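(* For any finite group $G$, the analog category of $G$ and the distributional category of $G$ coincide.
   Context: Topological spaces are taken in Steenrod's convenient category (compactly generated Hausdorff spaces), and products, limits and mapping spaces are formed there. For a discrete group $G$, $BG$ is its classifying space, i.e. the geometric realization of its nerve. For a space $X$, $\mathcal{P}(X)$ is the set of probability measures on $X$ with finite support, with the quotient topology inherited from the maps $X^n\times\Delta^{n-1}\to\mathcal{P}(X)$, $(x,t)\mapsto\sum_{i=1}^n t_i\delta_{x_i}$, where $\Delta^{n-1}=\{(t_1,\ldots,t_n)\in[0,1]^n:\sum_i t_i=1\}$. $\mathcal{P}_n(X)\subseteq\mathcal{P}(X)$ is the subspace of measures with support of cardinality at most $n$. For a map $f:X\to Y$, $\mathcal{P}_n(f)\subseteq\mathcal{P}_n(X)$ is the subspace of measures whose support lies in a single fiber of $f$; it maps to $Y$ by sending a measure to the point in whose fiber it is supported. The analog sectional category of $f$ is the least $n$ such that $\mathcal{P}_{n+1}(f)\to Y$ admits a section. The analog category of a space $X$ is the analog sectional category of the evaluation map $\gamma\mapsto\gamma(1)$ to $X$ from the space $(X,x_0)^{([0,1],\{0\})}$ of paths $\gamma:[0,1]\to X$ with $\gamma(0)=x_0$, where $x_0\in X$ is any basepoint. The analog category of the group $G$ is the analog category of $BG$. The distributional invariants are defined in the same way, with the Lévy–Prokhorov metric in place of the quotient topology: for $X$ metric, $\mathcal{P}_n(X)_{\mathrm{LP}}$ is the set $\mathcal{P}_n(X)$ with the topology of the Lévy–Prokhorov metric, and for continuous $f:X\to Y$ with metric source, $\mathcal{P}_n(f)_{\mathrm{LP}}$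 is the set $\mathcal{P}_n(f)$ with the subspace topology from $\mathcal{P}_n(X)_{\mathrm{LP}}$. The distributional sectional category of such an $f$ is the least $n$ for which $\mathcal{P}_{n+1}(f)_{\mathrm{LP}}\to Y$ admits a section, and the distributional category of a metric space $X$ is the distributional sectional category of the evaluation map $(X,x_0)^{([0,1],\{0\})}\to X$. The distributional category of the finite group $G$ is the distributional category of $BG$, which for finite $G$ is taken to be metrizable. *)

theory Defs
  imports
    "HOL-Homology.Homology"
    "HOL-Probability.Probability_Mass_Function"
    "HOL-Algebra.Group"
    "HOL-Library.Extended_Nat"
begin

section \<open>Final topologies and Steenrod's convenient category\<close>

text \<open>
  Spaces of the convenient category are formed by applying \<open>kification\<close> to the
  naive construction.
\<close>

definition final_topology :: "'b set \<Rightarrow> ('i \<Rightarrow> 'a topology) \<Rightarrow> ('i \<Rightarrow> 'a \<Rightarrow> 'b) \<Rightarrow> 'b topology"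
  where "final_topology C T f =
    topology (\<lambda>U. U \<subseteq> C \<and> (\<forall>i. openin (T i) {x \<in> topspace (T i). f i x \<in> U}))"

lemma openin_final_topology:
  "openin (final_topology C T f) U \<longleftrightarrow>
    U \<subseteq> C \<and> (\<forall>i. openin (T i) {x \<in> topspace (T i). f i x \<in> U})"
proof -
  have "istopology (\<lambda>U. U \<subseteq> C \<and> (\<forall>i. openin (T i) {x \<in> topspace (T i). f i x \<in> U}))"
    unfolding istopology_def
  proof (intro conjI allI impI; (elim conjE)?)
    fix S S' i
    assume "\<forall>i. openin (T i) {x \<in> topspace (T i). f i x \<in> S}"
      "\<forall>i. openin (T i) {x \<in> topspace (T i). f i x \<in> S'}"
    then have "openin (T i) ({x \<in> topspace (T i). f i x \<in> S} \<inter> {x \<in> topspace (T i). f i x \<in> S'})"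
      by blast
    moreover have "{x \<in> topspace (T i). f i x \<in> S} \<inter> {x \<in> topspace (T i). f i x \<in> S'}
        = {x \<in> topspace (T i). f i x \<in> S \<inter> S'}"
      by blast
    ultimately show "openin (T i) {x \<in> topspace (T i). f i x \<in> S \<inter> S'}"
      by simp
  next
    fix \<K> i
    assume "\<forall>K\<in>\<K>. K \<subseteq> C \<and> (\<forall>i. openin (T i) {x \<in> topspace (T i). f i x \<in> K})"
    then have "openin (T i) (\<Union>K\<in>\<K>. {x \<in> topspace (T i). f i x \<in> K})"
      by blast
    moreover have "(\<Union>K\<in>\<K>. {x \<in> topspace (T i). f i x \<in> K})
        = {x \<in> topspace (T i). f i x \<in> \<Union>\<K>}"
      by blast
    ultimately show "openin (T i) {x \<in> topspace (T i). f i x \<in> \<Union>\<K>}"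
      by simp
  qed blast+
  then show ?thesis
    by (simp add: final_topology_def)
qed

lemma topspace_final_topology:
  assumes "\<And>i. f i \<in> topspace (T i) \<rightarrow> C"
  shows "topspace (final_topology C T f) = C"
proof -
  have "{x \<in> topspace (T i). f i x \<in> C} = topspace (T i)" for i
    using assms[of i] by blast
  then have "openin (final_topology C T f) C"
    by (simp add: openin_final_topology)
  then show ?thesis
    by (meson openin_final_topology openin_subset openin_topspace subset_antisym)
qed

abbreviation simplex_topology :: "nat \<Rightarrow> (nat \<Rightarrow> real) topology"
  where "simplex_topology n \<equiv> subtopology (powertop_real UNIV) (standard_simplex n)"

definition cg_mapping_space :: "'a topology \<Rightarrow> 'b topology \<Rightarrow> ('a \<Rightarrow> 'b) topology"
  where "cg_mapping_space X Y = kification (topology_generated_by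
    {{f \<in> extensional (topspace X). continuous_map X Y f \<and> f ` K \<subseteq> U} | K U.
      compactin X K \<and> openin Y U})"


section \<open>Classifying spaces\<close>

text \<open>
  A simplicial set is given by its sets of simplices \<open>S n\<close> and the action
  \<open>act m \<theta> \<sigma>\<close> in \<open>S m\<close> of monotone maps \<open>\<theta>\<close> from
  \<open>{0,\<dots>,m}\<close> to \<open>{0,\<dots>,n}\<close> on \<open>\<sigma> \<in> S n\<close>.
  The realization is the quotient of the disjoint union of the \<open>S n \<times> \<Delta>\<^sup>n\<close>
  by the equivalence relation generated by
  \<open>(\<theta>\<^sup>*\<sigma>, t) \<sim> (\<sigma>, \<theta>\<^sub>* t)\<close>.
\<close>

definition simplex_push :: "nat \<Rightarrow> (nat \<Rightarrow> nat) \<Rightarrow> (nat \<Rightarrow> real) \<Rightarrow> nat \<Rightarrow> real"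
  where "simplex_push m \<theta> t = (\<lambda>j. \<Sum>i \<in> {i. i \<le> m \<and> \<theta> i = j}. t i)"

inductive realization_glue ::
  "(nat \<Rightarrow> 's set) \<Rightarrow> (nat \<Rightarrow> (nat \<Rightarrow> nat) \<Rightarrow> 's \<Rightarrow> 's) \<Rightarrow>
    nat \<times> 's \<times> (nat \<Rightarrow> real) \<Rightarrow> nat \<times> 's \<times> (nat \<Rightarrow> real) \<Rightarrow> bool"
  for S act where
  "\<lbrakk>\<theta> \<in> {..m} \<rightarrow> {..n}; mono_on {..m} \<theta>; \<sigma> \<in> S n; t \<in> standard_simplex m\<rbrakk> \<Longrightarrow>
    realization_glue S act (m, act m \<theta> \<sigma>, t) (n, \<sigma>, simplex_push m \<theta> t)"

definition realization_class ::
  "(nat \<Rightarrow> 's set) \<Rightarrow> (nat \<Rightarrow> (nat \<Rightarrow> nat) \<Rightarrow> 's \<Rightarrow> 's) \<Rightarrow>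
    nat \<times> 's \<times> (nat \<Rightarrow> real) \<Rightarrow> (nat \<times> 's \<times> (nat \<Rightarrow> real)) set"
  where "realization_class S act x = Collect (equivclp (realization_glue S act) x)"

definition geometric_realization ::
  "(nat \<Rightarrow> 's set) \<Rightarrow> (nat \<Rightarrow> (nat \<Rightarrow> nat) \<Rightarrow> 's \<Rightarrow> 's) \<Rightarrow>
    (nat \<times> 's \<times> (nat \<Rightarrow> real)) set topology"
  where "geometric_realization S act =
    final_topology
      (realization_class S act ` (SIGMA n:UNIV. S n \<times> standard_simplex n))
      (\<lambda>n. prod_topology (discrete_topology (S n)) (simplex_topology n))
      (\<lambda>n z. realization_class S act (n, z))"

text \<open>
  An n-simplex of the nerve is a functor from the poset \<open>{0,\<dots>,n}\<close> to the
  one-object category \<open>G\<close>: it sends each \<open>i \<le> j\<close> to a group element.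
\<close>

definition nerve :: "('g, 'b) monoid_scheme \<Rightarrow> nat \<Rightarrow> (nat \<times> nat \<Rightarrow> 'g) set"
  where "nerve G n = {\<sigma> \<in> {(i, j). i \<le> j \<and> j \<le> n} \<rightarrow>\<^sub>E carrier G.
    (\<forall>i\<le>n. \<sigma> (i, i) = \<one>\<^bsub>G\<^esub>) \<and>
    (\<forall>i j k. i \<le> j \<and> j \<le> k \<and> k \<le> n \<longrightarrow> \<sigma> (i, k) = \<sigma> (i, j) \<otimes>\<^bsub>G\<^esub> \<sigma> (j, k))}"

definition nerve_act :: "nat \<Rightarrow> (nat \<Rightarrow> nat) \<Rightarrow> (nat \<times> nat \<Rightarrow> 'g) \<Rightarrow> nat \<times> nat \<Rightarrow> 'g"
  where "nerve_act m \<theta> \<sigma> = (\<lambda>(i, j) \<in> {(i, j). i \<le> j \<and> j \<le> m}. \<sigma> (\<theta> i, \<theta> j))"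

definition classifying_space ::
  "('g, 'b) monoid_scheme \<Rightarrow> (nat \<times> (nat \<times> nat \<Rightarrow> 'g) \<times> (nat \<Rightarrow> real)) set topology"
  where "classifying_space G = geometric_realization (nerve G) nerve_act"

text \<open>
  For nontrivial finite \<open>G\<close> this CW complex is not locally finite, hence not metrizable.
  Distributional invariants of \<open>G\<close> refer to a metrizable model: any metric space
  homotopy equivalent to \<open>classifying_space G\<close>.
\<close>


section \<open>Finitely supported probability measures\<close>

definition finite_measures :: "'a set \<Rightarrow> 'a pmf set"
  where "finite_measures A = {p. finite (set_pmf p) \<and> set_pmf p \<subseteq> A}"

definition measures_upto :: "nat \<Rightarrow> 'a set \<Rightarrow> 'a pmf set"
  where "measures_upto n A = {p \<in> finite_measures A. card (set_pmf p) \<le> n}"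

definition fiber_measures_upto :: "nat \<Rightarrow> 'a set \<Rightarrow> 'b set \<Rightarrow> ('a \<Rightarrow> 'b) \<Rightarrow> 'a pmf set"
  where "fiber_measures_upto n A B f =
    {p \<in> measures_upto n A. \<exists>y\<in>B. \<forall>x\<in>set_pmf p. f x = y}"

definition fiber_projection :: "('a \<Rightarrow> 'b) \<Rightarrow> 'a pmf \<Rightarrow> 'b"
  where "fiber_projection f p = the_elem (f ` set_pmf p)"


section \<open>Analog invariants\<close>

text \<open>
  For \<open>t \<in> standard_simplex m\<close>, the measure \<open>map_pmf x (embed_pmf t)\<close> is
  \<open>\<Sum>i\<le>m. t i * \<delta>(x i)\<close>; the index \<open>m\<close> plays the role of n - 1.
\<close>

definition analog_measures :: "'a topology \<Rightarrow> 'a pmf topology"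
  where "analog_measures X =
    final_topology (finite_measures (topspace X))
      (\<lambda>m. kification (prod_topology (product_topology (\<lambda>_. X) {..m}) (simplex_topology m)))
      (\<lambda>m (x, t). map_pmf x (embed_pmf t))"

definition analog_measures_upto :: "nat \<Rightarrow> 'a topology \<Rightarrow> 'a pmf topology"
  where "analog_measures_upto n X =
    kification (subtopology (analog_measures X) (measures_upto n (topspace X)))"

definition analog_fiber_measures ::
  "nat \<Rightarrow> 'a topology \<Rightarrow> 'b topology \<Rightarrow> ('a \<Rightarrow> 'b) \<Rightarrow> 'a pmf topology"
  where "analog_fiber_measures n X Y f =
    kification (subtopology (analog_measures_upto n X)
      (fiber_measures_upto n (topspace X) (topspace Y) f))"

definition analog_sectional_category ::
  "'a topology \<Rightarrow> 'b topology \<Rightarrow> ('a \<Rightarrow> 'b) \<Rightarrow> enat"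
  where "analog_sectional_category X Y f =
    Inf {enat n | n. \<exists>s. continuous_map Y (analog_fiber_measures (Suc n) X Y f) s \<and>
      (\<forall>y\<in>topspace Y. fiber_projection f (s y) = y)}"

abbreviation unit_interval :: "real topology"
  where "unit_interval \<equiv> top_of_set {0..1}"

definition based_paths :: "'a topology \<Rightarrow> 'a \<Rightarrow> (real \<Rightarrow> 'a) set"
  where "based_paths X x0 =
    {\<gamma> \<in> extensional {0..1}. continuous_map unit_interval X \<gamma> \<and> \<gamma> 0 = x0}"

definition based_path_space :: "'a topology \<Rightarrow> 'a \<Rightarrow> (real \<Rightarrow> 'a) topology"
  where "based_path_space X x0 =
    kification (subtopology (cg_mapping_space unit_interval X) (based_paths X x0))"

definition analog_category :: "'a topology \<Rightarrow> 'a \<Rightarrow> enat"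
  where "analog_category X x0 =
    analog_sectional_category (based_path_space X x0) X (\<lambda>\<gamma>. \<gamma> 1)"


section \<open>Distributional invariants\<close>

definition thickening :: "'a set \<Rightarrow> ('a \<Rightarrow> 'a \<Rightarrow> real) \<Rightarrow> real \<Rightarrow> 'a set \<Rightarrow> 'a set"
  where "thickening M d e A = {x \<in> M. \<exists>a\<in>A. d a x < e}"

definition levy_prokhorov_dist ::
  "'a set \<Rightarrow> ('a \<Rightarrow> 'a \<Rightarrow> real) \<Rightarrow> 'a pmf \<Rightarrow> 'a pmf \<Rightarrow> real"
  where "levy_prokhorov_dist M d p q =
    Inf {e. 0 < e \<and>
      (\<forall>A \<in> sigma_sets M {U. openin (Metric_space.mtopology M d) U}.
        measure_pmf.prob p A \<le> measure_pmf.prob q (thickening M d e A) + e \<and>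
        measure_pmf.prob q A \<le> measure_pmf.prob p (thickening M d e A) + e)}"

lemma Metric_space_levy_prokhorov:
  assumes "Metric_space M d"
  shows "Metric_space (measures_upto n M) (levy_prokhorov_dist M d)"
proof -
  interpret Metric_space M d by fact
  let ?B = "sigma_sets M {U. openin mtopology U}"
  define L where "L p q = {e. 0 < e \<and> (\<forall>A\<in>?B.
        measure_pmf.prob p A \<le> measure_pmf.prob q (thickening M d e A) + e \<and>
        measure_pmf.prob q A \<le> measure_pmf.prob p (thickening M d e A) + e)}" for p q
  have D: "levy_prokhorov_dist M d p q = Inf (L p q)" for p q
    by (simp add: levy_prokhorov_dist_def L_def)
  have sym: "L p q = L q p" for p q unfolding L_def by blast
  have one: "1 \<in> L p q" for p q
    unfolding L_def by (auto intro!: add_increasing measure_pmf.prob_le_1)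
  have bdd: "bdd_below (L p q)" for p q unfolding L_def by (intro bdd_belowI[of _ 0]) auto
  have nn: "0 \<le> levy_prokhorov_dist M d p q" for p q
    unfolding D using one[of p q] by (intro cInf_greatest) (blast, simp add: L_def)
  have up: "e' \<in> L p q" if "e \<in> L p q" "e \<le> e'" for e e' p q
  proof -
    have "thickening M d e A \<subseteq> thickening M d e' A" for A
      using that by (force simp: thickening_def)
    then have "measure_pmf.prob r (thickening M d e A) \<le> measure_pmf.prob r (thickening M d e' A)" for r A
      by (intro measure_pmf.finite_measure_mono) auto
    then have *: "measure_pmf.prob r (thickening M d e A) + e
        \<le> measure_pmf.prob r (thickening M d e' A) + e'" for r A
      using that(2) by (rule add_mono)
    have "0 < e'" using that by (simp add: L_def)
    then show ?thesis using that(1) order_trans[OF _ *] unfolding L_def by blast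
  qed
  have inL: "e \<in> L p q" if lt: "levy_prokhorov_dist M d p q < e" for p q e
  proof -
    obtain e' where "e' \<in> L p q" "e' < e"
      using lt cInf_lessD[of "L p q" e] one[of p q] unfolding D by blast
    then show ?thesis using up[of e' p q e] by simp
  qed
  have AM: "A \<subseteq> M" if "A \<in> ?B" for A
    using that by (rule sigma_sets_into_sp[rotated]) (use openin_subset topspace_mtopology in blast)
  have thop: "thickening M d e A \<in> ?B" if "A \<in> ?B" for A e
  proof -
    have "thickening M d e A = (\<Union>a\<in>A. mball a e)"
      using AM[OF that] unfolding thickening_def by (auto simp: subset_iff)
    moreover have "openin mtopology (\<Union>a\<in>A. mball a e)"
      by (intro openin_Union) auto
    ultimately show ?thesis by (simp add: sigma_sets.Basic)
  qed
  have tri: "e + e' \<in> L p r" if e: "e \<in> L p q" and e': "e' \<in> L q r" for e e' p q r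
  proof -
    have sub: "thickening M d x (thickening M d y A) \<subseteq> thickening M d (x+y) A" if "A \<in> ?B" for x y A
    proof
      fix z assume "z \<in> thickening M d x (thickening M d y A)"
      then obtain w a where "z \<in> M" "w \<in> M" "a \<in> A" "d w z < x" "d a w < y"
        by (auto simp: thickening_def)
      moreover have "a \<in> M" using \<open>a \<in> A\<close> AM that by blast
      ultimately have "d a z < x + y" using triangle[of a w z] by linarith
      then show "z \<in> thickening M d (x+y) A" using \<open>z \<in> M\<close> \<open>a \<in> A\<close> by (auto simp: thickening_def)
    qed
    have "0 < e" "0 < e'" using that by (auto simp: L_def)
    moreover have "measure_pmf.prob p A \<le> measure_pmf.prob r (thickening M d (e+e') A) + (e+e')
       \<and> measure_pmf.prob r A \<le> measure_pmf.prob p (thickening M d (e+e') A) + (e+e')" if A: "A \<in> ?B" for A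
    proof -
      have "measure_pmf.prob p A \<le> measure_pmf.prob q (thickening M d e A) + e"
        using e A by (auto simp: L_def)
      moreover have "measure_pmf.prob q (thickening M d e A) \<le> measure_pmf.prob r (thickening M d e' (thickening M d e A)) + e'"
        using e' thop[OF A] unfolding L_def by blast
      moreover have "measure_pmf.prob r (thickening M d e' (thickening M d e A)) \<le> measure_pmf.prob r (thickening M d (e+e') A)"
        using sub[OF A, of e' e] by (intro measure_pmf.finite_measure_mono) (auto simp: add.commute)
      moreover have "measure_pmf.prob r A \<le> measure_pmf.prob q (thickening M d e' A) + e'"
        using e' A by (auto simp: L_def)
      moreover have "measure_pmf.prob q (thickening M d e' A) \<le> measure_pmf.prob p (thickening M d e (thickening M d e' A)) + e"
        using e thop[OF A] unfolding L_def by blast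
      moreover have "measure_pmf.prob p (thickening M d e (thickening M d e' A)) \<le> measure_pmf.prob p (thickening M d (e+e') A)"
        using sub[OF A, of e e'] by (intro measure_pmf.finite_measure_mono) auto
      ultimately show ?thesis by linarith
    qed
    ultimately show ?thesis unfolding L_def by simp
  qed
  have triangle_ineq: "levy_prokhorov_dist M d p r \<le> levy_prokhorov_dist M d p q + levy_prokhorov_dist M d q r" for p q r
  proof (rule field_le_epsilon)
    fix e :: real assume "0 < e"
    then have "(levy_prokhorov_dist M d p q + e/2) + (levy_prokhorov_dist M d q r + e/2) \<in> L p r"
      by (intro tri[of _ p q _ r] inL) auto
    from cInf_lower[OF this bdd]
    show "levy_prokhorov_dist M d p r \<le> levy_prokhorov_dist M d p q + levy_prokhorov_dist M d q r + e"
      unfolding D[of p r] by (simp add: algebra_simps)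
  qed
  have self: "levy_prokhorov_dist M d p p = 0" if "p \<in> measures_upto n M" for p
  proof -
    have "e \<in> L p p" if "0 < e" for e
    proof -
      have "measure_pmf.prob p A \<le> measure_pmf.prob p (thickening M d e A) + e" if A: "A \<in> ?B" for A
      proof -
        have "A \<subseteq> thickening M d e A" using AM[OF A] \<open>0 < e\<close> by (force simp: thickening_def)
        then have "measure_pmf.prob p A \<le> measure_pmf.prob p (thickening M d e A)"
          by (intro measure_pmf.finite_measure_mono) auto
        then show ?thesis using \<open>0 < e\<close> by linarith
      qed
      then show ?thesis using that by (auto simp: L_def)
    qed
    then have "levy_prokhorov_dist M d p p \<le> e" if "0 < e" for e
      unfolding D using that by (intro cInf_lower bdd) auto
    then have "levy_prokhorov_dist M d p p \<le> 0" by (rule field_le_epsilon[of _ 0, simplified])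
    then show ?thesis using nn[of p p] by linarith
  qed
  have pt: "pmf p x \<le> pmf q x"
    if q: "q \<in> measures_upto n M" and 0: "levy_prokhorov_dist M d p q = 0" and x: "x \<in> M" for p q x
  proof (rule field_le_epsilon)
    fix e :: real assume e: "0 < e"
    have fin: "finite (set_pmf q)" "set_pmf q \<subseteq> M"
      using q by (auto simp: measures_upto_def finite_measures_def)
    let ?S = "insert e (d x ` (set_pmf q - {x}))"
    define k where "k = Min ?S"
    have "k > 0" unfolding k_def using fin e x by (subst Min_gr_iff) auto
    have "k \<le> e" unfolding k_def using fin by (intro Min_le) auto
    have kd: "k \<le> d x y" if "y \<in> set_pmf q" "y \<noteq> x" for y
      unfolding k_def using fin that by (intro Min_le) auto
    have "closedin mtopology {x}" using x by (simp add: closedin_t1_singleton t1_space_mtopology)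
    then have "{x} = M - (M - {x})" "openin mtopology (M - {x})"
      using x by (auto simp: closedin_def)
    then have B: "{x} \<in> ?B" by (metis (mono_tags) mem_Collect_eq sigma_sets.Basic sigma_sets.Compl)
    have "k \<in> L p q" using 0 \<open>k > 0\<close> by (auto intro: inL)
    then have "measure_pmf.prob p {x} \<le> measure_pmf.prob q (thickening M d k {x}) + k"
      using B unfolding L_def by blast
    moreover have "measure_pmf.prob q (thickening M d k {x}) = measure_pmf.prob q (thickening M d k {x} \<inter> set_pmf q)"
      by (simp add: measure_Int_set_pmf)
    moreover have "measure_pmf.prob q (thickening M d k {x} \<inter> set_pmf q) \<le> measure_pmf.prob q {x}"
      using kd by (intro measure_pmf.finite_measure_mono) (force simp: thickening_def)+
    ultimately show "pmf p x \<le> pmf q x + e" using \<open>k \<le> e\<close> by (simp add: measure_pmf_single)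
  qed
  have com: "levy_prokhorov_dist M d p q = levy_prokhorov_dist M d q p" for p q
    unfolding D by (subst sym) (rule refl)
  show ?thesis
  proof
    fix p q assume p: "p \<in> measures_upto n M" and q: "q \<in> measures_upto n M"
    have S: "levy_prokhorov_dist M d p q = levy_prokhorov_dist M d q p" by (rule com)
    show "levy_prokhorov_dist M d p q = 0 \<longleftrightarrow> p = q"
    proof
      assume 0: "levy_prokhorov_dist M d p q = 0"
      show "p = q"
      proof (rule pmf_eqI)
        fix x show "pmf p x = pmf q x"
        proof (cases "x \<in> M")
          case True then show ?thesis using pt[OF q 0] pt[OF p, of q] 0 S by (metis order_antisym)
        next
          case False
          then have "x \<notin> set_pmf p" "x \<notin> set_pmf q"
            using p q by (auto simp: measures_upto_def finite_measures_def)
          then show ?thesis by (simp add: set_pmf_iff)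
        qed
      qed
    qed (use self p in blast)
  qed (rule nn triangle_ineq com)+
qed

definition distributional_measures_upto ::
  "nat \<Rightarrow> 'a set \<Rightarrow> ('a \<Rightarrow> 'a \<Rightarrow> real) \<Rightarrow> 'a pmf topology"
  where "distributional_measures_upto n M d =
    Metric_space.mtopology (measures_upto n M) (levy_prokhorov_dist M d)"

definition distributional_fiber_measures ::
  "nat \<Rightarrow> 'a set \<Rightarrow> ('a \<Rightarrow> 'a \<Rightarrow> real) \<Rightarrow> 'b topology \<Rightarrow> ('a \<Rightarrow> 'b) \<Rightarrow> 'a pmf topology"
  where "distributional_fiber_measures n M d Y f =
    subtopology (distributional_measures_upto n M d) (fiber_measures_upto n M (topspace Y) f)"

definition distributional_sectional_category ::
  "'a set \<Rightarrow> ('a \<Rightarrow> 'a \<Rightarrow> real) \<Rightarrow> 'b topology \<Rightarrow> ('a \<Rightarrow> 'b) \<Rightarrow> enat"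
  where "distributional_sectional_category M d Y f =
    Inf {enat n | n. \<exists>s. continuous_map Y (distributional_fiber_measures (Suc n) M d Y f) s \<and>
      (\<forall>y\<in>topspace Y. fiber_projection f (s y) = y)}"

text \<open>
  The uniform metric induces the compact-open topology on paths in a metric space.
  Paths are bounded, so the else-branch never applies to them; it makes the distance
  nonnegative on arbitrary functions, as \<^locale>\<open>Metric_space\<close> demands.
\<close>

definition path_dist :: "('a \<Rightarrow> 'a \<Rightarrow> real) \<Rightarrow> (real \<Rightarrow> 'a) \<Rightarrow> (real \<Rightarrow> 'a) \<Rightarrow> real"
  where "path_dist d \<gamma> \<delta> =
    (if bdd_above ((\<lambda>t. d (\<gamma> t) (\<delta> t)) ` {0..1})
     then SUP t\<in>{0..1}. d (\<gamma> t) (\<delta> t) else 0)"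

lemma Metric_space_path_dist:
  assumes "Metric_space M d"
  shows "Metric_space (based_paths (Metric_space.mtopology M d) x0) (path_dist d)"
proof -
  interpret Metric_space M d by fact
  let ?P = "based_paths mtopology x0"
  have inM: "\<gamma> t \<in> M" if "\<gamma> \<in> ?P" "t \<in> {0..1}" for \<gamma> t
    using that by (force simp: based_paths_def continuous_map_def)
  have bdd: "bdd_above ((\<lambda>t. d (\<gamma> t) (\<delta> t)) ` {0..1})" if "\<gamma> \<in> ?P" "\<delta> \<in> ?P" for \<gamma> \<delta>
  proof -
    have "continuous_map unit_interval euclidean (\<lambda>t. d (\<gamma> t) (\<delta> t))"
      using that continuous_map_mdist[of unit_interval "metric (M, d)" \<gamma> \<delta>]
      by (simp add: based_paths_def)
    then have "continuous_on {0..1} (\<lambda>t. d (\<gamma> t) (\<delta> t))"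
      by simp
    then show ?thesis
      by (meson compact_Icc compact_continuous_image compact_imp_bounded bounded_imp_bdd_above)
  qed
  have le: "d (\<gamma> t) (\<delta> t) \<le> path_dist d \<gamma> \<delta>" if "\<gamma> \<in> ?P" "\<delta> \<in> ?P" "t \<in> {0..1}" for \<gamma> \<delta> t
    using bdd[OF that(1,2)] cSUP_upper[OF that(3) bdd[OF that(1,2)]] by (simp add: path_dist_def)
  have least: "path_dist d \<gamma> \<delta> \<le> c"
    if "\<gamma> \<in> ?P" "\<delta> \<in> ?P" "\<And>t. t \<in> {0..1} \<Longrightarrow> d (\<gamma> t) (\<delta> t) \<le> c" for \<gamma> \<delta> c
    using bdd[OF that(1,2)] that(3) unfolding path_dist_def by (auto intro!: cSUP_least)
  show ?thesis
  proof
    fix \<gamma> \<delta>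
    show "path_dist d \<gamma> \<delta> = path_dist d \<delta> \<gamma>"
      by (simp add: path_dist_def commute)
    show "0 \<le> path_dist d \<gamma> \<delta>"
      unfolding path_dist_def by (auto intro!: cSUP_upper2[where x = 0])
  next
    fix \<gamma> \<delta> assume P: "\<gamma> \<in> ?P" "\<delta> \<in> ?P"
    show "path_dist d \<gamma> \<delta> = 0 \<longleftrightarrow> \<gamma> = \<delta>"
    proof
      assume 0: "path_dist d \<gamma> \<delta> = 0"
      have "\<gamma> t = \<delta> t" if "t \<in> {0..1}" for t
        using le[OF P that] 0 inM[OF P(1) that] inM[OF P(2) that] mdist_pos_less by fastforce
      then show "\<gamma> = \<delta>"
        using P by (intro extensionalityI[of _ "{0..1}"]) (auto simp: based_paths_def)
    next
      assume "\<gamma> = \<delta>"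
      then have "path_dist d \<gamma> \<delta> \<le> 0"
        using P inM by (intro least) auto
      then show "path_dist d \<gamma> \<delta> = 0"
        using order_trans[OF nonneg le[OF P, of 0]] by simp
    qed
  next
    fix \<gamma> \<delta> \<epsilon> assume P: "\<gamma> \<in> ?P" "\<delta> \<in> ?P" "\<epsilon> \<in> ?P"
    show "path_dist d \<gamma> \<epsilon> \<le> path_dist d \<gamma> \<delta> + path_dist d \<delta> \<epsilon>"
    proof (rule least)
      fix t :: real assume t: "t \<in> {0..1}"
      show "d (\<gamma> t) (\<epsilon> t) \<le> path_dist d \<gamma> \<delta> + path_dist d \<delta> \<epsilon>"
        using le[OF P(1,2) t] le[OF P(2,3) t] triangle[of "\<gamma> t" "\<delta> t" "\<epsilon> t"] inM t P by fastforce
    qed (use P in auto)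
  qed
qed

definition distributional_category :: "'a set \<Rightarrow> ('a \<Rightarrow> 'a \<Rightarrow> real) \<Rightarrow> 'a \<Rightarrow> enat"
  where "distributional_category M d x0 =
    distributional_sectional_category
      (based_paths (Metric_space.mtopology M d) x0) (path_dist d)
      (Metric_space.mtopology M d) (\<lambda>\<gamma>. \<gamma> 1)"

end

theory Submission
  imports Defs
begin

text \<open>
  Sending a measure on paths to the measure on ends of lifts turns a section over \<open>B = BG\<close> into a
  function on a covering, where neither path spaces nor topologies on measures occur any more.

  Let \<open>L\<close> be the space of step functions from \<open>[0,1)\<close> to \<open>G\<close>, where the distance of two step functions
  is the measure of the set on which they disagree. \<open>G\<close> acts on \<open>L\<close> by left translation, isometrically,
  and moves every point by distance 1. A simplex of the nerve with barycentric coordinates \<open>t\<close> is a step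
  function, with steps of lengths \<open>t 0, \<dots>, t n\<close>, up to translation, so every point \<open>b\<close> of \<open>B\<close> has a
  fibre of \<open>card G\<close> step functions. This is the universal covering of \<open>B\<close>; the locale
  \<open>finite_covering\<close> isolates the properties of the fibres from which local triviality and path lifting
  follow, namely constant cardinality, mutual distance at least 1, and lower semicontinuity.

  For a map \<open>\<phi>\<close> from \<open>X\<close> to \<open>B\<close>, let weights of support at most \<open>n\<close> be a continuous real function on the
  pulled back covering that restricts to a probability distribution with at most \<open>n\<close> points on each
  fibre. Three facts give the theorem.

  \<^item> A section of fibre measures gives weights (\<open>weights_of_measures\<close>): the weight of a point of the
    fibre is the mass of the paths whose lift ends there. In the quotient topology as well as in the
    Levy-Prokhorov topology the mass of an open set is lower semicontinuous. As the weights in a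
    fibre add up to 1, they are continuous.

  \<^item> Weights give a section (\<open>continuous_map_analog_path_measure\<close>,
    \<open>continuous_map_distributional_path_measure\<close>): the universal covering contracts to a point by
    coning off simplices, so each of its points determines a path, depending continuously on the
    point, and the weights can be pushed forward to paths. As the covering has finitely many
    sheets, the resulting measure is locally a sum \<open>\<Sum>i. w i * \<delta>(\<gamma> i)\<close> over a fixed finite index set with
    continuous \<open>w i\<close> and \<open>\<gamma> i\<close>, which is continuous in both topologies.

  \<^item> The existence of weights is invariant under homotopy equivalence (\<open>weights_homotopy_transfer\<close>),
    because paths lift to coverings. This leads from the metric model back to \<open>BG\<close>.

  Thus each of the two categories is the least \<open>n\<close> for which \<open>BG\<close> carries weights of support at most
  \<open>n + 1\<close>.
\<close>

section \<open>Continuous families of paths\<close>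

text \<open>
  This says that \<open>P\<close> is continuous into the compact-open topology, without forming a space of paths. It is
  the property by which all path spaces below, with their different topologies, are accessed.
\<close>

definition path_family :: "'z topology \<Rightarrow> 'y topology \<Rightarrow> ('z \<Rightarrow> real \<Rightarrow> 'y) \<Rightarrow> bool"
  where "path_family Z Y P \<longleftrightarrow>
    (\<forall>z\<in>topspace Z. continuous_map unit_interval Y (P z)) \<and>
    (\<forall>K V. compact K \<and> K \<subseteq> {0..1} \<and> openin Y V \<longrightarrow> openin Z {z \<in> topspace Z. P z ` K \<subseteq> V})"

lemma path_familyI:
  assumes "\<And>z. z \<in> topspace Z \<Longrightarrow> continuous_map unit_interval Y (P z)"
    and "\<And>K V. \<lbrakk>compact K; K \<subseteq> {0..1}; openin Y V\<rbrakk> \<Longrightarrow> openin Z {z \<in> topspace Z. P z ` K \<subseteq> V}"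
  shows "path_family Z Y P"
  using assms by (simp add: path_family_def)

lemma path_family_path:
  "path_family Z Y P \<Longrightarrow> z \<in> topspace Z \<Longrightarrow> continuous_map unit_interval Y (P z)"
  by (simp add: path_family_def)

lemma path_family_openin:
  "\<lbrakk>path_family Z Y P; compact K; K \<subseteq> {0..1}; openin Y V\<rbrakk> \<Longrightarrow> openin Z {z \<in> topspace Z. P z ` K \<subseteq> V}"
  by (simp add: path_family_def)

lemma path_family_in_topspace:
  "\<lbrakk>path_family Z Y P; z \<in> topspace Z; t \<in> {0..1}\<rbrakk> \<Longrightarrow> P z t \<in> topspace Y"
  using path_family_path[of Z Y P z] by (auto simp: continuous_map_def)

lemma path_family_const: "continuous_map unit_interval Y p \<Longrightarrow> path_family Z Y (\<lambda>z. p)"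
proof (rule path_familyI)
  show "openin Z {z \<in> topspace Z. p ` K \<subseteq> V}" for K V
    by (cases "p ` K \<subseteq> V") auto
qed

lemma path_family_compose:
  assumes P: "path_family Z Y P" and g: "continuous_map Y Y' g"
  shows "path_family Z Y' (\<lambda>z t. g (P z t))"
proof (rule path_familyI)
  show "continuous_map unit_interval Y' (\<lambda>t. g (P z t))" if "z \<in> topspace Z" for z
    using continuous_map_compose[OF path_family_path[OF P that] g] by (simp add: o_def)
  fix K :: "real set" and V assume K: "compact K" "K \<subseteq> {0..1}" and V: "openin Y' V"
  have "{z \<in> topspace Z. (\<lambda>t. g (P z t)) ` K \<subseteq> V}
      = {z \<in> topspace Z. P z ` K \<subseteq> {y \<in> topspace Y. g y \<in> V}}"
    using path_family_in_topspace[OF P] K by (auto simp: image_subset_iff subset_iff)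
  then show "openin Z {z \<in> topspace Z. (\<lambda>t. g (P z t)) ` K \<subseteq> V}"
    using path_family_openin[OF P K openin_continuous_map_preimage[OF g V]] by simp
qed

lemma path_family_reindex:
  assumes P: "path_family Z Y P" and h: "continuous_map Z' Z h"
  shows "path_family Z' Y (\<lambda>z. P (h z))"
proof (rule path_familyI)
  have hZ: "h z \<in> topspace Z" if "z \<in> topspace Z'" for z
    using h that by (auto simp: continuous_map_def)
  show "continuous_map unit_interval Y (P (h z))" if "z \<in> topspace Z'" for z
    using path_family_path[OF P hZ[OF that]] .
  fix K :: "real set" and V assume K: "compact K" "K \<subseteq> {0..1}" and V: "openin Y V"
  have "{z \<in> topspace Z'. P (h z) ` K \<subseteq> V}
      = {z \<in> topspace Z'. h z \<in> {z \<in> topspace Z. P z ` K \<subseteq> V}}"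
    using hZ by auto
  then show "openin Z' {z \<in> topspace Z'. P (h z) ` K \<subseteq> V}"
    using openin_continuous_map_preimage[OF h path_family_openin[OF P K V]] by simp
qed

text \<open>
  The tube lemma.
\<close>

lemma openin_forall_compact:
  assumes "compact K" and "openin (prod_topology Z (top_of_set K)) W"
  shows "openin Z {z \<in> topspace Z. \<forall>t\<in>K. (z, t) \<in> W}"
proof -
  let ?C = "topspace Z \<times> K - W"
  have "closedin (prod_topology Z (top_of_set K)) ?C"
    using assms(2) closedin_diff[OF closedin_topspace assms(2)] by simp
  moreover have "closed_map (prod_topology Z (top_of_set K)) Z fst"
    using assms(1) by (intro closed_map_fst) (simp add: compact_space_subtopology compactin_euclidean_iff)
  ultimately have "closedin Z (fst ` ?C)"
    by (simp add: closed_map_def)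
  moreover have "{z \<in> topspace Z. \<forall>t\<in>K. (z, t) \<in> W} = topspace Z - fst ` ?C"
    by force
  ultimately show ?thesis by (simp add: openin_diff)
qed

lemma path_family_of_homotopy:
  assumes H: "continuous_map (prod_topology Z unit_interval) Y (\<lambda>(z, t). P z t)"
  shows "path_family Z Y P"
proof (rule path_familyI)
  show "continuous_map unit_interval Y (P z)" if "z \<in> topspace Z" for z
    using continuous_map_compose[OF _ H, of unit_interval "\<lambda>t. (z, t)"] that
    by (simp add: o_def continuous_map_pairedI)
  fix K :: "real set" and V assume K: "compact K" "K \<subseteq> {0..1::real}" and V: "openin Y V"
  have HK: "continuous_map (prod_topology Z (top_of_set K)) Y (\<lambda>(z, t). P z t)"
    using K by (intro continuous_map_from_subtopology_mono[OF H[unfolded prod_topology_subtopology(2)],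
        of "topspace Z \<times> K", folded prod_topology_subtopology(2)]) auto
  have "openin (prod_topology Z (top_of_set K)) {w \<in> topspace Z \<times> K. (\<lambda>(z, t). P z t) w \<in> V}"
    using openin_continuous_map_preimage[OF HK V] by simp
  from openin_forall_compact[OF K(1) this]
  show "openin Z {z \<in> topspace Z. P z ` K \<subseteq> V}"
    by (rule back_subst[of "openin Z"]) auto
qed

lemma continuous_map_interval_reverse: "continuous_map unit_interval unit_interval (\<lambda>t. 1 - t)"
proof -
  have "continuous_on {0..1} (\<lambda>t::real. 1 - t)" by (intro continuous_intros)
  then show ?thesis by auto
qed

definition path_concat :: "(real \<Rightarrow> 'y) \<Rightarrow> (real \<Rightarrow> 'y) \<Rightarrow> real \<Rightarrow> 'y"
  where "path_concat p q t = (if t \<le> 1/2 then p (2 * t) else q (2 * t - 1))"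

lemma continuous_map_path_concat:
  assumes p: "continuous_map unit_interval Y p" and q: "continuous_map unit_interval Y q"
    and "p 1 = q 0"
  shows "continuous_map unit_interval Y (path_concat p q)"
  unfolding path_concat_def
proof (rule continuous_map_cases_le)
  show "continuous_map (subtopology unit_interval {x \<in> topspace unit_interval. x \<le> 1/2}) Y (\<lambda>t. p (2 * t))"
    by (rule continuous_map_compose[OF _ p, unfolded o_def, of _ "\<lambda>t. 2 * t"])
      (auto simp: subtopology_subtopology intro!: continuous_intros)
  show "continuous_map (subtopology unit_interval {x \<in> topspace unit_interval. 1/2 \<le> x}) Y (\<lambda>t. q (2 * t - 1))"
    by (rule continuous_map_compose[OF _ q, unfolded o_def, of _ "\<lambda>t. 2 * t - 1"])
      (auto simp: subtopology_subtopology intro!: continuous_intros)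
next
  fix t :: real assume t: "t = 1/2"
  show "p (2 * t) = q (2 * t - 1)" unfolding t using assms(3) by simp
qed auto

lemma path_family_concat:
  assumes P: "path_family Z Y P" and Q: "path_family Z Y Q"
    and PQ: "\<And>z. z \<in> topspace Z \<Longrightarrow> P z 1 = Q z 0"
  shows "path_family Z Y (\<lambda>z. path_concat (P z) (Q z))"
proof (rule path_familyI)
  show "continuous_map unit_interval Y (path_concat (P z) (Q z))" if "z \<in> topspace Z" for z
    using continuous_map_path_concat path_family_path[OF P that] path_family_path[OF Q that] PQ[OF that] .
  fix K :: "real set" and V assume K: "compact K" "K \<subseteq> {0..1::real}" and V: "openin Y V"
  define K1 where "K1 = (\<lambda>t. 2 * t) ` (K \<inter> {0..1/2})"
  define K2 where "K2 = (\<lambda>t. 2 * t - 1) ` (K \<inter> {1/2..1})"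
  have K1: "compact K1" "K1 \<subseteq> {0..1}" and K2: "compact K2" "K2 \<subseteq> {0..1}"
    unfolding K1_def K2_def using K(1)
    by (auto intro!: compact_continuous_image continuous_intros compact_Int)
  have *: "path_concat (P z) (Q z) ` K \<subseteq> V \<longleftrightarrow> P z ` K1 \<subseteq> V \<and> Q z ` K2 \<subseteq> V"
    if z: "z \<in> topspace Z" for z
  proof -
    have "path_concat (P z) (Q z) ` K
       = path_concat (P z) (Q z) ` (K \<inter> {0..1/2}) \<union> path_concat (P z) (Q z) ` (K \<inter> {1/2..1})"
      using K(2) by (subst image_Un[symmetric]) (rule arg_cong[of _ _ "image _"], auto)
    moreover have "path_concat (P z) (Q z) ` (K \<inter> {0..1/2}) = P z ` K1"
      unfolding K1_def image_image by (rule image_cong) (auto simp: path_concat_def)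
    moreover have "path_concat (P z) (Q z) ` (K \<inter> {1/2..1}) = Q z ` K2"
      unfolding K2_def image_image
    proof (rule image_cong[OF refl])
      fix t assume t: "t \<in> K \<inter> {1/2..1}"
      show "path_concat (P z) (Q z) t = Q z (2 * t - 1)"
      proof (cases "t = 1/2")
        case True
        show ?thesis unfolding True using PQ[OF z] by (simp add: path_concat_def)
      qed (use t in \<open>auto simp: path_concat_def\<close>)
    qed
    ultimately show ?thesis by simp
  qed
  have "{z. z \<in> topspace Z \<and> path_concat (P z) (Q z) ` K \<subseteq> V}
      = {z. z \<in> topspace Z \<and> P z ` K1 \<subseteq> V} \<inter> {z. z \<in> topspace Z \<and> Q z ` K2 \<subseteq> V}"
    unfolding Collect_conj_eq[symmetric] by (rule Collect_cong) (meson *)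
  then show "openin Z {z \<in> topspace Z. path_concat (P z) (Q z) ` K \<subseteq> V}"
    using path_family_openin[OF P K1 V] path_family_openin[OF Q K2 V] by (simp add: openin_Int)
qed

text \<open>
  A compactness argument on the interval: \<open>R\<close> plays the role of an entourage, and neighbourhoods of
  \<open>z0\<close> that work on short pieces of the interval are intersected by bisection.
\<close>

lemma path_family_uniformly_close:
  assumes P: "path_family Z Y P" and z0: "z0 \<in> topspace Z"
    and R: "\<And>y. y \<in> topspace Y \<Longrightarrow> \<exists>V. openin Y V \<and> y \<in> V \<and> (\<forall>a\<in>V. \<forall>b\<in>V. R a b)"
  shows "\<exists>U. openin Z U \<and> z0 \<in> U \<and> (\<forall>z\<in>U. \<forall>t\<in>{0..1}. R (P z0 t) (P z t))"
proof -
  let ?Q = "\<lambda>a b. \<exists>U. openin Z U \<and> z0 \<in> U \<and> (\<forall>z\<in>U. \<forall>t\<in>{a..b} \<inter> {0..1}. R (P z0 t) (P z t))"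
  have "?Q 0 1"
  proof (rule Bolzano[of 0 1 ?Q])
    show "?Q a c" if ab: "?Q a b" and bc: "?Q b c" for a b c
    proof -
      obtain U U' where "openin Z U" "z0 \<in> U" "\<forall>z\<in>U. \<forall>t\<in>{a..b} \<inter> {0..1}. R (P z0 t) (P z t)"
        and "openin Z U'" "z0 \<in> U'" "\<forall>z\<in>U'. \<forall>t\<in>{b..c} \<inter> {0..1}. R (P z0 t) (P z t)"
        using ab bc by blast
      then show ?thesis
        by (intro exI[of _ "U \<inter> U'"]) (force simp: openin_Int)
    qed
  next
    fix x :: real assume x: "0 \<le> x" "x \<le> 1"
    then obtain V where V: "openin Y V" "P z0 x \<in> V" "\<forall>a\<in>V. \<forall>b\<in>V. R a b"
      using R[OF path_family_in_topspace[OF P z0, of x]] by auto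
    have "openin unit_interval {t \<in> {0..1}. P z0 t \<in> V}"
      using openin_continuous_map_preimage[OF path_family_path[OF P z0] V(1)] by simp
    then obtain e where e: "e > 0" "\<And>t. t \<in> {0..1} \<Longrightarrow> dist t x < e \<Longrightarrow> P z0 t \<in> V"
      using x V(2) unfolding openin_euclidean_subtopology_iff by force
    show "\<exists>d>0. \<forall>a b. a \<le> x \<and> x \<le> b \<and> b - a < d \<longrightarrow> ?Q a b"
    proof (intro exI[of _ e] conjI allI impI)
      fix a b assume ab: "a \<le> x \<and> x \<le> b \<and> b - a < e"
      have near: "P z0 t \<in> V" if "t \<in> {a..b} \<inter> {0..1}" for t
        using that ab by (intro e(2)) (auto simp: dist_real_def)
      have "openin Z {z \<in> topspace Z. P z ` ({a..b} \<inter> {0..1}) \<subseteq> V}"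
        by (rule path_family_openin[OF P _ _ V(1)]) (auto intro: compact_Int)
      then show "?Q a b"
        using near z0 V(3)
        by (intro exI[of _ "{z \<in> topspace Z. P z ` ({a..b} \<inter> {0..1}) \<subseteq> V}"])
          (auto simp: image_subset_iff)
    qed (use e in auto)
  qed auto
  then show ?thesis by simp
qed

section \<open>Finite coverings\<close>

text \<open>
  A covering with \<open>N\<close> sheets is recorded by its fibres only, as finite subsets of one metric space \<open>L\<close>; its
  total space is the set of pairs \<open>(b, u)\<close> with \<open>u \<in> fib b\<close>, topologized as a subspace of \<open>B \<times> L\<close>.
  Local triviality is a consequence: by lower semicontinuity, the fibre over a point near \<open>b\<close> meets each
  of the \<open>N\<close> disjoint balls of radius 1/2 around \<open>fib b\<close>, and by counting it meets each of them once.
\<close>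

locale finite_covering = Metric_space L d for L :: "'l set" and d +
  fixes B :: "'b topology" and fib :: "'b \<Rightarrow> 'l set" and N :: nat
  assumes fib_subset: "b \<in> topspace B \<Longrightarrow> fib b \<subseteq> L"
    and card_fib: "b \<in> topspace B \<Longrightarrow> card (fib b) = N"
    and N_pos: "0 < N"
    and fib_separated: "\<lbrakk>b \<in> topspace B; u \<in> fib b; v \<in> fib b; u \<noteq> v\<rbrakk> \<Longrightarrow> 1 \<le> d u v"
    and fib_lsc: "openin mtopology V \<Longrightarrow> openin B {b \<in> topspace B. fib b \<inter> V \<noteq> {}}"
begin

lemma finite_fib: "b \<in> topspace B \<Longrightarrow> finite (fib b)"
  using card_fib N_pos card_ge_0_finite by metis

lemma fib_nonempty: "b \<in> topspace B \<Longrightarrow> fib b \<noteq> {}"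
  using card_fib N_pos by fastforce

lemma fib_in: "b \<in> topspace B \<Longrightarrow> u \<in> fib b \<Longrightarrow> u \<in> L"
  using fib_subset by blast

lemma fib_unique:
  assumes "b \<in> topspace B" "u \<in> fib b" "v \<in> fib b" "w \<in> L" "d w u < 1/2" "d w v < 1/2"
  shows "u = v"
proof (rule ccontr)
  assume "u \<noteq> v"
  then have "1 \<le> d u v" using assms fib_separated by blast
  moreover have "d u v \<le> d u w + d w v" using assms fib_in by (intro triangle) auto
  ultimately show False using assms commute[of u w] by linarith
qed

text \<open>
  One half of Hausdorff distance less than \<open>e\<close>; for \<open>e \<le> 1/2\<close> the other half follows by counting, see
  \<open>near_sym\<close>.
\<close>

definition near :: "real \<Rightarrow> 'b \<Rightarrow> 'b \<Rightarrow> bool"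
  where "near e b c \<longleftrightarrow> (\<forall>u\<in>fib b. \<exists>v\<in>fib c. d u v < e)"

lemma near_refl: "b \<in> topspace B \<Longrightarrow> 0 < e \<Longrightarrow> near e b b"
  unfolding near_def using fib_in by (metis mdist_zero)

text \<open>
  Moving points by less than 1/2 is injective on a fibre, hence bijective between fibres of equal size.
\<close>

lemma near_sym:
  assumes "near e b c" "e \<le> 1/2" "b \<in> topspace B" "c \<in> topspace B"
  shows "near e c b"
proof -
  obtain h where h: "\<And>u. u \<in> fib b \<Longrightarrow> h u \<in> fib c" "\<And>u. u \<in> fib b \<Longrightarrow> d u (h u) < e"
    using assms(1) unfolding near_def by metis
  have "inj_on h (fib b)"
  proof (rule inj_onI)
    fix u v assume uv: "u \<in> fib b" "v \<in> fib b" "h u = h v"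
    have "h u \<in> L" using h uv assms fib_in by blast
    then show "u = v"
      using fib_unique[OF assms(3) uv(1,2), of "h u"] h(2)[OF uv(1)] h(2)[OF uv(2)] uv(3) assms(2)
      by (simp add: commute)
  qed
  then have "card (h ` fib b) = N" using card_image card_fib assms by metis
  then have "h ` fib b = fib c"
    using h(1) card_fib finite_fib assms by (intro card_subset_eq) auto
  then show ?thesis unfolding near_def using h(2) commute by (metis imageE)
qed

lemma near_trans:
  assumes "near e b c" "near e' c a" "b \<in> topspace B" "c \<in> topspace B" "a \<in> topspace B"
  shows "near (e + e') b a"
  unfolding near_def
proof
  fix u assume u: "u \<in> fib b"
  obtain v w where v: "v \<in> fib c" "d u v < e" and w: "w \<in> fib a" "d v w < e'"
    using assms(1,2) u unfolding near_def by metis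
  then have "d u w < e + e'" using triangle[of u v w] u assms fib_in by fastforce
  then show "\<exists>v\<in>fib a. d u v < e + e'" using w by blast
qed

lemma openin_meets_ball:
  "openin B {c \<in> topspace B. \<exists>v\<in>fib c. d u v < e}" if "u \<in> L"
proof -
  have "{c \<in> topspace B. \<exists>v\<in>fib c. d u v < e} = {c \<in> topspace B. fib c \<inter> mball u e \<noteq> {}}"
    using that fib_in by auto
  then show ?thesis using fib_lsc[of "mball u e"] by simp
qed

lemma openin_near:
  assumes b: "b \<in> topspace B"
  shows "openin B {c \<in> topspace B. near e b c}"
proof -
  have "{c \<in> topspace B. near e b c} = topspace B \<inter> (\<Inter>u\<in>fib b. {c \<in> topspace B. \<exists>v\<in>fib c. d u v < e})"
    by (auto simp: near_def)
  moreover have "openin B (\<Inter>u\<in>fib b. {c \<in> topspace B. \<exists>v\<in>fib c. d u v < e})"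
    using finite_fib[OF b] fib_nonempty[OF b] openin_meets_ball fib_in[OF b]
    by (intro openin_INT2) auto
  ultimately show ?thesis by (simp add: openin_Int)
qed

lemma near_entourage:
  assumes y: "y \<in> topspace B" and e: "0 < e" "e \<le> 1/2"
  shows "\<exists>V. openin B V \<and> y \<in> V \<and> (\<forall>a\<in>V. \<forall>b\<in>V. near e a b)"
proof (intro exI[of _ "{c \<in> topspace B. near (e/2) y c}"] conjI ballI)
  show "openin B {c \<in> topspace B. near (e/2) y c}" by (rule openin_near[OF y])
  show "y \<in> {c \<in> topspace B. near (e/2) y c}" using y near_refl e by auto
  fix a b assume "a \<in> {c \<in> topspace B. near (e/2) y c}" "b \<in> {c \<in> topspace B. near (e/2) y c}"
  then show "near e a b"
    using near_trans[OF near_sym, of "e/2" y a "e/2" b] y e by auto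
qed


text \<open>
  The local section of the covering through points close to \<open>w\<close>.
\<close>

definition sheet :: "'l \<Rightarrow> 'b \<Rightarrow> 'l"
  where "sheet w b = (THE u. u \<in> fib b \<and> d w u < 1/2)"

lemma sheet_eq:
  assumes "b \<in> topspace B" "u \<in> fib b" "w \<in> L" "d w u < 1/2"
  shows "sheet w b = u"
  unfolding sheet_def using assms fib_unique by (intro the_equality) auto

lemma continuous_map_sheet:
  assumes w: "w \<in> L"
  shows "continuous_map (subtopology B {b. \<exists>u\<in>fib b. d w u < 1/2}) mtopology (sheet w)"
  unfolding continuous_map_to_metric
proof (intro ballI allI impI)
  fix b and e :: real
  assume "b \<in> topspace (subtopology B {b. \<exists>u\<in>fib b. d w u < 1/2})" and e: "0 < e"
  then obtain u where b: "b \<in> topspace B" "u \<in> fib b" "d w u < 1/2" by auto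
  have uL: "u \<in> L" using fib_in b by blast
  let ?V = "mball w (1/2) \<inter> mball u e"
  let ?U = "{c \<in> topspace B. fib c \<inter> ?V \<noteq> {}}"
  have "openin B ?U" by (rule fib_lsc) (simp add: openin_Int)
  moreover have "?U \<subseteq> {b. \<exists>u\<in>fib b. d w u < 1/2}" by auto
  ultimately have "openin (subtopology B {b. \<exists>u\<in>fib b. d w u < 1/2}) ?U"
    by (metis (no_types, lifting) inf.absorb1 openin_subtopology_Int)
  moreover have "b \<in> ?U" using b w uL e by auto
  moreover have "sheet w c \<in> mball (sheet w b) e" if c: "c \<in> ?U" for c
  proof -
    obtain v where v: "v \<in> fib c" "d w v < 1/2" "d u v < e" "c \<in> topspace B"
    proof -
      obtain v where "v \<in> fib c \<inter> (mball w (1/2) \<inter> mball u e)" using c by blast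
      then show thesis using that[of v] c by (simp add: in_mball)
    qed
    then show ?thesis using sheet_eq[of c v w] sheet_eq[of b u w] b w uL fib_in by auto
  qed
  ultimately show "\<exists>U. openin (subtopology B {b. \<exists>u\<in>fib b. d w u < 1/2}) U \<and> b \<in> U \<and>
      (\<forall>c\<in>U. sheet w c \<in> mball (sheet w b) e)"
    by blast
qed


definition lift_of :: "(real \<Rightarrow> 'b) \<Rightarrow> (real \<Rightarrow> 'l) \<Rightarrow> bool"
  where "lift_of p q \<longleftrightarrow> continuous_map unit_interval mtopology q \<and> (\<forall>t\<in>{0..1}. q t \<in> fib (p t))"

text \<open>
  Near any parameter \<open>x\<close> the sheets through \<open>fib (p x)\<close> give lifts from every starting point, and lifts over
  adjacent intervals fit together.
\<close>

lemma path_lifting: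
  assumes p: "continuous_map unit_interval B p" and u: "u \<in> fib (p 0)"
  shows "\<exists>q. lift_of p q \<and> q 0 = u"
proof -
  have pB: "p t \<in> topspace B" if "t \<in> {0..1}" for t
    using p that by (auto simp: continuous_map_def)
  let ?Q = "\<lambda>a b. 0 \<le> a \<longrightarrow> b \<le> 1 \<longrightarrow> a \<le> b \<longrightarrow> (\<forall>u\<in>fib (p a).
    \<exists>q. continuous_map (top_of_set {a..b}) mtopology q \<and> (\<forall>t\<in>{a..b}. q t \<in> fib (p t)) \<and> q a = u)"
  have "?Q 0 1"
  proof (rule Bolzano[of 0 1 ?Q])
    fix a b c :: real assume ab: "?Q a b" and bc: "?Q b c" and abc: "a \<le> b" "b \<le> c"
    show "?Q a c"
    proof (intro impI ballI)
      fix u assume *: "0 \<le> a" "c \<le> 1" "a \<le> c" "u \<in> fib (p a)"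
      obtain q where q: "continuous_map (top_of_set {a..b}) mtopology q" "\<forall>t\<in>{a..b}. q t \<in> fib (p t)" "q a = u"
        using ab * abc by force
      moreover have "q b \<in> fib (p b)" using q abc by auto
      then obtain r where r: "continuous_map (top_of_set {b..c}) mtopology r" "\<forall>t\<in>{b..c}. r t \<in> fib (p t)" "r b = q b"
        using bc * abc by force
      have "continuous_map (top_of_set {a..c}) mtopology (\<lambda>t. if t \<le> b then q t else r t)"
        using abc q(1) r
        by (intro continuous_map_cases_le)
          (auto simp: subtopology_subtopology Int_def intro: continuous_map_from_subtopology_mono[OF q(1)]
            continuous_map_from_subtopology_mono[OF r(1)])
      then show "\<exists>q. continuous_map (top_of_set {a..c}) mtopology q \<and> (\<forall>t\<in>{a..c}. q t \<in> fib (p t)) \<and> q a = u"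
        using q r abc by (intro exI[of _ "\<lambda>t. if t \<le> b then q t else r t"]) auto
    qed
  next
    fix x :: real assume x: "0 \<le> x" "x \<le> 1"
    have px: "p x \<in> topspace B" using pB x by auto
    let ?V = "{c \<in> topspace B. near (1/2) (p x) c}"
    have "openin unit_interval {t \<in> {0..1}. p t \<in> ?V}"
      using openin_continuous_map_preimage[OF p openin_near[OF px, of "1/2"]] by simp
    moreover have "x \<in> {t \<in> {0..1}. p t \<in> ?V}" using x px near_refl by auto
    ultimately obtain e where e: "e > 0" "\<And>t. t \<in> {0..1} \<Longrightarrow> dist t x < e \<Longrightarrow> near (1/2) (p x) (p t)"
      unfolding openin_euclidean_subtopology_iff by force
    \<comment> \<open>The lift starting at \<open>u\<close> stays in the sheet through the point \<open>w\<close> over \<open>p x\<close> next to \<open>u\<close>.\<close>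
    show "\<exists>d>0. \<forall>a b. a \<le> x \<and> x \<le> b \<and> b - a < d \<longrightarrow> ?Q a b"
    proof (intro exI[of _ e] conjI allI impI ballI)
      fix a b u assume ab: "a \<le> x \<and> x \<le> b \<and> b - a < e" "0 \<le> a" "b \<le> 1" "a \<le> b" and u: "u \<in> fib (p a)"
      have near: "near (1/2) (p x) (p t)" if "t \<in> {a..b}" for t
        using that ab by (intro e(2)) (auto simp: dist_real_def)
      have paB: "p a \<in> topspace B" using ab x by (intro pB) auto
      have "near (1/2) (p a) (p x)"
        using near[of a] near_sym[OF _ _ px paB] ab by simp
      then obtain w where w: "w \<in> fib (p x)" "d u w < 1/2" using u unfolding near_def by blast
      have wL: "w \<in> L" using w px fib_in by blast
      have sh: "sheet w (p t) \<in> fib (p t) \<and> d w (sheet w (p t)) < 1/2" if t: "t \<in> {a..b}" for t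
      proof -
        obtain v where "v \<in> fib (p t)" "d w v < 1/2" using near[OF t] w unfolding near_def by blast
        then show ?thesis using sheet_eq[of "p t" v w] wL pB[of t] t ab by auto
      qed
      have "p t \<in> {b. \<exists>u\<in>fib b. d w u < 1/2}" if "t \<in> {a..b}" for t
        using sh[OF that] by blast
      then have "continuous_map (top_of_set {a..b}) (subtopology B {b. \<exists>u\<in>fib b. d w u < 1/2}) p"
        using continuous_map_from_subtopology_mono[OF p, of "{a..b}"] ab
        unfolding continuous_map_in_subtopology by auto
      from continuous_map_compose[OF this continuous_map_sheet[OF wL]]
      have "continuous_map (top_of_set {a..b}) mtopology (\<lambda>t. sheet w (p t))" by (simp add: o_def)
      moreover have "sheet w (p a) = u" using sheet_eq[OF paB u wL] w(2) commute by simp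
      ultimately show "\<exists>q. continuous_map (top_of_set {a..b}) mtopology q \<and> (\<forall>t\<in>{a..b}. q t \<in> fib (p t)) \<and> q a = u"
        using sh by (intro exI[of _ "\<lambda>t. sheet w (p t)"]) auto
    qed (use e in auto)
  qed auto
  then show ?thesis using u by (auto simp: lift_of_def)
qed

text \<open>
  As long as \<open>p\<close> and \<open>p'\<close> have close fibres, the distance of their lifts is either less than \<open>e\<close> or
  greater than 1/2. Being continuous in the parameter, it cannot switch between the two. The parameters
  \<open>i\<close> and \<open>j\<close> are in arbitrary order, so that closeness propagates from end to start as well.
\<close>

lemma lifts_stay_close:
  assumes q: "lift_of p q" and r: "lift_of p' r"
    and p: "continuous_map unit_interval B p" "continuous_map unit_interval B p'"
    and near: "\<And>t. t \<in> {0..1} \<Longrightarrow> near e (p t) (p' t)" and e: "e \<le> 1/2"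
    and ij: "i \<in> {0..1}" "j \<in> {0..1}" and close: "d (q i) (r i) < e"
  shows "d (q j) (r j) < e"
proof -
  have pB: "p t \<in> topspace B" "p' t \<in> topspace B" if "t \<in> {0..1}" for t
    using p that by (auto simp: continuous_map_def)
  have gap: "d (q t) (r t) < e \<or> 1/2 < d (q t) (r t)" if t: "t \<in> {0..1}" for t
  proof -
    have qt: "q t \<in> fib (p t)" "r t \<in> fib (p' t)" using q r t by (auto simp: lift_of_def)
    then obtain v where v: "v \<in> fib (p' t)" "d (q t) v < e" using near[OF t] by (auto simp: near_def)
    have L: "q t \<in> L" "r t \<in> L" "v \<in> L" using qt v pB[OF t] fib_in by auto
    \<comment> \<open>If \<open>v\<close> is not \<open>r t\<close>, it is at distance at least 1 from \<open>r t\<close>, which lies in the same fibre.\<close>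
    show ?thesis
    proof (cases "v = r t")
      case False
      then have "1 \<le> d v (r t)" using fib_separated pB[OF t] v qt by blast
      moreover have "d v (r t) \<le> d v (q t) + d (q t) (r t)" using L by (intro triangle)
      ultimately show ?thesis using v e commute[of v "q t"] by linarith
    qed (use v in auto)
  qed
  have cont: "continuous_on {0..1} (\<lambda>t. d (q t) (r t))"
  proof -
    have "continuous_map unit_interval euclidean (\<lambda>t. d (q t) (r t))"
      using continuous_map_mdist[of unit_interval "metric (L, d)" q r] q r by (simp add: lift_of_def)
    then show ?thesis by simp
  qed
  have "connected ((\<lambda>t. d (q t) (r t)) ` {0..1})"
    by (rule connected_continuous_image[OF cont]) simp
  moreover have "1/2 \<notin> (\<lambda>t. d (q t) (r t)) ` {0..1}"
    using gap e by fastforce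
  ultimately have "\<not> (1/2 < d (q j) (r j))"
    using close e ij connectedD_interval[of _ "d (q i) (r i)" "d (q j) (r j)" "1/2"] by force
  then show ?thesis using gap[OF ij(2)] by blast
qed

text \<open>
  Any lift may be chosen, since \<open>lifts_stay_close\<close> compares arbitrary lifts.
\<close>

definition lift_end :: "(real \<Rightarrow> 'b) \<Rightarrow> 'l \<Rightarrow> 'l"
  where "lift_end p u = (SOME q. lift_of p q \<and> q 0 = u) 1"

lemma lift_end_ex:
  assumes "continuous_map unit_interval B p" "u \<in> fib (p 0)"
  shows "\<exists>q. lift_of p q \<and> q 0 = u \<and> q 1 = lift_end p u"
  using someI_ex[OF path_lifting[OF assms]] unfolding lift_end_def by blast

lemma lift_end_in_fib:
  assumes "continuous_map unit_interval B p" "u \<in> fib (p 0)"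
  shows "lift_end p u \<in> fib (p 1)"
proof -
  obtain q where "lift_of p q" "q 1 = lift_end p u" using lift_end_ex[OF assms] by blast
  then show ?thesis by (auto simp: lift_of_def dest: bspec[of _ _ 1])
qed

lemma bij_betw_lift_end:
  assumes p: "continuous_map unit_interval B p"
  shows "bij_betw (lift_end p) (fib (p 0)) (fib (p 1))"
proof -
  have pB: "p t \<in> topspace B" if "t \<in> {0..1}" for t
    using p that by (auto simp: continuous_map_def)
  have "inj_on (lift_end p) (fib (p 0))"
  proof (rule inj_onI)
    fix u v assume uv: "u \<in> fib (p 0)" "v \<in> fib (p 0)" "lift_end p u = lift_end p v"
    obtain q where q: "lift_of p q" "q 0 = u" "q 1 = lift_end p u" using lift_end_ex[OF p uv(1)] by blast
    obtain r where r: "lift_of p r" "r 0 = v" "r 1 = lift_end p v" using lift_end_ex[OF p uv(2)] by blast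
    have "q 1 \<in> L" using lift_end_in_fib[OF p uv(1)] q fib_in pB[of 1] by auto
    then have "d (q 0) (r 0) < 1/2"
      using uv q r near_refl pB by (intro lifts_stay_close[OF q(1) r(1) p p, of "1/2" 1 0]) auto
    then show "u = v"
      using q r uv fib_separated[of "p 0" u v] pB[of 0] by force
  qed
  moreover have "lift_end p ` fib (p 0) \<subseteq> fib (p 1)" using lift_end_in_fib[OF p] by blast
  ultimately show ?thesis
    using card_fib[OF pB[of 0]] card_fib[OF pB[of 1]] finite_fib[OF pB[of 1]]
    by (simp add: bij_betw_def card_image card_subset_eq)
qed

lemma continuous_map_lift_end:
  assumes P: "path_family Z B P" and v: "continuous_map Z mtopology v"
    and vP: "\<And>z. z \<in> topspace Z \<Longrightarrow> v z \<in> fib (P z 0)"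
  shows "continuous_map Z mtopology (\<lambda>z. lift_end (P z) (v z))"
  unfolding continuous_map_to_metric
proof (intro ballI allI impI)
  fix z and \<epsilon> :: real assume z: "z \<in> topspace Z" and "0 < \<epsilon>"
  define e where "e = min \<epsilon> (1/2)"
  have e: "0 < e" "e \<le> 1/2" "e \<le> \<epsilon>" using \<open>0 < \<epsilon>\<close> by (auto simp: e_def)
  obtain U where U: "openin Z U" "z \<in> U" "\<forall>y\<in>U. \<forall>t\<in>{0..1}. near e (P z t) (P y t)"
    using path_family_uniformly_close[OF P z, of "near e"] near_entourage e by blast
  obtain U' where U': "openin Z U'" "z \<in> U'" "\<forall>y\<in>U'. v y \<in> mball (v z) e"
    using v z e(1) unfolding continuous_map_to_metric by meson
  have "lift_end (P y) (v y) \<in> mball (lift_end (P z) (v z)) \<epsilon>" if y: "y \<in> U \<inter> U'" for y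
  proof -
    have yZ: "y \<in> topspace Z" using y U(1) openin_subset by blast
    note Pz = path_family_path[OF P z] and Py = path_family_path[OF P yZ]
    obtain q where q: "lift_of (P z) q" "q 0 = v z" "q 1 = lift_end (P z) (v z)"
      using lift_end_ex[OF Pz vP[OF z]] by blast
    obtain r where r: "lift_of (P y) r" "r 0 = v y" "r 1 = lift_end (P y) (v y)"
      using lift_end_ex[OF Py vP[OF yZ]] by blast
    have "d (q 1) (r 1) < e"
      using U U' y e q r by (intro lifts_stay_close[OF q(1) r(1) Pz Py, of e 0 1]) auto
    moreover have "q 1 \<in> L" "r 1 \<in> L"
      using q(3) r(3) lift_end_in_fib[OF Pz vP[OF z]] lift_end_in_fib[OF Py vP[OF yZ]]
        fib_in[OF path_family_in_topspace[OF P z, of 1]] fib_in[OF path_family_in_topspace[OF P yZ, of 1]]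
      by auto
    ultimately show ?thesis using q r e by auto
  qed
  then show "\<exists>U. openin Z U \<and> z \<in> U \<and> (\<forall>y\<in>U. lift_end (P y) (v y) \<in> mball (lift_end (P z) (v z)) \<epsilon>)"
    using U U' by (intro exI[of _ "U \<inter> U'"]) (auto simp: openin_Int)
qed

end

section \<open>Weights on a covering\<close>

context finite_covering
begin

text \<open>
  The total space of the covering pulled back along \<open>\<phi>\<close>.
\<close>

definition total :: "'x topology \<Rightarrow> ('x \<Rightarrow> 'b) \<Rightarrow> ('x \<times> 'l) topology"
  where "total X \<phi> = subtopology (prod_topology X mtopology) {(x, u). u \<in> fib (\<phi> x)}"

lemma topspace_total:
  assumes "continuous_map X B \<phi>"
  shows "topspace (total X \<phi>) = {(x, u). x \<in> topspace X \<and> u \<in> fib (\<phi> x)}"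
proof -
  have "\<phi> x \<in> topspace B" if "x \<in> topspace X" for x
    using assms that by (auto simp: continuous_map_def)
  then show ?thesis using fib_in by (auto simp: total_def)
qed

lemma continuous_map_into_total:
  assumes "continuous_map Z X f" "continuous_map Z mtopology g"
    and "\<And>z. z \<in> topspace Z \<Longrightarrow> g z \<in> fib (\<phi> (f z))"
  shows "continuous_map Z (total X \<phi>) (\<lambda>z. (f z, g z))"
  unfolding total_def using assms by (auto simp: continuous_map_in_subtopology intro: continuous_map_pairedI)

lemma continuous_map_total_fst: "continuous_map (total X \<phi>) X fst"
  and continuous_map_total_snd: "continuous_map (total X \<phi>) mtopology snd"
  unfolding total_def by (auto intro: continuous_map_from_subtopology continuous_map_fst continuous_map_snd)

lemma openin_total_Times:
  assumes "openin X U" "openin mtopology V"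
  shows "openin (total X \<phi>) (topspace (total X \<phi>) \<inter> U \<times> V)"
proof -
  have "topspace (total X \<phi>) \<inter> U \<times> V =
      {z \<in> topspace (total X \<phi>). fst z \<in> U} \<inter> {z \<in> topspace (total X \<phi>). snd z \<in> V}"
    by auto
  then show ?thesis
    by (simp only:) (intro openin_Int openin_continuous_map_preimage[OF continuous_map_total_fst assms(1)]
      openin_continuous_map_preimage[OF continuous_map_total_snd assms(2)])
qed

definition weights :: "nat \<Rightarrow> 'x topology \<Rightarrow> ('x \<Rightarrow> 'b) \<Rightarrow> ('x \<times> 'l \<Rightarrow> real) \<Rightarrow> bool"
  where "weights n X \<phi> T \<longleftrightarrow>
    continuous_map (total X \<phi>) euclideanreal T \<and>
    (\<forall>x\<in>topspace X. (\<forall>u\<in>fib (\<phi> x). 0 \<le> T (x, u)) \<and> (\<Sum>u\<in>fib (\<phi> x). T (x, u)) = 1 \<and>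
       card {u \<in> fib (\<phi> x). T (x, u) \<noteq> 0} \<le> n)"

lemma weights_pullback:
  assumes T: "weights n X \<phi> T" and h: "continuous_map X' X h"
  shows "weights n X' (\<phi> \<circ> h) (\<lambda>(x, u). T (h x, u))"
proof -
  have "continuous_map (total X' (\<phi> \<circ> h)) (total X \<phi>) (\<lambda>z. (h (fst z), snd z))"
  proof (intro continuous_map_into_total)
    show "continuous_map (total X' (\<phi> \<circ> h)) X (\<lambda>z. h (fst z))"
      using continuous_map_compose[OF continuous_map_total_fst h] by (simp add: o_def)
  qed (auto simp: continuous_map_total_snd, auto simp: total_def)
  then have "continuous_map (total X' (\<phi> \<circ> h)) euclideanreal (\<lambda>z. T (h (fst z), snd z))"
    using T continuous_map_compose unfolding weights_def o_def by fastforce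
  moreover have "h x \<in> topspace X" if "x \<in> topspace X'" for x
    using h that by (auto simp: continuous_map_def)
  ultimately show ?thesis using T by (simp add: weights_def case_prod_unfold)
qed

text \<open>
  The weights pulled back to \<open>B\<close> along \<open>g\<close> live on the fibres over \<open>f (g b)\<close>. Lifting the path from \<open>b\<close> to
  \<open>f (g b)\<close> that the homotopy provides identifies these with the fibres over \<open>b\<close>.
\<close>

lemma weights_homotopy_transfer:
  assumes f: "continuous_map X B f" and g: "continuous_map B X g"
    and fg: "homotopic_with (\<lambda>_. True) B B (f \<circ> g) id"
    and T: "weights n X f T"
  shows "\<exists>T'. weights n B id T'"
proof -
  obtain k where k: "continuous_map (prod_topology unit_interval B) B k"
    and k0: "\<And>x. k (0, x) = f (g x)" and k1: "\<And>x. k (1, x) = x"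
    using fg unfolding homotopic_with_def by (auto simp: o_def)
  let ?E = "total B (id :: 'b \<Rightarrow> 'b)"
  define P where "P = (\<lambda>z::'b \<times> 'l. \<lambda>t::real. k (1 - t, fst z))"
  have P: "path_family ?E B P"
  proof (rule path_family_of_homotopy)
    have "continuous_map (prod_topology ?E unit_interval) (prod_topology unit_interval B)
        (\<lambda>w. (1 - snd w, fst (fst w)))"
    proof (intro continuous_map_pairedI)
      show "continuous_map (prod_topology ?E unit_interval) unit_interval (\<lambda>w. 1 - snd w)"
        using continuous_map_compose[OF continuous_map_snd continuous_map_interval_reverse]
        by (simp add: o_def)
      show "continuous_map (prod_topology ?E unit_interval) B (\<lambda>w. fst (fst w))"
        using continuous_map_compose[OF continuous_map_fst continuous_map_total_fst] by (simp add: o_def)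
    qed
    from continuous_map_compose[OF this k]
    show "continuous_map (prod_topology ?E unit_interval) B (\<lambda>(z, t). P z t)"
      by (simp add: o_def P_def case_prod_unfold)
  qed
  have E: "topspace ?E = {(x, u). x \<in> topspace B \<and> u \<in> fib x}"
    using topspace_total[of B id] by simp
  have P0: "P z 0 = fst z" and P1: "P z 1 = f (g (fst z))" for z
    by (simp_all add: P_def k0 k1)
  define T' where "T' = (\<lambda>z. T (g (fst z), lift_end (P z) (snd z)))"
  have gB: "g b \<in> topspace X" "f (g b) \<in> topspace B" if "b \<in> topspace B" for b
    using f g that by (auto simp: continuous_map_def)
  have "continuous_map ?E mtopology (\<lambda>z. lift_end (P z) (snd z))"
    using P0 by (intro continuous_map_lift_end[OF P continuous_map_total_snd]) (auto simp: E)
  then have "continuous_map ?E (total X f) (\<lambda>z. (g (fst z), lift_end (P z) (snd z)))"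
  proof (rule continuous_map_into_total[rotated])
    show "continuous_map ?E X (\<lambda>z. g (fst z))"
      using continuous_map_compose[OF continuous_map_total_fst g] by (simp add: o_def)
    fix z assume z: "z \<in> topspace ?E"
    then show "lift_end (P z) (snd z) \<in> fib (f (g (fst z)))"
      using lift_end_in_fib[OF path_family_path[OF P z], of "snd z"] P0 P1 by (auto simp: E)
  qed
  then have "continuous_map ?E euclideanreal T'"
    unfolding T'_def using T continuous_map_compose unfolding weights_def o_def by fastforce
  moreover have "(\<forall>u\<in>fib (id b). 0 \<le> T' (b, u)) \<and> (\<Sum>u\<in>fib (id b). T' (b, u)) = 1 \<and>
       card {u \<in> fib (id b). T' (b, u) \<noteq> 0} \<le> n" if b: "b \<in> topspace B" for b
  proof -
    define l where "l = lift_end (P (b, undefined))"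
    have l: "T' (b, u) = T (g b, l u)" for u
      by (simp add: T'_def l_def P_def)
    obtain u0 where "u0 \<in> fib b" using fib_nonempty[OF b] by blast
    then have "continuous_map unit_interval B (P (b, u0))"
      using path_family_path[OF P, of "(b, u0)"] b E by auto
    then have bij: "bij_betw l (fib b) (fib (f (g b)))"
      using bij_betw_lift_end[of "P (b, u0)"] by (simp add: l_def P_def k0 k1)
    have W: "\<forall>u\<in>fib (f (g b)). 0 \<le> T (g b, u)" "(\<Sum>u\<in>fib (f (g b)). T (g b, u)) = 1"
        "card {u \<in> fib (f (g b)). T (g b, u) \<noteq> 0} \<le> n"
      using T gB[OF b] by (auto simp: weights_def)
    have "(\<Sum>u\<in>fib b. T' (b, u)) = 1"
      unfolding l using sum.reindex_bij_betw[OF bij, of "\<lambda>u. T (g b, u)"] W(2) by simp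
    moreover have "bij_betw l {u \<in> fib b. T (g b, l u) \<noteq> 0} {u \<in> fib (f (g b)). T (g b, u) \<noteq> 0}"
      using bij by (auto simp: bij_betw_def inj_on_def)
    then have "card {u \<in> fib b. T' (b, u) \<noteq> 0} \<le> n"
      unfolding l using W(3) bij_betw_same_card by fastforce
    moreover have "\<forall>u\<in>fib b. 0 \<le> T' (b, u)" unfolding l using W(1) bij bij_betwE by fast
    ultimately show ?thesis by simp
  qed
  ultimately show ?thesis unfolding weights_def by blast
qed

section \<open>From measures to weights\<close>

text \<open>
  The weight of \<open>u\<close> is the mass of the paths that \<open>h\<close> sends to \<open>u\<close>. Near a point \<open>(x, u)\<close> it equals the mass
  of the open set of paths that \<open>h\<close> sends into a ball around \<open>u\<close>, so it is lower semicontinuous by the last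
  assumption. Upper semicontinuity follows by applying this to the mass of the paths that \<open>h\<close> sends to the
  other points of the fibre, since the total mass is 1.
\<close>

lemma weights_of_measures:
  assumes \<phi>: "continuous_map X B \<phi>" and h: "continuous_map Q mtopology h"
    and fin: "\<And>x. x \<in> topspace X \<Longrightarrow> finite (set_pmf (s x)) \<and> card (set_pmf (s x)) \<le> n"
    and sub: "\<And>x \<gamma>. x \<in> topspace X \<Longrightarrow> \<gamma> \<in> set_pmf (s x) \<Longrightarrow> \<gamma> \<in> topspace Q \<and> h \<gamma> \<in> fib (\<phi> x)"
    and lsc: "\<And>W c. openin Q W \<Longrightarrow> openin X {x \<in> topspace X. c < measure_pmf.prob (s x) W}"
  shows "\<exists>T. weights n X \<phi> T"
proof -
  define T where "T = (\<lambda>(x, u). pmf (map_pmf h (s x)) u)"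
  have \<phi>B: "\<phi> x \<in> topspace B" if "x \<in> topspace X" for x
    using \<phi> that by (auto simp: continuous_map_def)
  note E = topspace_total[OF \<phi>]
  have T_prob: "T (x, u) = measure_pmf.prob (s x) (h -` {u})" for x u
    by (simp add: T_def pmf_map)
  define W where "W w = {\<gamma> \<in> topspace Q. h \<gamma> \<in> mball w (1/2)}" for w
  have W: "openin Q (W w)" for w
    unfolding W_def by (rule openin_continuous_map_preimage[OF h openin_mball])
  have T_W: "T (x, u) = measure_pmf.prob (s x) (W w)"
    if "x \<in> topspace X" "u \<in> fib (\<phi> x)" "w \<in> L" "d w u < 1/2" for x u w
  proof -
    have "W w \<inter> set_pmf (s x) = h -` {u} \<inter> set_pmf (s x)"
    proof (intro Set.set_eqI iffI)
      fix \<gamma> assume "\<gamma> \<in> W w \<inter> set_pmf (s x)"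
      then have "\<gamma> \<in> set_pmf (s x)" "d w (h \<gamma>) < 1/2" unfolding W_def by auto
      then show "\<gamma> \<in> h -` {u} \<inter> set_pmf (s x)"
        using sub[OF that(1)] fib_unique[OF \<phi>B[OF that(1)] that(2) _ that(3,4)] by blast
    next
      fix \<gamma> assume "\<gamma> \<in> h -` {u} \<inter> set_pmf (s x)"
      then show "\<gamma> \<in> W w \<inter> set_pmf (s x)"
        using that sub[OF that(1), of \<gamma>] fib_in[OF \<phi>B[OF that(1)], of u] unfolding W_def by simp
    qed
    then have "measure_pmf.prob (s x) (W w) = measure_pmf.prob (s x) (h -` {u})"
      using measure_Int_set_pmf[of "s x"] by metis
    then show ?thesis unfolding T_prob by simp
  qed
  have "continuous_map (total X \<phi>) euclideanreal T"
    unfolding continuous_map_upper_lower_semicontinuous_lt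
  proof (intro conjI allI; subst openin_subopen; intro ballI)
    fix c z assume "z \<in> {z \<in> topspace (total X \<phi>). c < T z}"
    then obtain x u where z: "z = (x, u)" "x \<in> topspace X" "u \<in> fib (\<phi> x)" "c < T (x, u)"
      by (auto simp: E)
    have u: "u \<in> L" using z fib_in \<phi>B by blast
    let ?O = "topspace (total X \<phi>) \<inter> {y \<in> topspace X. c < measure_pmf.prob (s y) (W u)} \<times> mball u (1/2)"
    have "openin (total X \<phi>) ?O"
      by (rule openin_total_Times[OF lsc[OF W] openin_mball])
    moreover have "z \<in> ?O" using z u T_W[OF z(2,3) u] by (auto simp: E)
    moreover have "?O \<subseteq> {z \<in> topspace (total X \<phi>). c < T z}"
      using T_W[OF _ _ u] by (auto simp: E)
    ultimately show "\<exists>O'. openin (total X \<phi>) O' \<and> z \<in> O' \<and> O' \<subseteq> {z \<in> topspace (total X \<phi>). c < T z}"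
      by blast
  next
    fix c z assume "z \<in> {z \<in> topspace (total X \<phi>). T z < c}"
    then obtain x u where z: "z = (x, u)" "x \<in> topspace X" "u \<in> fib (\<phi> x)" "T (x, u) < c"
      by (auto simp: E)
    have u: "u \<in> L" using z fib_in \<phi>B by blast
    \<comment> \<open>Around \<open>(x, u)\<close> the open set \<open>W'\<close> consists of paths that do not contribute to the weight.\<close>
    define W' where "W' = (\<Union>v\<in>fib (\<phi> x) - {u}. W v)"
    have W': "openin Q W'" unfolding W'_def using W by blast
    have eq: "measure_pmf.prob (s x) W' = 1 - T (x, u)"
    proof -
      have "W' \<inter> set_pmf (s x) = (- (h -` {u})) \<inter> set_pmf (s x)"
      proof (intro Set.set_eqI iffI)
        fix \<gamma> assume "\<gamma> \<in> W' \<inter> set_pmf (s x)"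
        then obtain v where v: "v \<in> fib (\<phi> x)" "v \<noteq> u" "d v (h \<gamma>) < 1/2" "\<gamma> \<in> set_pmf (s x)"
          unfolding W'_def W_def by auto
        have "1 \<le> d v u" using fib_separated[OF \<phi>B[OF z(2)] v(1) z(3) v(2)] .
        then show "\<gamma> \<in> (- (h -` {u})) \<inter> set_pmf (s x)" using v by auto
      next
        fix \<gamma> assume "\<gamma> \<in> (- (h -` {u})) \<inter> set_pmf (s x)"
        then have \<gamma>: "\<gamma> \<in> set_pmf (s x)" "h \<gamma> \<noteq> u" by auto
        have "\<gamma> \<in> W (h \<gamma>)"
          using sub[OF z(2) \<gamma>(1)] fib_in[OF \<phi>B[OF z(2)], of "h \<gamma>"] unfolding W_def by simp
        then show "\<gamma> \<in> W' \<inter> set_pmf (s x)"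
          using \<gamma> sub[OF z(2) \<gamma>(1)] unfolding W'_def by blast
      qed
      then have "measure_pmf.prob (s x) W' = measure_pmf.prob (s x) (- (h -` {u}))"
        by (metis measure_Int_set_pmf)
      also have "\<dots> = 1 - T (x, u)"
        unfolding T_prob using measure_pmf.prob_compl[of "h -` {u}" "s x"] by (simp add: Compl_eq_Diff_UNIV)
      finally show ?thesis .
    qed
    let ?O = "topspace (total X \<phi>) \<inter> {y \<in> topspace X. 1 - c < measure_pmf.prob (s y) W'} \<times> mball u (1/2)"
    have "openin (total X \<phi>) ?O"
      by (rule openin_total_Times[OF lsc[OF W'] openin_mball])
    moreover have "z \<in> ?O" using z u eq by (auto simp: E)
    moreover have "?O \<subseteq> {z \<in> topspace (total X \<phi>). T z < c}"
    proof
      fix z' assume z': "z' \<in> ?O"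
      then obtain y v where y: "z' = (y, v)" "y \<in> topspace X" "v \<in> fib (\<phi> y)" "v \<in> L" "d u v < 1/2"
        "1 - c < measure_pmf.prob (s y) W'"
        by (auto simp: E)
      have "W' \<inter> h -` {v} = {}"
      proof (rule ccontr)
        assume "W' \<inter> h -` {v} \<noteq> {}"
        then obtain w where w: "w \<in> fib (\<phi> x)" "w \<noteq> u" "d w v < 1/2" "w \<in> L" by (auto simp: W'_def W_def)
        then have "1 \<le> d w u" using fib_separated \<phi>B z by blast
        moreover have "d w u \<le> d w v + d v u" using w y u by (intro triangle)
        ultimately show False using y(5) w(3) commute[of v u] by linarith
      qed
      then have "measure_pmf.prob (s y) W' + T (y, v) = measure_pmf.prob (s y) (W' \<union> h -` {v})"
        unfolding T_prob by (intro measure_pmf.finite_measure_Union[symmetric]) auto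
      also have "\<dots> \<le> 1" by simp
      finally show "z' \<in> {z \<in> topspace (total X \<phi>). T z < c}" using y z' by auto
    qed
    ultimately show "\<exists>O'. openin (total X \<phi>) O' \<and> z \<in> O' \<and> O' \<subseteq> {z \<in> topspace (total X \<phi>). T z < c}"
      by blast
  qed
  moreover have "(\<forall>u\<in>fib (\<phi> x). 0 \<le> T (x, u)) \<and> (\<Sum>u\<in>fib (\<phi> x). T (x, u)) = 1 \<and>
       card {u \<in> fib (\<phi> x). T (x, u) \<noteq> 0} \<le> n" if x: "x \<in> topspace X" for x
  proof -
    have set: "set_pmf (map_pmf h (s x)) \<subseteq> fib (\<phi> x)" using sub[OF x] by auto
    have "(\<Sum>u\<in>fib (\<phi> x). T (x, u)) = 1"
      unfolding T_def using sum_pmf_eq_1[OF finite_fib[OF \<phi>B[OF x]] set] by simp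
    moreover have "{u \<in> fib (\<phi> x). T (x, u) \<noteq> 0} \<subseteq> h ` set_pmf (s x)"
      by (auto simp: T_def set_pmf_iff[symmetric])
    then have "card {u \<in> fib (\<phi> x). T (x, u) \<noteq> 0} \<le> n"
      using fin[OF x] card_mono[of "h ` set_pmf (s x)"] card_image_le[of "set_pmf (s x)" h] by (meson finite_imageI le_trans)
    ultimately show ?thesis by (simp add: T_def)
  qed
  ultimately show ?thesis unfolding weights_def by blast
qed

end

section \<open>Finitely supported measures\<close>

definition weighted_pmf :: "'a set \<Rightarrow> ('a \<Rightarrow> real) \<Rightarrow> 'a pmf"
  where "weighted_pmf I w = embed_pmf (\<lambda>i. if i \<in> I then w i else 0)"

definition is_distribution :: "'a set \<Rightarrow> ('a \<Rightarrow> real) \<Rightarrow> bool"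
  where "is_distribution I w \<longleftrightarrow> finite I \<and> (\<forall>i\<in>I. 0 \<le> w i) \<and> sum w I = 1"

lemma pmf_weighted:
  assumes "is_distribution I w"
  shows "pmf (weighted_pmf I w) i = (if i \<in> I then w i else 0)"
  unfolding weighted_pmf_def
proof (rule pmf_embed_pmf)
  show "0 \<le> (if i \<in> I then w i else 0)" for i
    using assms by (simp add: is_distribution_def)
  have "(\<integral>\<^sup>+ i. ennreal (if i \<in> I then w i else 0) \<partial>count_space UNIV) = (\<Sum>i\<in>I. ennreal (if i \<in> I then w i else 0))"
    using assms by (intro nn_integral_count_space') (auto simp: is_distribution_def)
  also have "\<dots> = ennreal (sum w I)"
    using assms by (subst sum_ennreal[symmetric]) (auto simp: is_distribution_def intro!: sum.cong)
  finally show "(\<integral>\<^sup>+ i. ennreal (if i \<in> I then w i else 0) \<partial>count_space UNIV) = 1"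
    using assms by (simp add: is_distribution_def)
qed

lemma set_pmf_weighted: "is_distribution I w \<Longrightarrow> set_pmf (weighted_pmf I w) = {i \<in> I. w i \<noteq> 0}"
  by (auto simp: set_pmf_eq pmf_weighted)

lemma prob_weighted:
  assumes "is_distribution I w"
  shows "measure_pmf.prob (weighted_pmf I w) S = sum w (I \<inter> S)"
proof -
  have fin: "finite I" using assms by (simp add: is_distribution_def)
  have "measure_pmf.prob (weighted_pmf I w) S = measure_pmf.prob (weighted_pmf I w) (I \<inter> S)"
  proof -
    have "S \<inter> set_pmf (weighted_pmf I w) = (I \<inter> S) \<inter> set_pmf (weighted_pmf I w)"
      using set_pmf_weighted[OF assms] by auto
    then show ?thesis
      using measure_Int_set_pmf[of "weighted_pmf I w" S] measure_Int_set_pmf[of "weighted_pmf I w" "I \<inter> S"]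
      by simp
  qed
  also have "\<dots> = sum (pmf (weighted_pmf I w)) (I \<inter> S)"
    using fin by (intro measure_measure_pmf_finite) auto
  also have "\<dots> = sum w (I \<inter> S)" by (intro sum.cong) (auto simp: pmf_weighted[OF assms])
  finally show ?thesis .
qed

lemma weighted_pmf_bij:
  assumes h: "bij_betw h J I" and w: "is_distribution I w"
  shows "is_distribution J (\<lambda>j. w (h j))"
    and "weighted_pmf I w = map_pmf h (weighted_pmf J (\<lambda>j. w (h j)))"
proof -
  show J: "is_distribution J (\<lambda>j. w (h j))"
    using w sum.reindex_bij_betw[OF h, of w] bij_betw_finite[OF h] bij_betwE[OF h]
    by (auto simp: is_distribution_def)
  show "weighted_pmf I w = map_pmf h (weighted_pmf J (\<lambda>j. w (h j)))"
  proof (rule pmf_eqI)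
    fix i
    have "pmf (map_pmf h (weighted_pmf J (\<lambda>j. w (h j)))) i = sum (\<lambda>j. w (h j)) (J \<inter> h -` {i})"
      by (simp add: pmf_map prob_weighted[OF J])
    also have "\<dots> = (if i \<in> I then w i else 0)"
    proof (cases "i \<in> I")
      case True
      then obtain j where j: "j \<in> J" "h j = i" using h by (auto simp: bij_betw_def)
      then have "J \<inter> h -` {i} = {j}" using h by (auto simp: bij_betw_def inj_on_def)
      then show ?thesis using True j by simp
    next
      case False
      then have "J \<inter> h -` {i} = {}" using h by (auto simp: bij_betw_def)
      then show ?thesis using False by simp
    qed
    finally show "pmf (weighted_pmf I w) i = pmf (map_pmf h (weighted_pmf J (\<lambda>j. w (h j)))) i"
      by (simp add: pmf_weighted[OF w])
  qed
qed

section \<open>Continuity and final topologies\<close>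

lemma continuous_map_locally:
  assumes "\<And>x. x \<in> topspace X \<Longrightarrow> \<exists>U. openin X U \<and> x \<in> U \<and> continuous_map (subtopology X U) Y f"
  shows "continuous_map X Y f"
  unfolding continuous_map_def
proof (intro conjI allI impI)
  have loc: "f x \<in> topspace Y" if x: "x \<in> topspace X" for x
  proof -
    obtain U where "openin X U" "x \<in> U" "continuous_map (subtopology X U) Y f" using assms[OF x] by blast
    then show ?thesis using x by (auto simp: continuous_map_def)
  qed
  then show "f \<in> topspace X \<rightarrow> topspace Y" by blast
  fix V assume V: "openin Y V"
  show "openin X {x \<in> topspace X. f x \<in> V}"
  proof (subst openin_subopen, intro ballI)
    fix x assume x: "x \<in> {x \<in> topspace X. f x \<in> V}"
    then obtain U where U: "openin X U" "x \<in> U" "continuous_map (subtopology X U) Y f" using assms by blast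
    have "openin (subtopology X U) {x \<in> topspace (subtopology X U). f x \<in> V}"
      by (rule openin_continuous_map_preimage[OF U(3) V])
    then have "openin X {x \<in> topspace (subtopology X U). f x \<in> V}"
      using U(1) openin_trans_full by blast
    then show "\<exists>T. openin X T \<and> x \<in> T \<and> T \<subseteq> {x \<in> topspace X. f x \<in> V}"
      using x U(2) by (intro exI[of _ "{x \<in> topspace (subtopology X U). f x \<in> V}"]) auto
  qed
qed

lemma continuous_map_final_topology:
  assumes "\<And>i. f i \<in> topspace (T i) \<rightarrow> C"
  shows "continuous_map (T i) (final_topology C T f) (f i)"
  using assms by (auto simp: continuous_map_def topspace_final_topology[OF assms] openin_final_topology)

lemma continuous_map_from_kification_into:
  "continuous_map X (kification Y) f \<Longrightarrow> continuous_map X Y f"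
  by (simp add: continuous_map_def openin_kification_finer)

section \<open>Path spaces\<close>

lemma based_path_in_topspace: "\<gamma> \<in> based_paths Y y0 \<Longrightarrow> t \<in> {0..1} \<Longrightarrow> \<gamma> t \<in> topspace Y"
  by (auto simp: based_paths_def continuous_map_def)

lemma restrict_in_based_paths:
  assumes "continuous_map unit_interval Y p" "p 0 = y0"
  shows "restrict p {0..1} \<in> based_paths Y y0"
  using assms continuous_map_eq[OF assms(1), of "restrict p {0..1}"] by (auto simp: based_paths_def)

lemma topspace_cg_mapping_space:
  "topspace (cg_mapping_space X Y) = {f \<in> extensional (topspace X). continuous_map X Y f}"
  unfolding cg_mapping_space_def topspace_kification topology_generated_by_topspace
proof (rule subset_antisym)
  have "{f \<in> extensional (topspace X). continuous_map X Y f \<and> f ` {} \<subseteq> {}}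
    \<in> {{f \<in> extensional (topspace X). continuous_map X Y f \<and> f ` K \<subseteq> U} |K U. compactin X K \<and> openin Y U}"
    by (intro CollectI exI[of _ "{}"]) simp
  then show "{f \<in> extensional (topspace X). continuous_map X Y f}
    \<subseteq> \<Union> {{f \<in> extensional (topspace X). continuous_map X Y f \<and> f ` K \<subseteq> U} |K U. compactin X K \<and> openin Y U}"
    by (intro Union_upper[THEN subset_trans[rotated]]) auto
qed blast

lemma topspace_based_path_space: "topspace (based_path_space Y y0) = based_paths Y y0"
  by (auto simp: based_path_space_def topspace_cg_mapping_space based_paths_def)

lemma path_family_based_path_space: "path_family (based_path_space Y y0) Y (\<lambda>\<gamma>. \<gamma>)"
proof (rule path_familyI)
  show "continuous_map unit_interval Y \<gamma>" if "\<gamma> \<in> topspace (based_path_space Y y0)" for \<gamma>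
    using that by (auto simp: topspace_based_path_space based_paths_def)
  fix K :: "real set" and V assume K: "compact K" "K \<subseteq> {0..1}" and V: "openin Y V"
  let ?S = "{f \<in> extensional (topspace unit_interval). continuous_map unit_interval Y f \<and> f ` K \<subseteq> V}"
  have "openin (cg_mapping_space unit_interval Y) ?S"
    unfolding cg_mapping_space_def using K V
    by (intro openin_kification_finer topology_generated_by_Basis) (auto simp: compactin_subtopology)
  then have "openin (based_path_space Y y0) (based_paths Y y0 \<inter> ?S)"
    unfolding based_path_space_def by (intro openin_kification_finer openin_subtopology_Int2)
  moreover have "based_paths Y y0 \<inter> ?S = {\<gamma> \<in> topspace (based_path_space Y y0). \<gamma> ` K \<subseteq> V}"
    by (auto simp: topspace_based_path_space based_paths_def)
  ultimately show "openin (based_path_space Y y0) {\<gamma> \<in> topspace (based_path_space Y y0). \<gamma> ` K \<subseteq> V}"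
    by simp
qed

text \<open>
  The kifications in \<open>based_path_space\<close> are invisible to k-spaces, so only the compact-open topology
  has to be considered.
\<close>

lemma continuous_map_into_based_path_space:
  assumes Z: "k_space Z" and P: "path_family Z Y P" and P0: "\<And>z. z \<in> topspace Z \<Longrightarrow> P z 0 = y0"
  shows "continuous_map Z (based_path_space Y y0) (\<lambda>z. restrict (P z) {0..1})"
proof -
  let ?r = "\<lambda>z. restrict (P z) {0..1}"
  have r: "?r z \<in> based_paths Y y0" if "z \<in> topspace Z" for z
    using restrict_in_based_paths[OF path_family_path[OF P that] P0[OF that]] .
  have "continuous_map Z (cg_mapping_space unit_interval Y) ?r"
    unfolding cg_mapping_space_def continuous_map_into_kification[OF Z]
  proof (rule continuous_on_generated_topo)
    show "?r ` topspace Z \<subseteq> \<Union> {{f \<in> extensional (topspace unit_interval). continuous_map unit_interval Y f \<and> f ` K \<subseteq> U} |K U.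
        compactin unit_interval K \<and> openin Y U}" (is "_ \<subseteq> \<Union> ?\<B>")
    proof -
      have "\<Union> ?\<B> = {f \<in> extensional (topspace unit_interval). continuous_map unit_interval Y f}"
        using topspace_cg_mapping_space[of unit_interval Y]
        unfolding cg_mapping_space_def topspace_kification topology_generated_by_topspace .
      moreover have "?r ` topspace Z \<subseteq> {f \<in> extensional (topspace unit_interval). continuous_map unit_interval Y f}"
        using r by (auto simp: based_paths_def)
      ultimately show ?thesis by simp
    qed
    fix A assume "A \<in> ?\<B>"
    then obtain K U where A: "A = {f \<in> extensional (topspace unit_interval). continuous_map unit_interval Y f \<and> f ` K \<subseteq> U}"
      and K: "compactin unit_interval K" and U: "openin Y U" by blast
    have K': "compact K" "K \<subseteq> {0..1}" using K by (auto simp: compactin_subtopology)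
    have "?r z ` K = P z ` K" for z using K' by (intro image_cong) auto
    then have "?r -` A \<inter> topspace Z = {z \<in> topspace Z. P z ` K \<subseteq> U}"
      using r by (auto simp: A based_paths_def)
    then show "openin Z (?r -` A \<inter> topspace Z)" using path_family_openin[OF P K' U] by simp
  qed
  then show ?thesis
    unfolding based_path_space_def continuous_map_into_kification[OF Z]
    using r by (auto simp: continuous_map_in_subtopology)
qed

lemma standard_simplex_weighted:
  assumes "t \<in> standard_simplex m"
  shows "is_distribution {..m} t" and "embed_pmf t = weighted_pmf {..m} t"
proof -
  show "is_distribution {..m} t" using assms by (simp add: is_distribution_def standard_simplex_def)
  show "embed_pmf t = weighted_pmf {..m} t"
    unfolding weighted_pmf_def using assms by (intro arg_cong[of _ _ embed_pmf]) (auto simp: standard_simplex_def)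
qed

lemma map_embed_pmf_finite_measures:
  assumes x: "x \<in> {..m} \<rightarrow>\<^sub>E A" and t: "t \<in> standard_simplex m"
  shows "map_pmf x (embed_pmf t) \<in> finite_measures A"
proof -
  have "set_pmf (embed_pmf t) \<subseteq> {..m}"
    using standard_simplex_weighted[OF t] by (auto simp: set_pmf_weighted)
  then show ?thesis using x finite_subset[of _ "{..m}"] by (auto simp: finite_measures_def)
qed

context finite_covering
begin

section \<open>From weights to measures\<close>

definition path_measure :: "('x \<Rightarrow> 'b) \<Rightarrow> ('x \<times> 'l \<Rightarrow> real) \<Rightarrow> ('x \<times> 'l \<Rightarrow> real \<Rightarrow> 'y) \<Rightarrow> 'x \<Rightarrow> (real \<Rightarrow> 'y) pmf"
  where "path_measure \<phi> T \<Gamma> x =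
    map_pmf (\<lambda>u. restrict (\<Gamma> (x, u)) {0..1}) (weighted_pmf (fib (\<phi> x)) (\<lambda>u. T (x, u)))"

lemma weights_distribution:
  assumes "weights n X \<phi> T" "continuous_map X B \<phi>" "x \<in> topspace X"
  shows "is_distribution (fib (\<phi> x)) (\<lambda>u. T (x, u))"
  using assms finite_fib[of "\<phi> x"] by (auto simp: weights_def is_distribution_def continuous_map_def)

lemma path_measure_fiber:
  assumes \<phi>: "continuous_map X B \<phi>" and T: "weights n X \<phi> T"
    and \<Gamma>: "path_family (total X \<phi>) Y \<Gamma>"
    and ends: "\<And>x u. x \<in> topspace X \<Longrightarrow> u \<in> fib (\<phi> x) \<Longrightarrow> \<Gamma> (x, u) 0 = y0 \<and> \<Gamma> (x, u) 1 = \<psi> x"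
    and x: "x \<in> topspace X"
  shows "path_measure \<phi> T \<Gamma> x \<in> fiber_measures_upto n (based_paths Y y0) (topspace Y) (\<lambda>\<gamma>. \<gamma> 1)"
    and "fiber_projection (\<lambda>\<gamma>. \<gamma> 1) (path_measure \<phi> T \<Gamma> x) = \<psi> x"
proof -
  let ?p = "path_measure \<phi> T \<Gamma> x"
  let ?A = "{u \<in> fib (\<phi> x). T (x, u) \<noteq> 0}"
  have set: "set_pmf ?p = (\<lambda>u. restrict (\<Gamma> (x, u)) {0..1}) ` ?A"
    by (simp add: path_measure_def set_pmf_weighted[OF weights_distribution[OF T \<phi> x]])
  have "\<phi> x \<in> topspace B" using \<phi> x by (auto simp: continuous_map_def)
  then have fin: "finite ?A" using finite_fib by simp
  have card: "card ?A \<le> n" using T x by (simp add: weights_def)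
  have \<Gamma>u: "restrict (\<Gamma> (x, u)) {0..1} \<in> based_paths Y y0" "\<psi> x \<in> topspace Y" if "u \<in> fib (\<phi> x)" for u
  proof -
    have z: "(x, u) \<in> topspace (total X \<phi>)" using that x by (simp add: topspace_total[OF \<phi>])
    show "restrict (\<Gamma> (x, u)) {0..1} \<in> based_paths Y y0"
      using restrict_in_based_paths[OF path_family_path[OF \<Gamma> z]] ends[OF x that] by simp
    show "\<psi> x \<in> topspace Y" using path_family_in_topspace[OF \<Gamma> z, of 1] ends[OF x that] by simp
  qed
  have end1: "\<gamma> 1 = \<psi> x" if "\<gamma> \<in> set_pmf ?p" for \<gamma>
    using that ends[OF x] by (auto simp: set)
  obtain \<gamma>0 where \<gamma>0: "\<gamma>0 \<in> set_pmf ?p" using set_pmf_not_empty[of ?p] by blast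
  then have \<psi>: "\<psi> x \<in> topspace Y" using \<Gamma>u(2) by (auto simp: set)
  have "card (set_pmf ?p) \<le> n"
    unfolding set by (rule order_trans[OF card_image_le[OF fin] card])
  then show "?p \<in> fiber_measures_upto n (based_paths Y y0) (topspace Y) (\<lambda>\<gamma>. \<gamma> 1)"
    using ends[OF x] \<psi> \<Gamma>u(1) fin
    by (auto simp: fiber_measures_upto_def measures_upto_def finite_measures_def set
        intro!: bexI[of _ "\<psi> x"])
  have "(\<lambda>\<gamma>. \<gamma> 1) ` set_pmf ?p = (\<lambda>\<gamma>. \<psi> x) ` set_pmf ?p"
    by (rule image_cong) (auto dest: end1)
  also have "\<dots> = {\<psi> x}" by (rule image_constant[OF \<gamma>0])
  finally have "(\<lambda>\<gamma>. \<gamma> 1) ` set_pmf ?p = {\<psi> x}" .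
  then show "fiber_projection (\<lambda>\<gamma>. \<gamma> 1) ?p = \<psi> x" by (simp add: fiber_projection_def)
qed

text \<open>
  Over a neighbourhood of \<open>x0\<close> the sheets through the points of \<open>fib (\<phi> x0)\<close> exhaust the covering. They are
  numbered, since the maps defining the topology of \<open>analog_measures\<close> are indexed by numbers.
\<close>

lemma local_trivialization:
  assumes \<phi>: "continuous_map X B \<phi>" and x0: "x0 \<in> topspace X"
  obtains U v where "openin X U" "x0 \<in> U"
    "\<And>i. i < N \<Longrightarrow> continuous_map (subtopology X U) (total X \<phi>) (\<lambda>x. (x, v i x))"
    "\<And>x. x \<in> U \<Longrightarrow> bij_betw (\<lambda>i. v i x) {..<N} (fib (\<phi> x))"
proof -
  have b0: "\<phi> x0 \<in> topspace B" using \<phi> x0 by (auto simp: continuous_map_def)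
  obtain h where h: "bij_betw h {..<N} (fib (\<phi> x0))"
    using ex_bij_betw_nat_finite[OF finite_fib[OF b0]] by (auto simp: card_fib[OF b0] lessThan_atLeast0)
  have hi: "h i \<in> fib (\<phi> x0)" "h i \<in> L" if "i < N" for i
    using h that fib_in[OF b0] by (auto simp: bij_betw_def)
  define U where "U = {x \<in> topspace X. \<phi> x \<in> {c \<in> topspace B. near (1/2) (\<phi> x0) c}}"
  have U: "openin X U"
    unfolding U_def by (rule openin_continuous_map_preimage[OF \<phi> openin_near[OF b0]])
  have UB: "\<phi> x \<in> topspace B" "x \<in> topspace X" if "x \<in> U" for x using that by (auto simp: U_def)
  define v where "v i x = sheet (h i) (\<phi> x)" for i x
  have v: "v i x \<in> fib (\<phi> x)" "d (h i) (v i x) < 1/2" if ix: "i < N" "x \<in> U" for i x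
  proof -
    obtain u where "u \<in> fib (\<phi> x)" "d (h i) u < 1/2"
      using ix hi(1)[OF ix(1)] by (auto simp: U_def near_def)
    then have "v i x = u" "u \<in> fib (\<phi> x)" "d (h i) u < 1/2"
      using sheet_eq[OF UB(1)[OF ix(2)]] hi(2)[OF ix(1)] by (auto simp: v_def)
    then show "v i x \<in> fib (\<phi> x)" "d (h i) (v i x) < 1/2" by auto
  qed
  show thesis
  proof (rule that[of U v])
    show "x0 \<in> U" using x0 b0 near_refl by (simp add: U_def)
    show "continuous_map (subtopology X U) (total X \<phi>) (\<lambda>x. (x, v i x))" if i: "i < N" for i
    proof (rule continuous_map_into_total)
      show "continuous_map (subtopology X U) X (\<lambda>x. x)" by (simp add: continuous_map_from_subtopology)
      have "\<phi> x \<in> {b. \<exists>u\<in>fib b. d (h i) u < 1/2}" if "x \<in> U" for x using v[OF i that] by blast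
      then have "continuous_map (subtopology X U) (subtopology B {b. \<exists>u\<in>fib b. d (h i) u < 1/2}) \<phi>"
        using continuous_map_from_subtopology[OF \<phi>] by (auto simp: continuous_map_in_subtopology)
      from continuous_map_compose[OF this continuous_map_sheet[OF hi(2)[OF i]]]
      show "continuous_map (subtopology X U) mtopology (v i)" by (simp add: o_def v_def[abs_def])
      show "v i x \<in> fib (\<phi> x)" if "x \<in> topspace (subtopology X U)" for x using v[OF i] that by simp
    qed
    show "bij_betw (\<lambda>i. v i x) {..<N} (fib (\<phi> x))" if x: "x \<in> U" for x
    proof -
      have "inj_on (\<lambda>i. v i x) {..<N}"
      proof (rule inj_onI)
        fix i j assume ij: "i \<in> {..<N}" "j \<in> {..<N}" "v i x = v j x"
        have "v i x \<in> L" using v[of i x] ij x fib_in UB by auto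
        then have "h i = h j"
          using fib_unique[OF b0 hi(1) hi(1), of i j "v i x"] ij v(2)[of i x] v(2)[of j x] x by (simp add: commute)
        then show "i = j" using h ij by (auto simp: bij_betw_def inj_on_def)
      qed
      moreover have "(\<lambda>i. v i x) ` {..<N} \<subseteq> fib (\<phi> x)" using v x by auto
      ultimately show ?thesis
        using card_fib[OF UB(1)[OF x]] finite_fib[OF UB(1)[OF x]]
        by (simp add: bij_betw_def card_image card_subset_eq)
    qed
  qed (rule U)
qed

lemma path_measure_local:
  assumes "weights n X \<phi> T" "continuous_map X B \<phi>" "x \<in> topspace X"
    and bij: "bij_betw (\<lambda>i. v i x) {..<N} (fib (\<phi> x))"
  shows "is_distribution {..<N} (\<lambda>i. T (x, v i x))"
    and "path_measure \<phi> T \<Gamma> x =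
      map_pmf (\<lambda>i. restrict (\<Gamma> (x, v i x)) {0..1}) (weighted_pmf {..<N} (\<lambda>i. T (x, v i x)))"
  using weighted_pmf_bij[OF bij weights_distribution[OF assms(1-3)]]
  by (simp_all add: path_measure_def map_pmf_comp)

section \<open>Measures in the quotient topology\<close>

text \<open>
  Locally, \<open>path_measure\<close> factors through one of the maps that define the quotient topology. As the source
  of this map is a kification, the open subspaces on which the factorization lives have to be k-spaces.
\<close>

lemma continuous_map_analog_path_measure:
  assumes kX: "\<And>U. openin X U \<Longrightarrow> k_space (subtopology X U)"
    and \<phi>: "continuous_map X B \<phi>" and T: "weights n X \<phi> T"
    and \<Gamma>: "path_family (total X \<phi>) Y \<Gamma>"
    and ends: "\<And>x u. x \<in> topspace X \<Longrightarrow> u \<in> fib (\<phi> x) \<Longrightarrow> \<Gamma> (x, u) 0 = y0"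
  shows "continuous_map X (analog_measures (based_path_space Y y0)) (path_measure \<phi> T \<Gamma>)"
proof (rule continuous_map_locally)
  fix x0 assume x0: "x0 \<in> topspace X"
  obtain U v where U: "openin X U" "x0 \<in> U"
    and v: "\<And>i. i < N \<Longrightarrow> continuous_map (subtopology X U) (total X \<phi>) (\<lambda>x. (x, v i x))"
    and bij: "\<And>x. x \<in> U \<Longrightarrow> bij_betw (\<lambda>i. v i x) {..<N} (fib (\<phi> x))"
    using local_trivialization[OF \<phi> x0] by blast
  let ?U = "subtopology X U" and ?Q = "based_path_space Y y0"
  have UX: "x \<in> topspace X" if "x \<in> U" for x using U that openin_subset by blast
  have k: "k_space ?U" by (rule kX[OF U(1)])
  obtain m where m: "N = Suc m" using N_pos gr0_implies_Suc by blast
  define g where "g i x = restrict (\<Gamma> (x, v i x)) {0..1}" for i x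
  define w where "w i x = (if i \<le> m then T (x, v i x) else 0)" for i x
  have dist: "is_distribution {..<N} (\<lambda>i. T (x, v i x))" if "x \<in> U" for x
    using path_measure_local(1)[where v = v, OF T \<phi> UX[OF that] bij[OF that]] .
  have g: "continuous_map ?U ?Q (g i)" if "i \<le> m" for i
    unfolding g_def
  proof (rule continuous_map_into_based_path_space[OF k])
    show "path_family ?U Y (\<lambda>x. \<Gamma> (x, v i x))"
      using path_family_reindex[OF \<Gamma> v] that m by simp
    show "\<Gamma> (x, v i x) 0 = y0" if "x \<in> topspace ?U" for x
      using bij[of x] that \<open>i \<le> m\<close> m by (intro ends) (auto simp: bij_betw_def)
  qed
  have w: "continuous_map ?U euclideanreal (w i)" for i
  proof (cases "i \<le> m")
    case True
    have "continuous_map (total X \<phi>) euclideanreal T" using T by (simp add: weights_def)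
    from continuous_map_compose[OF v this, of i] True m
    have "continuous_map ?U euclideanreal (\<lambda>x. T (x, v i x))" by (simp add: o_def)
    then show ?thesis using True by (simp add: w_def[abs_def])
  qed (simp add: w_def[abs_def])
  let ?P = "prod_topology (product_topology (\<lambda>_. ?Q) {..m}) (simplex_topology m)"
  let ?c = "\<lambda>x. (restrict (\<lambda>i. g i x) {..m}, \<lambda>i. w i x)"
  have simplex: "(\<lambda>i. w i x) \<in> standard_simplex m" if "x \<in> U" for x
  proof -
    have "0 \<le> T (x, v i x)" if "i \<le> m" for i
      using dist[OF \<open>x \<in> U\<close>] that m by (auto simp: is_distribution_def)
    moreover have s: "(\<Sum>i\<le>m. w i x) = 1"
      using dist[OF that] by (simp add: w_def is_distribution_def m lessThan_Suc_atMost)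
    moreover have "w i x \<le> 1" for i
    proof (cases "i \<le> m")
      case True
      have "w i x \<le> (\<Sum>i\<le>m. w i x)" using True calculation(1) by (intro member_le_sum) (auto simp: w_def)
      then show ?thesis using s by simp
    qed (simp add: w_def)
    moreover have "0 \<le> w i x" for i using calculation(1) by (simp add: w_def)
    moreover have "w i x = 0" if "m < i" for i using that by (simp add: w_def)
    ultimately show ?thesis by (simp add: standard_simplex_def)
  qed
  have "continuous_map ?U ?P ?c"
  proof (rule continuous_map_pairedI)
    show "continuous_map ?U (product_topology (\<lambda>_. ?Q) {..m}) (\<lambda>x. restrict (\<lambda>i. g i x) {..m})"
      using g by (auto simp: continuous_map_componentwise)
    show "continuous_map ?U (simplex_topology m) (\<lambda>x i. w i x)"
      using w simplex by (auto simp: continuous_map_in_subtopology continuous_map_componentwise_UNIV)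
  qed
  then have "continuous_map ?U (kification ?P) ?c"
    by (simp add: continuous_map_into_kification[OF k])
  moreover have "continuous_map (kification ?P) (analog_measures ?Q) (\<lambda>(x, t). map_pmf x (embed_pmf t))"
    unfolding analog_measures_def
    by (rule continuous_map_final_topology) (auto intro: map_embed_pmf_finite_measures)
  ultimately have "continuous_map ?U (analog_measures ?Q) ((\<lambda>(x, t). map_pmf x (embed_pmf t)) \<circ> ?c)"
    by (rule continuous_map_compose)
  then have "continuous_map ?U (analog_measures ?Q) (path_measure \<phi> T \<Gamma>)"
  proof (rule continuous_map_eq)
    fix x assume "x \<in> topspace ?U"
    then have x: "x \<in> U" by simp
    have emb: "embed_pmf (\<lambda>i. w i x) = weighted_pmf {..<N} (\<lambda>i. T (x, v i x))"
      unfolding weighted_pmf_def by (intro arg_cong[of _ _ embed_pmf]) (auto simp: w_def m)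
    have "map_pmf (restrict (\<lambda>i. g i x) {..m}) (weighted_pmf {..<N} (\<lambda>i. T (x, v i x)))
      = map_pmf (\<lambda>i. g i x) (weighted_pmf {..<N} (\<lambda>i. T (x, v i x)))"
      using set_pmf_weighted[OF dist[OF x]] by (intro map_pmf_cong) (auto simp: m)
    then show "((\<lambda>(x, t). map_pmf x (embed_pmf t)) \<circ> ?c) x = path_measure \<phi> T \<Gamma> x"
      using path_measure_local(2)[where v = v and \<Gamma> = \<Gamma>, OF T \<phi> UX[OF x] bij[OF x]]
      by (simp add: emb g_def)
  qed
  then show "\<exists>U. openin X U \<and> x0 \<in> U \<and> continuous_map (subtopology X U) (analog_measures ?Q) (path_measure \<phi> T \<Gamma>)"
    using U by blast
qed

end

text \<open>
  The measure \<open>\<Sum>i. t i * \<delta>(x i)\<close> gives \<open>W\<close> mass greater than \<open>c\<close> iff the \<open>x i\<close> lie in \<open>W\<close> for all \<open>i\<close> in some set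
  \<open>I\<close> over which the \<open>t i\<close> add up to more than \<open>c\<close>. For fixed \<open>I\<close> this is an open condition on \<open>x\<close> and \<open>t\<close>.
\<close>

lemma openin_analog_measures_prob:
  assumes W: "openin Q W"
  shows "openin (analog_measures Q) {p \<in> finite_measures (topspace Q). c < measure_pmf.prob p W}"
  unfolding analog_measures_def openin_final_topology
proof (intro conjI allI)
  fix m
  let ?P = "prod_topology (product_topology (\<lambda>_. Q) {..m}) (simplex_topology m)"
  let ?f = "\<lambda>(x, t). map_pmf x (embed_pmf t)"
  have prob: "measure_pmf.prob (?f (x, t)) W = sum t {i\<in>{..m}. x i \<in> W}" if "t \<in> standard_simplex m" for x t
    using standard_simplex_weighted[OF that] by (simp add: prob_weighted vimage_def Int_def)
  have fin: "?f (x, t) \<in> finite_measures (topspace Q)"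
    if "x \<in> {..m} \<rightarrow>\<^sub>E topspace Q" "t \<in> standard_simplex m" for x t
    using map_embed_pmf_finite_measures[OF that] by simp
  let ?S = "\<lambda>I. {z \<in> topspace ?P. (\<forall>i\<in>I. fst z i \<in> W) \<and> c < sum (snd z) I}"
  have "openin ?P (?S I)" if I: "I \<subseteq> {..m}" for I
  proof -
    have finI: "finite I" using I finite_subset by blast
    have 1: "continuous_map ?P Q (\<lambda>z. fst z i)" if "i \<in> I" for i
      using continuous_map_compose[OF continuous_map_fst continuous_map_product_projection, of i "{..m}" "\<lambda>_. Q"] that I
      by (auto simp: o_def)
    have 2: "continuous_map ?P euclideanreal (\<lambda>z. snd z i)" for i
    proof -
      have "continuous_map (simplex_topology m) euclideanreal (\<lambda>t. t i)"
        by (intro continuous_map_from_subtopology continuous_map_product_projection) simp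
      from continuous_map_compose[OF continuous_map_snd this] show ?thesis by (simp add: o_def)
    qed
    have "continuous_map ?P euclideanreal (\<lambda>z. sum (snd z) I)"
      using finI 2 by (intro continuous_map_sum)
    then have "openin ?P {z \<in> topspace ?P. sum (snd z) I \<in> {c<..}}"
      by (rule openin_continuous_map_preimage) auto
    moreover have "openin ?P (topspace ?P \<inter> (\<Inter>i\<in>I. {z \<in> topspace ?P. fst z i \<in> W}))"
    proof (cases "I = {}")
      case False
      have "openin ?P (\<Inter>i\<in>I. {z \<in> topspace ?P. fst z i \<in> W})"
        using finI False openin_continuous_map_preimage[OF 1 W] by (rule openin_INT2)
      then show ?thesis by (rule openin_Int[OF openin_topspace])
    next
      case True
      show ?thesis unfolding True using openin_topspace[of ?P] by (simp only: INT_empty Int_UNIV_right)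
    qed
    ultimately have "openin ?P ({z \<in> topspace ?P. sum (snd z) I \<in> {c<..}} \<inter>
        (topspace ?P \<inter> (\<Inter>i\<in>I. {z \<in> topspace ?P. fst z i \<in> W})))"
      by (rule openin_Int)
    moreover have "{z \<in> topspace ?P. sum (snd z) I \<in> {c<..}} \<inter>
        (topspace ?P \<inter> (\<Inter>i\<in>I. {z \<in> topspace ?P. fst z i \<in> W})) = ?S I"
      by auto
    ultimately show ?thesis by simp
  qed
  then have "openin ?P (\<Union>I\<in>Pow {..m}. ?S I)" by blast
  moreover have "(\<Union>I\<in>Pow {..m}. ?S I)
      = {z \<in> topspace (kification ?P). ?f z \<in> {p \<in> finite_measures (topspace Q). c < measure_pmf.prob p W}}"
  proof (rule subset_antisym; rule subsetI)
    fix z assume "z \<in> (\<Union>I\<in>Pow {..m}. ?S I)"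
    then obtain I x t where z: "z = (x, t)" "z \<in> topspace ?P" "I \<subseteq> {..m}" "\<forall>i\<in>I. x i \<in> W" "c < sum t I"
      by (cases z) auto
    then have xt: "x \<in> {..m} \<rightarrow>\<^sub>E topspace Q" "t \<in> standard_simplex m" by auto
    have "sum t I \<le> sum t {i\<in>{..m}. x i \<in> W}"
      using z xt by (intro sum_mono2) (auto simp: standard_simplex_def)
    then show "z \<in> {z \<in> topspace (kification ?P). ?f z \<in> {p \<in> finite_measures (topspace Q). c < measure_pmf.prob p W}}"
      using z prob[OF xt(2), of x] fin[OF xt] by simp
  next
    fix z assume z: "z \<in> {z \<in> topspace (kification ?P). ?f z \<in> {p \<in> finite_measures (topspace Q). c < measure_pmf.prob p W}}"
    obtain x t where xt: "z = (x, t)" by (cases z)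
    then have t: "t \<in> standard_simplex m" using z by simp
    show "z \<in> (\<Union>I\<in>Pow {..m}. ?S I)"
      using z prob[OF t, of x] by (intro UN_I[of "{i\<in>{..m}. x i \<in> W}"]) (auto simp: xt)
  qed
  ultimately show "openin (kification ?P)
      {z \<in> topspace (kification ?P). ?f z \<in> {p \<in> finite_measures (topspace Q). c < measure_pmf.prob p W}}"
    using openin_kification_finer by simp
qed auto

lemma continuous_map_analog_fiber_measuresD:
  assumes "continuous_map Y (analog_fiber_measures n X Y' f) s"
  shows "continuous_map Y (analog_measures X) s"
    and "\<And>y. y \<in> topspace Y \<Longrightarrow> s y \<in> fiber_measures_upto n (topspace X) (topspace Y') f"
proof -
  have *: "continuous_map Y (subtopology (analog_measures_upto n X) (fiber_measures_upto n (topspace X) (topspace Y') f)) s"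
    using assms unfolding analog_fiber_measures_def by (rule continuous_map_from_kification_into)
  then show "\<And>y. y \<in> topspace Y \<Longrightarrow> s y \<in> fiber_measures_upto n (topspace X) (topspace Y') f"
    by (auto simp: continuous_map_def)
  have "continuous_map Y (analog_measures_upto n X) s"
    using * by (simp add: continuous_map_in_subtopology)
  then have "continuous_map Y (subtopology (analog_measures X) (measures_upto n (topspace X))) s"
    unfolding analog_measures_upto_def by (rule continuous_map_from_kification_into)
  then show "continuous_map Y (analog_measures X) s" by (simp add: continuous_map_in_subtopology)
qed

lemma continuous_map_analog_fiber_measuresI:
  assumes Z: "k_space Z" and s: "continuous_map Z (analog_measures X) s"
    and fib: "\<And>z. z \<in> topspace Z \<Longrightarrow> s z \<in> fiber_measures_upto n (topspace X) (topspace Y') f"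
  shows "continuous_map Z (analog_fiber_measures n X Y' f) s"
  unfolding analog_fiber_measures_def analog_measures_upto_def
  using s fib Z by (auto simp: continuous_map_into_kification continuous_map_in_subtopology fiber_measures_upto_def)

section \<open>The Levy-Prokhorov topology\<close>

context Metric_space
begin

lemma path_dist_ge:
  assumes "\<gamma> \<in> based_paths mtopology x0" "\<delta> \<in> based_paths mtopology x0" "t \<in> {0..1}"
  shows "d (\<gamma> t) (\<delta> t) \<le> path_dist d \<gamma> \<delta>"
proof -
  have "continuous_map unit_interval euclidean (\<lambda>t. d (\<gamma> t) (\<delta> t))"
    using assms(1,2) continuous_map_mdist[of unit_interval "metric (M, d)" \<gamma> \<delta>]
    by (simp add: based_paths_def)
  then have "bdd_above ((\<lambda>t. d (\<gamma> t) (\<delta> t)) ` {0..1})"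
    by (intro bounded_imp_bdd_above compact_imp_bounded compact_continuous_image) auto
  then show ?thesis using cSUP_upper[OF assms(3)] by (simp add: path_dist_def)
qed

lemma path_dist_le:
  assumes "\<And>t. t \<in> {0..1} \<Longrightarrow> d (\<gamma> t) (\<delta> t) \<le> c"
  shows "path_dist d \<gamma> \<delta> \<le> c"
proof -
  have "bdd_above ((\<lambda>t. d (\<gamma> t) (\<delta> t)) ` {0..1})" using assms by (intro bdd_aboveI[of _ c]) auto
  then show ?thesis using assms by (auto simp: path_dist_def intro!: cSUP_least)
qed

abbreviation metric_path_space :: "'a \<Rightarrow> (real \<Rightarrow> 'a) topology"
  where "metric_path_space x0 \<equiv> Metric_space.mtopology (based_paths mtopology x0) (path_dist d)"

lemma path_family_metric_path_space: "path_family (metric_path_space x0) mtopology (\<lambda>\<gamma>. \<gamma>)"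
proof -
  interpret P: Metric_space "based_paths mtopology x0" "path_dist d"
    by (rule Metric_space_path_dist) (rule Metric_space_axioms)
  show ?thesis
  proof (rule path_familyI)
    show c: "continuous_map unit_interval mtopology \<gamma>" if "\<gamma> \<in> topspace P.mtopology" for \<gamma>
      using that by (simp add: P.topspace_mtopology) (simp add: based_paths_def)
    fix K :: "real set" and V assume K: "compact K" "K \<subseteq> {0..1}" and V: "openin mtopology V"
    show "openin P.mtopology {\<gamma> \<in> topspace P.mtopology. \<gamma> ` K \<subseteq> V}"
      unfolding P.openin_mtopology
    proof (intro conjI allI impI)
      fix \<gamma> assume "\<gamma> \<in> {\<gamma> \<in> topspace P.mtopology. \<gamma> ` K \<subseteq> V}"
      then have \<gamma>: "\<gamma> \<in> based_paths mtopology x0" "\<gamma> ` K \<subseteq> V" by auto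
      have "compactin unit_interval K" using K by (simp add: compactin_subtopology)
      then have "compactin mtopology (\<gamma> ` K)" using \<gamma> c by (intro image_compactin) auto
      then obtain e where e: "e > 0" "\<forall>x\<in>\<gamma> ` K. \<exists>U\<in>{V}. mball x e \<subseteq> U"
        using lebesgue_number[of "\<gamma> ` K" "{V}"] \<gamma>(2) V by auto
      have "P.mball \<gamma> e \<subseteq> {\<gamma> \<in> topspace P.mtopology. \<gamma> ` K \<subseteq> V}"
      proof
        fix \<delta> assume "\<delta> \<in> P.mball \<gamma> e"
        then have \<delta>: "\<delta> \<in> based_paths mtopology x0" "path_dist d \<gamma> \<delta> < e" by auto
        have "\<delta> t \<in> V" if t: "t \<in> K" for t
        proof -
          have t01: "t \<in> {0..1}" using t K by blast
          have "\<gamma> t \<in> M" "\<delta> t \<in> M"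
            using based_path_in_topspace[OF \<gamma>(1) t01] based_path_in_topspace[OF \<delta>(1) t01] by simp_all
          then have "\<delta> t \<in> mball (\<gamma> t) e" using path_dist_ge[OF \<gamma>(1) \<delta>(1) t01] \<delta>(2) by simp
          then show ?thesis using e(2) t by blast
        qed
        then show "\<delta> \<in> {\<gamma> \<in> topspace P.mtopology. \<gamma> ` K \<subseteq> V}" using \<delta> by auto
      qed
      then show "\<exists>r>0. P.mball \<gamma> r \<subseteq> {\<gamma> \<in> topspace P.mtopology. \<gamma> ` K \<subseteq> V}" using e by blast
    qed auto
  qed
qed

lemma continuous_map_into_metric_path_space:
  assumes P: "path_family Z mtopology P" and P0: "\<And>z. z \<in> topspace Z \<Longrightarrow> P z 0 = x0"
  shows "continuous_map Z (metric_path_space x0) (\<lambda>z. restrict (P z) {0..1})"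
proof -
  interpret Q: Metric_space "based_paths mtopology x0" "path_dist d"
    by (rule Metric_space_path_dist) (rule Metric_space_axioms)
  have r: "restrict (P z) {0..1} \<in> based_paths mtopology x0" if "z \<in> topspace Z" for z
    using restrict_in_based_paths[OF path_family_path[OF P that] P0[OF that]] .
  show ?thesis
    unfolding Q.continuous_map_to_metric
  proof (intro ballI allI impI)
    fix z and e :: real assume z: "z \<in> topspace Z" and e: "0 < e"
    have "\<exists>U. openin Z U \<and> z \<in> U \<and> (\<forall>y\<in>U. \<forall>t\<in>{0..1}. d (P z t) (P y t) < e/2)"
    proof (rule path_family_uniformly_close[OF P z])
      fix y assume y: "y \<in> topspace mtopology"
      have "d a b < e/2" if "a \<in> mball y (e/4)" "b \<in> mball y (e/4)" for a b
        using that triangle[of a y b] commute[of a y] by auto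
      then show "\<exists>V. openin mtopology V \<and> y \<in> V \<and> (\<forall>a\<in>V. \<forall>b\<in>V. d a b < e/2)"
        using y e by (intro exI[of _ "mball y (e/4)"]) auto
    qed
    then obtain U where U: "openin Z U" "z \<in> U" "\<forall>y\<in>U. \<forall>t\<in>{0..1}. d (P z t) (P y t) < e/2" by blast
    have "restrict (P y) {0..1} \<in> Q.mball (restrict (P z) {0..1}) e" if y: "y \<in> U" for y
    proof -
      have "y \<in> topspace Z" using y U(1) openin_subset by blast
      moreover have "path_dist d (restrict (P z) {0..1}) (restrict (P y) {0..1}) \<le> e/2"
        using U(3) y by (intro path_dist_le) (simp add: less_imp_le)
      ultimately show ?thesis using r z e by (simp add: Q.in_mball)
    qed
    then show "\<exists>U. openin Z U \<and> z \<in> U \<and> (\<forall>y\<in>U. restrict (P y) {0..1} \<in> Q.mball (restrict (P z) {0..1}) e)"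
      using U by blast
  qed
qed

lemma levy_prokhorov_leI:
  assumes "0 < e"
    and "\<And>A. A \<subseteq> M \<Longrightarrow> measure_pmf.prob p A \<le> measure_pmf.prob q (thickening M d e A) + e"
    and "\<And>A. A \<subseteq> M \<Longrightarrow> measure_pmf.prob q A \<le> measure_pmf.prob p (thickening M d e A) + e"
  shows "levy_prokhorov_dist M d p q \<le> e"
  unfolding levy_prokhorov_dist_def
proof (rule cInf_lower)
  have "A \<subseteq> M" if "A \<in> sigma_sets M {U. openin mtopology U}" for A
    using that by (rule sigma_sets_into_sp[rotated]) (use openin_subset topspace_mtopology in blast)
  then show "e \<in> {e. 0 < e \<and> (\<forall>A\<in>sigma_sets M {U. openin mtopology U}.
      measure_pmf.prob p A \<le> measure_pmf.prob q (thickening M d e A) + e \<and>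
      measure_pmf.prob q A \<le> measure_pmf.prob p (thickening M d e A) + e)}"
    using assms by blast
qed (auto intro: bdd_belowI[of _ 0])

text \<open>
  Finite sets are closed, hence Borel, so they may be tested in the definition of the distance.
\<close>

lemma levy_prokhorov_lessD:
  assumes "levy_prokhorov_dist M d p q < e" and A: "finite A" "A \<subseteq> M"
  shows "measure_pmf.prob p A \<le> measure_pmf.prob q (thickening M d e A) + e"
proof -
  let ?B = "sigma_sets M {U. openin mtopology U}"
  let ?L = "{e. 0 < e \<and> (\<forall>A\<in>?B.
      measure_pmf.prob p A \<le> measure_pmf.prob q (thickening M d e A) + e \<and>
      measure_pmf.prob q A \<le> measure_pmf.prob p (thickening M d e A) + e)}"
  have "(1::real) \<in> ?L" by (auto intro!: add_increasing measure_pmf.prob_le_1)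
  then obtain e' where e': "e' \<in> ?L" "e' < e"
    using assms(1) cInf_lessD[of ?L e] unfolding levy_prokhorov_dist_def by blast
  have "closedin mtopology A"
    using A by (simp add: closedin_Hausdorff_finite Hausdorff_space_mtopology)
  then have "M - (M - A) \<in> ?B"
    by (intro sigma_sets.Compl sigma_sets.Basic) (auto simp: closedin_def)
  then have "A \<in> ?B" using A by (simp add: double_diff)
  then have "measure_pmf.prob p A \<le> measure_pmf.prob q (thickening M d e' A) + e'"
    using e' by blast
  also have "measure_pmf.prob q (thickening M d e' A) \<le> measure_pmf.prob q (thickening M d e A)"
    using e'(2) by (intro measure_pmf.finite_measure_mono) (auto simp: thickening_def intro: less_trans)
  finally show ?thesis using e'(2) by linarith
qed

text \<open>
  The finite set \<open>A\<close> of points of the support of \<open>p\<close> in \<open>W\<close> has a thickening inside \<open>W\<close>, and a measure close to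
  \<open>p\<close> gives this thickening almost as much mass as \<open>p\<close> gives \<open>A\<close>.
\<close>

lemma openin_levy_prokhorov_prob:
  assumes W: "openin mtopology W"
  shows "openin (distributional_measures_upto n M d) {p \<in> measures_upto n M. c < measure_pmf.prob p W}"
proof -
  interpret LP: Metric_space "measures_upto n M" "levy_prokhorov_dist M d"
    by (rule Metric_space_levy_prokhorov) (rule Metric_space_axioms)
  show ?thesis
    unfolding distributional_measures_upto_def LP.openin_mtopology
  proof (intro conjI allI impI)
    fix p assume "p \<in> {p \<in> measures_upto n M. c < measure_pmf.prob p W}"
    then have p: "p \<in> measures_upto n M" "c < measure_pmf.prob p W" by auto
    define A where "A = set_pmf p \<inter> W"
    have A: "finite A" "A \<subseteq> M" "A \<subseteq> W" using p by (auto simp: A_def measures_upto_def finite_measures_def)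
    have pA: "measure_pmf.prob p A = measure_pmf.prob p W"
      unfolding A_def by (metis Int_commute measure_Int_set_pmf)
    have "compactin mtopology A" using A by (simp add: finite_imp_compactin)
    then obtain e0 where e0: "e0 > 0" "\<forall>x\<in>A. \<exists>U\<in>{W}. mball x e0 \<subseteq> U"
      using lebesgue_number[of A "{W}"] A W by auto
    define e where "e = min e0 (measure_pmf.prob p W - c)"
    have e: "0 < e" "e \<le> e0" "e \<le> measure_pmf.prob p W - c" using e0 p by (auto simp: e_def)
    have sub: "thickening M d e A \<subseteq> W"
    proof
      fix y assume "y \<in> thickening M d e A"
      then obtain a where a: "a \<in> A" "d a y < e" "y \<in> M" by (auto simp: thickening_def)
      then have "y \<in> mball a e0" using e A by auto
      then show "y \<in> W" using e0 a by blast
    qed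
    have "LP.mball p e \<subseteq> {p \<in> measures_upto n M. c < measure_pmf.prob p W}"
    proof
      fix q assume q: "q \<in> LP.mball p e"
      then have "levy_prokhorov_dist M d p q < e" by simp
      then obtain e1 where e1: "levy_prokhorov_dist M d p q < e1" "e1 < e"
        using dense by blast
      have "measure_pmf.prob p A \<le> measure_pmf.prob q (thickening M d e1 A) + e1"
        by (rule levy_prokhorov_lessD[OF e1(1) A(1,2)])
      also have "measure_pmf.prob q (thickening M d e1 A) \<le> measure_pmf.prob q W"
        using sub e1 by (intro measure_pmf.finite_measure_mono) (fastforce simp: thickening_def)+
      finally have "c < measure_pmf.prob q W" using e e1 pA by linarith
      then show "q \<in> {p \<in> measures_upto n M. c < measure_pmf.prob p W}" using q by simp
    qed
    then show "\<exists>r>0. LP.mball p r \<subseteq> {p \<in> measures_upto n M. c < measure_pmf.prob p W}"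
      using e by blast
  qed auto
qed

text \<open>
  Moving the points by less than \<open>e\<close> costs a thickening by \<open>e\<close>, and changing the weights by \<open>e\<close> in total
  costs the summand \<open>e\<close>.
\<close>

lemma prob_weighted_thickening:
  assumes w: "is_distribution I w" "is_distribution I w'" and g: "\<And>i. i \<in> I \<Longrightarrow> g i \<in> M \<and> g' i \<in> M \<and> d (g i) (g' i) < e"
    and ww: "(\<Sum>i\<in>I. \<bar>w i - w' i\<bar>) \<le> e"
  shows "measure_pmf.prob (map_pmf g (weighted_pmf I w)) A
    \<le> measure_pmf.prob (map_pmf g' (weighted_pmf I w')) (thickening M d e A) + e"
proof -
  have fin: "finite I" and pos: "\<And>i. i \<in> I \<Longrightarrow> 0 \<le> w' i" using w by (auto simp: is_distribution_def)
  have "sum w (I \<inter> g -` A) \<le> sum w' (I \<inter> g -` A) + (\<Sum>i\<in>I \<inter> g -` A. \<bar>w i - w' i\<bar>)"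
    unfolding sum.distrib[symmetric] by (intro sum_mono) auto
  also have "(\<Sum>i\<in>I \<inter> g -` A. \<bar>w i - w' i\<bar>) \<le> (\<Sum>i\<in>I. \<bar>w i - w' i\<bar>)"
    using fin by (intro sum_mono2) auto
  also have "sum w' (I \<inter> g -` A) \<le> sum w' (I \<inter> g' -` thickening M d e A)"
    using fin pos g by (intro sum_mono2) (auto simp: thickening_def)
  finally have "sum w (I \<inter> g -` A) \<le> sum w' (I \<inter> g' -` thickening M d e A) + e"
    using ww by simp
  then show ?thesis by (simp add: prob_weighted[OF w(1)] prob_weighted[OF w(2)])
qed

lemma levy_prokhorov_weighted:
  assumes "is_distribution I w" "is_distribution I w'" and g: "\<And>i. i \<in> I \<Longrightarrow> g i \<in> M \<and> g' i \<in> M \<and> d (g i) (g' i) < e"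
    and "(\<Sum>i\<in>I. \<bar>w i - w' i\<bar>) \<le> e" and "0 < e"
  shows "levy_prokhorov_dist M d (map_pmf g (weighted_pmf I w)) (map_pmf g' (weighted_pmf I w')) \<le> e"
  using assms g commute
  by (intro levy_prokhorov_leI prob_weighted_thickening) (auto simp: abs_minus_commute)

end

context finite_covering
begin

lemma continuous_map_distributional_path_measure:
  assumes M: "Metric_space M dM"
    and \<phi>: "continuous_map X B \<phi>" and T: "weights n X \<phi> T"
    and \<Gamma>: "path_family (total X \<phi>) (Metric_space.mtopology M dM) \<Gamma>"
    and ends: "\<And>x u. x \<in> topspace X \<Longrightarrow> u \<in> fib (\<phi> x) \<Longrightarrow> \<Gamma> (x, u) 0 = y0"
    and upto: "\<And>x. x \<in> topspace X \<Longrightarrow>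
      path_measure \<phi> T \<Gamma> x \<in> measures_upto n (based_paths (Metric_space.mtopology M dM) y0)"
  shows "continuous_map X (distributional_measures_upto n (based_paths (Metric_space.mtopology M dM) y0)
    (path_dist dM)) (path_measure \<phi> T \<Gamma>)"
proof -
  interpret M: Metric_space M dM by (rule M)
  let ?Q = "based_paths M.mtopology y0"
  interpret Q: Metric_space ?Q "path_dist dM" by (rule Metric_space_path_dist) (rule M)
  interpret LP: Metric_space "measures_upto n ?Q" "levy_prokhorov_dist ?Q (path_dist dM)"
    by (rule Metric_space_levy_prokhorov) (rule Q.Metric_space_axioms)
  show ?thesis
    unfolding distributional_measures_upto_def LP.continuous_map_to_metric
  proof (intro ballI allI impI)
    fix x0 and \<epsilon> :: real assume x0: "x0 \<in> topspace X" and \<epsilon>: "0 < \<epsilon>"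
    \<comment> \<open>The estimate below bounds the distance by \<open>e\<close> only weakly, hence the factor 1/2.\<close>
    define e where "e = \<epsilon> / 2"
    have e: "0 < e" "e < \<epsilon>" using \<epsilon> by (auto simp: e_def)
    obtain U v where U: "openin X U" "x0 \<in> U"
      and v: "\<And>i. i < N \<Longrightarrow> continuous_map (subtopology X U) (total X \<phi>) (\<lambda>x. (x, v i x))"
      and bij: "\<And>x. x \<in> U \<Longrightarrow> bij_betw (\<lambda>i. v i x) {..<N} (fib (\<phi> x))"
      using local_trivialization[OF \<phi> x0] by blast
    let ?U = "subtopology X U"
    have UX: "x \<in> topspace X" if "x \<in> U" for x using U that openin_subset by blast
    have topU: "topspace ?U = U" using UX by auto
    define g where "g i x = restrict (\<Gamma> (x, v i x)) {0..1}" for i x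
    have dist: "is_distribution {..<N} (\<lambda>i. T (x, v i x))"
      and pm: "path_measure \<phi> T \<Gamma> x = map_pmf (\<lambda>i. g i x) (weighted_pmf {..<N} (\<lambda>i. T (x, v i x)))"
      if "x \<in> U" for x
      using path_measure_local(1)[where v = v, OF T \<phi> UX[OF that] bij[OF that]]
        path_measure_local(2)[where v = v and \<Gamma> = \<Gamma>, OF T \<phi> UX[OF that] bij[OF that]]
      by (auto simp: g_def)
    have g: "continuous_map ?U Q.mtopology (g i)" if "i < N" for i
      unfolding g_def
    proof (rule M.continuous_map_into_metric_path_space)
      show "path_family ?U M.mtopology (\<lambda>x. \<Gamma> (x, v i x))"
        using path_family_reindex[OF \<Gamma> v] that by simp
      show "\<Gamma> (x, v i x) 0 = y0" if "x \<in> topspace ?U" for x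
        using bij[of x] that \<open>i < N\<close> by (intro ends) (auto simp: bij_betw_def)
    qed
    have w: "continuous_map ?U euclideanreal (\<lambda>x. T (x, v i x))" if "i < N" for i
    proof -
      have "continuous_map (total X \<phi>) euclideanreal T" using T by (simp add: weights_def)
      from continuous_map_compose[OF v this, OF that] show ?thesis by (simp add: o_def)
    qed
    have "\<exists>V. openin ?U V \<and> x0 \<in> V \<and> (\<forall>y\<in>V. g i y \<in> Q.mball (g i x0) e)" if "i < N" for i
      using g[OF that] U UX[OF U(2)] e(1) unfolding Q.continuous_map_to_metric topU by blast
    then obtain V where V: "\<And>i. i < N \<Longrightarrow> openin ?U (V i) \<and> x0 \<in> V i \<and> (\<forall>y\<in>V i. g i y \<in> Q.mball (g i x0) e)"
      by metis
    let ?D = "\<lambda>x. \<Sum>i<N. \<bar>T (x0, v i x0) - T (x, v i x)\<bar>"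
    have "continuous_map ?U euclideanreal ?D"
      using w by (intro continuous_map_sum continuous_map_real_abs continuous_map_diff) auto
    then have D: "openin ?U {x \<in> topspace ?U. ?D x \<in> {..<e}}"
      by (rule openin_continuous_map_preimage) auto
    define O' where "O' = {x \<in> topspace ?U. ?D x \<in> {..<e}} \<inter> (\<Inter>i\<in>{..<N}. V i)"
    have "openin ?U O'"
      unfolding O'_def using V N_pos by (intro openin_Int[OF D] openin_INT2) auto
    then have "openin X O'" using U(1) openin_trans_full by blast
    moreover have "x0 \<in> O'" using V U e UX[OF U(2)] by (simp add: O'_def)
    moreover have "path_measure \<phi> T \<Gamma> x \<in> LP.mball (path_measure \<phi> T \<Gamma> x0) \<epsilon>" if x: "x \<in> O'" for x
    proof -
      have xU: "x \<in> U" and xV: "\<And>i. i < N \<Longrightarrow> x \<in> V i" and xD: "?D x < e"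
        using x topU by (auto simp: O'_def)
      have "levy_prokhorov_dist ?Q (path_dist dM) (path_measure \<phi> T \<Gamma> x0) (path_measure \<phi> T \<Gamma> x) \<le> e"
        unfolding pm[OF xU] pm[OF U(2)]
      proof (rule Q.levy_prokhorov_weighted[OF dist[OF U(2)] dist[OF xU]])
        fix i assume "i \<in> {..<N}"
        then have "g i x \<in> Q.mball (g i x0) e" using V xV by blast
        then show "g i x0 \<in> ?Q \<and> g i x \<in> ?Q \<and> path_dist dM (g i x0) (g i x) < e" by simp
      qed (use xD e in auto)
      then show ?thesis using upto x0 UX[OF xU] e by simp
    qed
    ultimately show "\<exists>U. openin X U \<and> x0 \<in> U \<and>
        (\<forall>y\<in>U. path_measure \<phi> T \<Gamma> y \<in> LP.mball (path_measure \<phi> T \<Gamma> x0) \<epsilon>)" by blast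
  qed
qed

end

section \<open>Sections and weights\<close>

lemma fiber_projectionD:
  assumes "p \<in> fiber_measures_upto n A C f" "fiber_projection f p = y" "x \<in> set_pmf p"
  shows "f x = y"
proof -
  obtain y' where y': "\<forall>x\<in>set_pmf p. f x = y'" using assms(1) by (auto simp: fiber_measures_upto_def)
  then have "f ` set_pmf p = {y'}" using assms(3) by auto
  then show ?thesis using assms(2,3) y' by (simp add: fiber_projection_def)
qed

context finite_covering
begin

lemma continuous_map_lift_end_path:
  assumes Q: "path_family Q Y (\<lambda>\<gamma>. \<gamma>)" and base: "topspace Q = based_paths Y y0"
    and \<phi>: "continuous_map Y B \<phi>" and u: "u \<in> fib (\<phi> y0)"
  shows "continuous_map Q mtopology (\<lambda>\<gamma>. lift_end (\<lambda>t. \<phi> (\<gamma> t)) u)"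
    and "\<And>\<gamma>. \<gamma> \<in> topspace Q \<Longrightarrow> lift_end (\<lambda>t. \<phi> (\<gamma> t)) u \<in> fib (\<phi> (\<gamma> 1))"
proof -
  have fam: "path_family Q B (\<lambda>\<gamma> t. \<phi> (\<gamma> t))" by (rule path_family_compose[OF Q \<phi>])
  have u': "u \<in> fib (\<phi> (\<gamma> 0))" if "\<gamma> \<in> topspace Q" for \<gamma>
    using that u by (simp add: base based_paths_def)
  show "\<And>\<gamma>. \<gamma> \<in> topspace Q \<Longrightarrow> lift_end (\<lambda>t. \<phi> (\<gamma> t)) u \<in> fib (\<phi> (\<gamma> 1))"
    using lift_end_in_fib[OF path_family_path[OF fam]] u' by simp
  have "u \<in> L" if "\<gamma> \<in> topspace Q" for \<gamma>
    using fib_in[OF path_family_in_topspace[OF fam that, of 0]] u'[OF that] by simp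
  then have "continuous_map Q mtopology (\<lambda>\<gamma>. u)" using continuous_map_const[of Q mtopology u]
    by (metis all_not_in_conv null_topspace_iff_trivial topspace_mtopology)
  then show "continuous_map Q mtopology (\<lambda>\<gamma>. lift_end (\<lambda>t. \<phi> (\<gamma> t)) u)"
    using continuous_map_lift_end[OF fam] u' by simp
qed

text \<open>
  \<open>\<Gamma>\<close> is a contraction of the covering, projected to \<open>B\<close>: a continuous choice, for each point of the
  covering, of a path from the base point to its image.
\<close>

theorem analog_sections_iff_weights:
  assumes kB: "\<And>U. openin B U \<Longrightarrow> k_space (subtopology B U)" and b0: "b0 \<in> topspace B"
    and \<Gamma>: "path_family (total B id) B \<Gamma>"
    and ends: "\<And>b u. b \<in> topspace B \<Longrightarrow> u \<in> fib b \<Longrightarrow> \<Gamma> (b, u) 0 = b0 \<and> \<Gamma> (b, u) 1 = b"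
  shows "(\<exists>s. continuous_map B (analog_fiber_measures n (based_path_space B b0) B (\<lambda>\<gamma>. \<gamma> 1)) s \<and>
      (\<forall>b\<in>topspace B. fiber_projection (\<lambda>\<gamma>. \<gamma> 1) (s b) = b)) \<longleftrightarrow> (\<exists>T. weights n B id T)"
proof
  assume "\<exists>s. continuous_map B (analog_fiber_measures n (based_path_space B b0) B (\<lambda>\<gamma>. \<gamma> 1)) s \<and>
      (\<forall>b\<in>topspace B. fiber_projection (\<lambda>\<gamma>. \<gamma> 1) (s b) = b)"
  then obtain s where s: "continuous_map B (analog_fiber_measures n (based_path_space B b0) B (\<lambda>\<gamma>. \<gamma> 1)) s"
    and proj: "\<And>b. b \<in> topspace B \<Longrightarrow> fiber_projection (\<lambda>\<gamma>. \<gamma> 1) (s b) = b" by blast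
  obtain u where u: "u \<in> fib (id b0)" using fib_nonempty[OF b0] by auto
  note lift = continuous_map_lift_end_path[OF path_family_based_path_space topspace_based_path_space
      continuous_map_id u]
  note sD = continuous_map_analog_fiber_measuresD[OF s]
  show "\<exists>T. weights n B id T"
  proof (rule weights_of_measures[where s = s, OF continuous_map_id lift(1)])
    show "finite (set_pmf (s b)) \<and> card (set_pmf (s b)) \<le> n" if "b \<in> topspace B" for b
      using sD(2)[OF that] by (auto simp: fiber_measures_upto_def measures_upto_def finite_measures_def)
    show "\<gamma> \<in> topspace (based_path_space B b0) \<and> lift_end (\<lambda>t. id (\<gamma> t)) u \<in> fib (id b)"
      if b: "b \<in> topspace B" and \<gamma>: "\<gamma> \<in> set_pmf (s b)" for b \<gamma>
    proof -
      have "\<gamma> \<in> topspace (based_path_space B b0)"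
        using sD(2)[OF b] \<gamma> by (auto simp: fiber_measures_upto_def measures_upto_def finite_measures_def)
      moreover have "\<gamma> 1 = b" using fiber_projectionD[OF sD(2)[OF b] proj[OF b] \<gamma>] .
      ultimately show ?thesis using lift(2)[of \<gamma>] by simp
    qed
    show "openin B {b \<in> topspace B. c < measure_pmf.prob (s b) W}" if "openin (based_path_space B b0) W" for W c
    proof -
      have "s b \<in> finite_measures (topspace (based_path_space B b0))" if "b \<in> topspace B" for b
        using sD(2)[OF that] by (auto simp: fiber_measures_upto_def measures_upto_def)
      then have "{b \<in> topspace B. c < measure_pmf.prob (s b) W} = {b \<in> topspace B. s b \<in>
          {p \<in> finite_measures (topspace (based_path_space B b0)). c < measure_pmf.prob p W}}" by auto
      then show ?thesis
        using openin_continuous_map_preimage[OF sD(1) openin_analog_measures_prob[OF that]] by simp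
    qed
  qed
next
  assume "\<exists>T. weights n B id T"
  then obtain T where T: "weights n B id T" by blast
  let ?s = "path_measure id T \<Gamma>"
  have kB': "k_space B" using kB[OF openin_topspace] by simp
  have fib: "?s b \<in> fiber_measures_upto n (based_paths B b0) (topspace B) (\<lambda>\<gamma>. \<gamma> 1)"
    and proj: "fiber_projection (\<lambda>\<gamma>. \<gamma> 1) (?s b) = b" if "b \<in> topspace B" for b
    using path_measure_fiber[where \<psi> = id, OF continuous_map_id T \<Gamma> _ that] ends by auto
  have "continuous_map B (analog_measures (based_path_space B b0)) ?s"
    by (rule continuous_map_analog_path_measure[OF kB continuous_map_id T \<Gamma>]) (use ends in auto)
  then have "continuous_map B (analog_fiber_measures n (based_path_space B b0) B (\<lambda>\<gamma>. \<gamma> 1)) ?s"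
    using fib by (intro continuous_map_analog_fiber_measuresI kB') (auto simp: topspace_based_path_space)
  then show "\<exists>s. continuous_map B (analog_fiber_measures n (based_path_space B b0) B (\<lambda>\<gamma>. \<gamma> 1)) s \<and>
      (\<forall>b\<in>topspace B. fiber_projection (\<lambda>\<gamma>. \<gamma> 1) (s b) = b)"
    using proj by blast
qed

text \<open>
  The same argument over a metric space \<open>X\<close>, with the covering pulled back along \<open>f\<close>.
\<close>

theorem distributional_sections_iff_weights:
  fixes M :: "'m set"
  assumes M: "Metric_space M dM" and x0: "x0 \<in> M"
  defines "X \<equiv> Metric_space.mtopology M dM"
  assumes f: "continuous_map X B f"
    and \<Gamma>: "path_family (total X f) X \<Gamma>"
    and ends: "\<And>x u. x \<in> M \<Longrightarrow> u \<in> fib (f x) \<Longrightarrow> \<Gamma> (x, u) 0 = x0 \<and> \<Gamma> (x, u) 1 = x"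
  shows "(\<exists>s. continuous_map X (distributional_fiber_measures n (based_paths X x0) (path_dist dM) X (\<lambda>\<gamma>. \<gamma> 1)) s \<and>
      (\<forall>x\<in>topspace X. fiber_projection (\<lambda>\<gamma>. \<gamma> 1) (s x) = x)) \<longleftrightarrow> (\<exists>T. weights n X f T)"
proof -
  interpret M: Metric_space M dM by (rule M)
  have X: "X = M.mtopology" by (simp add: X_def)
  have topX: "topspace X = M" by (simp add: X)
  interpret Q: Metric_space "based_paths X x0" "path_dist dM"
    unfolding X by (rule Metric_space_path_dist) (rule M)
  let ?F = "fiber_measures_upto n (based_paths X x0) (topspace X) (\<lambda>\<gamma>. \<gamma> 1)"
  have DF: "continuous_map X (distributional_fiber_measures n (based_paths X x0) (path_dist dM) X (\<lambda>\<gamma>. \<gamma> 1)) s \<longleftrightarrow>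
      continuous_map X (distributional_measures_upto n (based_paths X x0) (path_dist dM)) s \<and> s \<in> topspace X \<rightarrow> ?F" for s
    by (auto simp: distributional_fiber_measures_def continuous_map_in_subtopology)
  show ?thesis
  proof
    assume "\<exists>s. continuous_map X (distributional_fiber_measures n (based_paths X x0) (path_dist dM) X (\<lambda>\<gamma>. \<gamma> 1)) s \<and>
      (\<forall>x\<in>topspace X. fiber_projection (\<lambda>\<gamma>. \<gamma> 1) (s x) = x)"
    then obtain s where s: "continuous_map X (distributional_measures_upto n (based_paths X x0) (path_dist dM)) s"
      and fib: "\<And>x. x \<in> topspace X \<Longrightarrow> s x \<in> ?F"
      and proj: "\<And>x. x \<in> topspace X \<Longrightarrow> fiber_projection (\<lambda>\<gamma>. \<gamma> 1) (s x) = x" unfolding DF by blast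
    have "f x0 \<in> topspace B" using f x0 topX by (auto simp: continuous_map_def)
    then obtain u where u: "u \<in> fib (f x0)" using fib_nonempty by blast
    have fam: "path_family Q.mtopology X (\<lambda>\<gamma>. \<gamma>)"
      using M.path_family_metric_path_space[of x0] by (simp add: X)
    note lift = continuous_map_lift_end_path[OF fam Q.topspace_mtopology f u]
    show "\<exists>T. weights n X f T"
    proof (rule weights_of_measures[where s = s, OF f lift(1)])
      show "finite (set_pmf (s x)) \<and> card (set_pmf (s x)) \<le> n" if "x \<in> topspace X" for x
        using fib[OF that] by (auto simp: fiber_measures_upto_def measures_upto_def finite_measures_def)
      show "\<gamma> \<in> topspace Q.mtopology \<and> lift_end (\<lambda>t. f (\<gamma> t)) u \<in> fib (f x)"
        if x: "x \<in> topspace X" and \<gamma>: "\<gamma> \<in> set_pmf (s x)" for x \<gamma>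
      proof -
        have "\<gamma> \<in> topspace Q.mtopology"
          using fib[OF x] \<gamma> by (auto simp: fiber_measures_upto_def measures_upto_def finite_measures_def)
        moreover have "\<gamma> 1 = x" using fiber_projectionD[OF fib[OF x] proj[OF x] \<gamma>] .
        ultimately show ?thesis using lift(2)[of \<gamma>] by simp
      qed
      show "openin X {x \<in> topspace X. c < measure_pmf.prob (s x) W}" if "openin Q.mtopology W" for W c
      proof -
        have "s x \<in> measures_upto n (based_paths X x0)" if "x \<in> topspace X" for x
          using fib[OF that] by (auto simp: fiber_measures_upto_def)
        then have "{x \<in> topspace X. c < measure_pmf.prob (s x) W} = {x \<in> topspace X. s x \<in>
            {p \<in> measures_upto n (based_paths X x0). c < measure_pmf.prob p W}}" by auto
        then show ?thesis
          using openin_continuous_map_preimage[OF s Q.openin_levy_prokhorov_prob[OF that]] by simp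
      qed
    qed
  next
    assume "\<exists>T. weights n X f T"
    then obtain T where T: "weights n X f T" by blast
    let ?s = "path_measure f T \<Gamma>"
    have fib: "?s x \<in> ?F" and proj: "fiber_projection (\<lambda>\<gamma>. \<gamma> 1) (?s x) = x" if "x \<in> topspace X" for x
      using path_measure_fiber[where \<psi> = id, OF f T \<Gamma> _ that] ends topX by auto
    have "continuous_map X (distributional_measures_upto n (based_paths X x0) (path_dist dM)) ?s"
      using continuous_map_distributional_path_measure[OF M, folded X_def, OF f T \<Gamma>, of x0]
        ends topX fib by (auto simp: fiber_measures_upto_def)
    then show "\<exists>s. continuous_map X (distributional_fiber_measures n (based_paths X x0) (path_dist dM) X (\<lambda>\<gamma>. \<gamma> 1)) s \<and>
      (\<forall>x\<in>topspace X. fiber_projection (\<lambda>\<gamma>. \<gamma> 1) (s x) = x)"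
      unfolding DF using fib proj by blast
  qed
qed

end

section \<open>Step functions\<close>

definition step_index :: "(nat \<Rightarrow> real) \<Rightarrow> real \<Rightarrow> nat"
  where "step_index t x = (LEAST i. x < sum t {..i})"

definition step_fun :: "(nat \<Rightarrow> 'a) \<Rightarrow> (nat \<Rightarrow> real) \<Rightarrow> real \<Rightarrow> 'a"
  where "step_fun a t = (\<lambda>x\<in>{0..<1}. a (step_index t x))"

definition step_functions :: "'a set \<Rightarrow> (real \<Rightarrow> 'a) set"
  where "step_functions A = {step_fun a t | n a t. a \<in> {..n} \<rightarrow> A \<and> t \<in> standard_simplex n}"

definition disagreement :: "(real \<Rightarrow> 'a) \<Rightarrow> (real \<Rightarrow> 'a) \<Rightarrow> real"
  where "disagreement u v = measure lborel {x \<in> {0..<1}. u x \<noteq> v x}"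

lemma step_index:
  assumes "t \<in> standard_simplex n" "x < 1"
  shows "x < sum t {..step_index t x}" and "step_index t x \<le> n"
proof -
  have n: "x < sum t {..n}" using assms by (simp add: standard_simplex_def)
  then show "x < sum t {..step_index t x}" unfolding step_index_def by (rule LeastI)
  show "step_index t x \<le> n" unfolding step_index_def using n by (rule Least_le)
qed

lemma step_index_less: "i < step_index t x \<Longrightarrow> sum t {..i} \<le> x"
  unfolding step_index_def using not_less_Least by fastforce

lemma step_index_eqI:
  assumes "x < sum t {..i}" "\<And>j. j < i \<Longrightarrow> sum t {..j} \<le> x"
  shows "step_index t x = i"
  unfolding step_index_def using assms by (intro Least_equality) (auto simp: not_less[symmetric])

lemma step_fun_in: 
  "\<lbrakk>a \<in> {..n} \<rightarrow> A; t \<in> standard_simplex n\<rbrakk> \<Longrightarrow> step_fun a t \<in> step_functions A"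
  unfolding step_functions_def by blast

lemma step_functionsE:
  assumes "u \<in> step_functions A"
  obtains n a t where "a \<in> {..n} \<rightarrow> A" "t \<in> standard_simplex n" "u = step_fun a t"
  using assms unfolding step_functions_def by blast

lemma step_fun_cong:
  assumes "t \<in> standard_simplex n" "\<And>i. i \<le> n \<Longrightarrow> a i = b i"
  shows "step_fun a t = step_fun b t"
  unfolding step_fun_def using step_index(2)[OF assms(1)] assms(2) by (intro restrict_ext) auto

lemma disagreement_set_fmeasurable:
  assumes "u \<in> step_functions A" "v \<in> step_functions A"
  shows "{x \<in> {0..<1}. u x \<noteq> v x} \<in> fmeasurable lborel"
proof -
  obtain a t where u: "u = step_fun a t" using assms(1) by (rule step_functionsE)
  obtain b s where v: "v = step_fun b s" using assms(2) by (rule step_functionsE)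
  have meas: "{x. step_index t x = i} \<in> sets borel" for t :: "nat \<Rightarrow> real" and i
  proof -
    have [measurable]: "step_index t \<in> borel \<rightarrow>\<^sub>M count_space UNIV"
      unfolding step_index_def by measurable
    have "{x \<in> space borel. step_index t x = i} \<in> sets borel" by measurable
    then show ?thesis by simp
  qed
  let ?U = "\<Union>z\<in>{z. a (fst z) \<noteq> b (snd z)}. {x. step_index t x = fst z} \<inter> {x. step_index s x = snd z}"
  have "?U \<in> sets borel"
    by (rule sets.countable_UN''[OF countableI_type sets.Int[OF meas meas]])
  moreover have "{0..<1::real} \<in> sets borel" by simp
  ultimately have "{0..<1} \<inter> ?U \<in> sets lborel" unfolding sets_lborel by (intro sets.Int)
  moreover have "{x \<in> {0..<1}. u x \<noteq> v x} = {0..<1} \<inter> ?U"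
  proof (intro subset_antisym subsetI)
    fix x assume "x \<in> {x \<in> {0..<1}. u x \<noteq> v x}"
    then show "x \<in> {0..<1} \<inter> ?U"
      by (intro IntI UN_I[of "(step_index t x, step_index s x)"]) (auto simp: u v step_fun_def)
  next
    fix x assume "x \<in> {0..<1} \<inter> ?U"
    then show "x \<in> {x \<in> {0..<1}. u x \<noteq> v x}" by (auto simp: u v step_fun_def)
  qed
  ultimately have "{x \<in> {0..<1}. u x \<noteq> v x} \<in> sets lborel" by simp
  moreover have "{0..<1::real} \<in> fmeasurable lborel" by (rule fmeasurableI) simp_all
  ultimately show ?thesis by (rule fmeasurableI2[rotated 2]) blast
qed

text \<open>
  Step functions are constant on a short interval to the right of each point, so they disagree on an
  interval if they disagree at a point.
\<close>

lemma disagreement_eq_0D: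
  assumes u: "u \<in> step_functions A" and v: "v \<in> step_functions A" and 0: "disagreement u v = 0"
  shows "u = v"
proof (rule ccontr)
  assume "u \<noteq> v"
  obtain a t n where ut: "u = step_fun a t" "t \<in> standard_simplex n" using u by (rule step_functionsE)
  obtain b s m where vs: "v = step_fun b s" "s \<in> standard_simplex m" using v by (rule step_functionsE)
  obtain x where x: "u x \<noteq> v x" using \<open>u \<noteq> v\<close> by blast
  then have x01: "0 \<le> x" "x < 1" by (auto simp: ut vs step_fun_def split: if_splits)
  define y where "y = min 1 (min (sum t {..step_index t x}) (sum s {..step_index s x}))"
  have y: "x < y" using step_index(1)[OF ut(2) x01(2)] step_index(1)[OF vs(2) x01(2)] x01 by (simp add: y_def)
  have const: "step_index r z = step_index r x" if "x \<le> z" "z < sum r {..step_index r x}" for r z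
    using that step_index_less[of _ r x] by (intro step_index_eqI) (auto intro: order_trans)
  have "{x..<y} \<subseteq> {x \<in> {0..<1}. u x \<noteq> v x}"
  proof
    fix z assume z: "z \<in> {x..<y}"
    then have "u z = u x" "v z = v x"
      using const[of z t] const[of z s] x01 by (auto simp: y_def ut vs step_fun_def)
    then show "z \<in> {x \<in> {0..<1}. u x \<noteq> v x}" using x z x01 by (auto simp: y_def)
  qed
  then have "measure lborel {x..<y} \<le> disagreement u v"
    unfolding disagreement_def using disagreement_set_fmeasurable[OF u v]
    by (intro measure_mono_fmeasurable) auto
  then show False using y 0 by simp
qed

lemma Metric_space_step_functions: "Metric_space (step_functions A) disagreement"
proof
  show "0 \<le> disagreement u v" for u v :: "real \<Rightarrow> 'a" by (simp add: disagreement_def)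
  show "disagreement u v = disagreement v u" for u v :: "real \<Rightarrow> 'a"
    unfolding disagreement_def by (rule arg_cong[of _ _ "measure lborel"]) auto
  show "disagreement u v = 0 \<longleftrightarrow> u = v" if "u \<in> step_functions A" "v \<in> step_functions A" for u v
    using disagreement_eq_0D[OF that] by (auto simp: disagreement_def)
  show "disagreement u w \<le> disagreement u v + disagreement v w"
    if "u \<in> step_functions A" "v \<in> step_functions A" "w \<in> step_functions A" for u v w
  proof -
    let ?D = "\<lambda>u v. {x \<in> {0..<1::real}. u x \<noteq> v x}"
    note f = disagreement_set_fmeasurable
    have "disagreement u w \<le> measure lborel (?D u v \<union> ?D v w)"
      unfolding disagreement_def using f[OF that(1,3)] f[OF that(1,2)] f[OF that(2,3)]
      by (intro measure_mono_fmeasurable) (auto intro: fmeasurable.Un)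
    also have "\<dots> \<le> disagreement u v + disagreement v w"
      unfolding disagreement_def using f[OF that(1,2)] f[OF that(2,3)]
      by (intro measure_Un_le) auto
    finally show ?thesis .
  qed
qed

text \<open>
  At a point of disagreement, one of the jumps of \<open>step_fun a t\<close> lies to the left and the corresponding
  jump of \<open>step_fun a s\<close> to the right, or the other way round.
\<close>

lemma disagreement_step_fun_le:
  assumes t: "t \<in> standard_simplex n" "s \<in> standard_simplex n" and a: "a \<in> {..n} \<rightarrow> A"
  shows "disagreement (step_fun a t) (step_fun a s) \<le> (\<Sum>i\<le>n. \<bar>sum t {..i} - sum s {..i}\<bar>)"
proof -
  let ?J = "\<lambda>i. {min (sum t {..i}) (sum s {..i})..<max (sum t {..i}) (sum s {..i})}"
  have "{x \<in> {0..<1}. step_fun a t x \<noteq> step_fun a s x} \<subseteq> (\<Union>i\<in>{..n}. ?J i)"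
  proof
    fix x assume x: "x \<in> {x \<in> {0..<1}. step_fun a t x \<noteq> step_fun a s x}"
    then have x1: "x < 1" and ne: "step_index t x \<noteq> step_index s x" by (auto simp: step_fun_def)
    show "x \<in> (\<Union>i\<in>{..n}. ?J i)"
    proof (cases "step_index t x < step_index s x")
      case True
      then show ?thesis using step_index[OF t(1) x1] step_index_less[OF True]
        by (intro UN_I[of "step_index t x"]) auto
    next
      case False
      then have lt: "step_index s x < step_index t x" using ne by simp
      show ?thesis using step_index[OF t(2) x1] step_index_less[OF lt]
        by (intro UN_I[of "step_index s x"]) auto
    qed
  qed
  then have "disagreement (step_fun a t) (step_fun a s) \<le> measure lborel (\<Union>i\<in>{..n}. ?J i)"
    unfolding disagreement_def
    using disagreement_set_fmeasurable[OF step_fun_in[OF a t(1)] step_fun_in[OF a t(2)]]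
    by (intro measure_mono_fmeasurable fmeasurable.finite_UN) (auto simp: fmeasurable_def)
  also have "\<dots> \<le> (\<Sum>i\<le>n. measure lborel (?J i))" by (intro measure_UNION_le) auto
  also have "\<dots> = (\<Sum>i\<le>n. \<bar>sum t {..i} - sum s {..i}\<bar>)"
    by (intro sum.cong refl) (auto simp: max_def min_def)
  finally show ?thesis .
qed

lemma continuous_map_simplex_coordinate: "continuous_map (simplex_topology n) euclideanreal (\<lambda>t. t i)"
  by (intro continuous_map_from_subtopology continuous_map_product_projection) simp

lemma continuous_map_step_fun:
  assumes a: "a \<in> {..n} \<rightarrow> A"
  shows "continuous_map (simplex_topology n) (Metric_space.mtopology (step_functions A) disagreement) (step_fun a)"
proof -
  interpret Metric_space "step_functions A" disagreement by (rule Metric_space_step_functions)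
  show ?thesis
    unfolding continuous_map_to_metric
  proof (intro ballI allI impI)
    fix t and e :: real assume t: "t \<in> topspace (simplex_topology n)" and e: "0 < e"
    let ?D = "\<lambda>s. \<Sum>i\<le>n. \<bar>sum t {..i} - sum s {..i}\<bar>"
    have "continuous_map (simplex_topology n) euclideanreal ?D"
      by (intro continuous_map_sum continuous_map_real_abs continuous_map_diff
        continuous_map_simplex_coordinate) auto
    then have "openin (simplex_topology n) {s \<in> topspace (simplex_topology n). ?D s \<in> {..<e}}"
      by (rule openin_continuous_map_preimage) auto
    moreover have "step_fun a s \<in> mball (step_fun a t) e"
      if "s \<in> {s \<in> topspace (simplex_topology n). ?D s \<in> {..<e}}" for s
      using that t disagreement_step_fun_le[of t n s, OF _ _ a] step_fun_in[OF a] by auto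
    moreover have "t \<in> {s \<in> topspace (simplex_topology n). ?D s \<in> {..<e}}" using t e by simp
    ultimately show "\<exists>U. openin (simplex_topology n) U \<and> t \<in> U \<and> (\<forall>s\<in>U. step_fun a s \<in> mball (step_fun a t) e)"
      by blast
  qed
qed

lemma disagreement_eq_1:
  assumes t: "t \<in> standard_simplex n" and ab: "\<And>i. i \<le> n \<Longrightarrow> a i \<noteq> b i"
  shows "disagreement (step_fun a t) (step_fun b t) = 1"
proof -
  have "{x \<in> {0..<1}. step_fun a t x \<noteq> step_fun b t x} = {0..<1}"
    using ab step_index(2)[OF t] by (auto simp: step_fun_def)
  then show ?thesis by (simp add: disagreement_def)
qed

section \<open>Pushing points of simplices along monotone maps\<close>

lemma sum_simplex_push:
  "sum (simplex_push m \<theta> t) {..j} = sum t {i. i \<le> m \<and> \<theta> i \<le> j}"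
proof -
  have "sum (simplex_push m \<theta> t) {..j} = (\<Sum>k\<le>j. sum t {i. i \<in> {i. i \<le> m \<and> \<theta> i \<le> j} \<and> \<theta> i = k})"
    unfolding simplex_push_def by (intro sum.cong refl) (auto intro!: arg_cong[of _ _ "sum t"])
  also have "\<dots> = sum t {i. i \<le> m \<and> \<theta> i \<le> j}" by (rule sum.group) auto
  finally show ?thesis .
qed

text \<open>
  Gluing does not change the step function: \<open>\<theta>\<close> merges consecutive steps with the same value and
  introduces steps of length 0.
\<close>

lemma step_fun_simplex_push:
  assumes \<theta>: "\<theta> \<in> {..m} \<rightarrow> {..n}" "mono_on {..m} \<theta>" and t: "t \<in> standard_simplex m"
  shows "step_fun a (simplex_push m \<theta> t) = step_fun (\<lambda>i. a (\<theta> i)) t"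
  unfolding step_fun_def
proof (rule restrict_ext)
  fix x :: real assume x: "x \<in> {0..<1}"
  define i where "i = step_index t x"
  have tpos: "0 \<le> t k" for k using t by (simp add: standard_simplex_def)
  have i: "x < sum t {..i}" "i \<le> m" using step_index[OF t, of x] x by (auto simp: i_def)
  have "step_index (simplex_push m \<theta> t) x = \<theta> i"
  proof (rule step_index_eqI)
    have "sum t {..i} \<le> sum t {k. k \<le> m \<and> \<theta> k \<le> \<theta> i}"
      using i \<theta>(2) tpos by (intro sum_mono2) (auto simp: mono_on_def)
    then show "x < sum (simplex_push m \<theta> t) {..\<theta> i}" using i by (simp add: sum_simplex_push)
    fix j assume j: "j < \<theta> i"
    show "sum (simplex_push m \<theta> t) {..j} \<le> x"
    proof (cases i)
      case 0
      then have "{k. k \<le> m \<and> \<theta> k \<le> j} = {}"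
        using \<theta>(2) j by (force simp: mono_on_def)
      then have "sum t {k. k \<le> m \<and> \<theta> k \<le> j} = 0" by (simp only: sum.empty)
      then show ?thesis unfolding sum_simplex_push using x by simp
    next
      case (Suc i')
      have "k \<le> i'" if "k \<le> m" "\<theta> k \<le> j" for k
      proof (rule ccontr)
        assume "\<not> k \<le> i'"
        then have "\<theta> i \<le> \<theta> k" using \<theta>(2) that i Suc by (auto simp: mono_on_def)
        then show False using that j by simp
      qed
      then have "sum t {k. k \<le> m \<and> \<theta> k \<le> j} \<le> sum t {..i'}"
        using tpos by (intro sum_mono2) auto
      also have "\<dots> \<le> x" using step_index_less[of i' t x] Suc i_def by simp
      finally show ?thesis by (simp add: sum_simplex_push)
    qed
  qed
  then show "a (step_index (simplex_push m \<theta> t) x) = a (\<theta> (step_index t x))" by (simp add: i_def)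
qed

text \<open>
  The point of the simplex with additional first vertex that divides the segment from this vertex to \<open>t\<close>
  in the ratio \<open>s : 1 - s\<close>.
\<close>

definition cone_point :: "real \<Rightarrow> (nat \<Rightarrow> real) \<Rightarrow> nat \<Rightarrow> real"
  where "cone_point s t = case_nat (1 - s) (\<lambda>i. s * t i)"

lemma cone_point_in:
  assumes t: "t \<in> standard_simplex n" and s: "s \<in> {0..1}"
  shows "cone_point s t \<in> standard_simplex (Suc n)"
proof -
  have "sum (cone_point s t) {..Suc n} = (1 - s) + s * sum t {..n}"
    by (simp add: sum.atMost_Suc_shift cone_point_def sum_distrib_left del: sum.atMost_Suc)
  moreover have "0 \<le> cone_point s t i \<and> cone_point s t i \<le> 1" for i
    using t s by (cases i) (auto simp: cone_point_def standard_simplex_def intro: mult_le_one)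
  moreover have "cone_point s t i = 0" if "Suc n < i" for i
    using t that by (cases i) (auto simp: cone_point_def standard_simplex_def)
  ultimately show ?thesis using t by (simp add: standard_simplex_def)
qed

lemma simplex_push_cone:
  "simplex_push (Suc m) (case_nat 0 (\<lambda>i. Suc (\<theta> i))) (cone_point s t) = cone_point s (simplex_push m \<theta> t)"
proof
  fix j
  show "simplex_push (Suc m) (case_nat 0 (\<lambda>i. Suc (\<theta> i))) (cone_point s t) j = cone_point s (simplex_push m \<theta> t) j"
  proof (cases j)
    case 0
    have "{i. i \<le> Suc m \<and> case_nat 0 (\<lambda>i. Suc (\<theta> i)) i = 0} = {0}"
    proof (intro subset_antisym subsetI)
      fix i assume "i \<in> {i. i \<le> Suc m \<and> case_nat 0 (\<lambda>i. Suc (\<theta> i)) i = 0}"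
      then show "i \<in> {0}" by (cases i) auto
    qed auto
    then show ?thesis by (simp add: 0 simplex_push_def cone_point_def)
  next
    case (Suc k)
    have "{i. i \<le> Suc m \<and> case_nat 0 (\<lambda>i. Suc (\<theta> i)) i = Suc k} = Suc ` {i. i \<le> m \<and> \<theta> i = k}"
    proof (intro subset_antisym subsetI)
      fix i assume "i \<in> {i. i \<le> Suc m \<and> case_nat 0 (\<lambda>i. Suc (\<theta> i)) i = Suc k}"
      then show "i \<in> Suc ` {i. i \<le> m \<and> \<theta> i = k}" by (cases i) auto
    qed auto
    then show ?thesis by (simp add: Suc simplex_push_def cone_point_def sum.reindex sum_distrib_left)
  qed
qed

lemma continuous_map_cone_point:
  "continuous_map (prod_topology (simplex_topology n) unit_interval) (simplex_topology (Suc n)) (\<lambda>(t, s). cone_point s t)"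
proof -
  have 1: "continuous_map (prod_topology (simplex_topology n) unit_interval) euclideanreal (\<lambda>z. fst z i)" for i
    using continuous_map_compose[OF continuous_map_fst continuous_map_simplex_coordinate] by (simp add: o_def)
  have 2: "continuous_map (prod_topology (simplex_topology n) unit_interval) euclideanreal snd"
    using continuous_map_snd continuous_map_in_subtopology by blast
  have "continuous_map (prod_topology (simplex_topology n) unit_interval) euclideanreal (\<lambda>z. cone_point (snd z) (fst z) i)" for i
    by (cases i) (auto simp: cone_point_def intro!: continuous_map_diff continuous_map_real_mult 1 2)
  then show ?thesis
    by (auto simp: continuous_map_in_subtopology continuous_map_componentwise_UNIV case_prod_unfold cone_point_in)
qed

section \<open>The covering of the classifying space\<close>

lemma k_space_openI:
  assumes "\<And>S. openin (kification X) S \<Longrightarrow> openin X S"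
  shows "k_space X"
proof -
  have "openin (kification X) S \<longleftrightarrow> openin X S" for S using assms openin_kification_finer by blast
  then have "kification X = X" by (simp add: topology_eq)
  then show ?thesis by (simp add: kification_eq_self)
qed

lemma k_space_simplex_open:
  assumes "openin (simplex_topology n) V"
  shows "k_space (subtopology (simplex_topology n) V)"
proof -
  have H: "Hausdorff_space (simplex_topology n)"
    by (intro Hausdorff_space_subtopology) (simp add: Hausdorff_space_product_topology)
  have "compact_space (simplex_topology n)"
    by (simp add: compact_space_subtopology compactin_standard_simplex)
  then have "locally_compact_space (simplex_topology n)" by (rule compact_imp_locally_compact_space)
  then show ?thesis
    by (rule locally_compact_imp_k_space[OF locally_compact_space_open_subset[OF disjI1[OF H] _ assms]])
qed

text \<open>
  The simplex of the nerve obtained from the simplex of \<open>EG\<close> with vertices \<open>a 0, \<dots>, a n\<close>.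
\<close>

definition edges :: "('g, 'b) monoid_scheme \<Rightarrow> nat \<Rightarrow> (nat \<Rightarrow> 'g) \<Rightarrow> nat \<times> nat \<Rightarrow> 'g"
  where "edges G n a = (\<lambda>(i, j) \<in> {(i, j). i \<le> j \<and> j \<le> n}. inv\<^bsub>G\<^esub> a i \<otimes>\<^bsub>G\<^esub> a j)"

locale finite_group = group G for G (structure) +
  assumes finite_carrier: "finite (carrier G)"
begin

abbreviation BG where "BG \<equiv> classifying_space G"

definition bg_point where "bg_point n \<sigma> t = realization_class (nerve G) nerve_act (n, \<sigma>, t)"

lemma l_cancel_inv: "\<lbrakk>y \<in> carrier G; z \<in> carrier G\<rbrakk> \<Longrightarrow> inv y \<otimes> (y \<otimes> z) = z"
  and r_cancel_inv: "\<lbrakk>y \<in> carrier G; z \<in> carrier G\<rbrakk> \<Longrightarrow> y \<otimes> (inv y \<otimes> z) = z"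
  by (simp_all add: m_assoc[symmetric])

lemma edges_in_nerve:
  assumes "a \<in> {..n} \<rightarrow> carrier G"
  shows "edges G n a \<in> nerve G n"
proof -
  have c: "a i \<in> carrier G" if "i \<le> n" for i using assms that by auto
  have "(inv a i \<otimes> a j) \<otimes> (inv a j \<otimes> a k) = inv a i \<otimes> a k" if "i \<le> n" "j \<le> n" "k \<le> n" for i j k
    using c that by (simp add: m_assoc r_cancel_inv)
  then show ?thesis using c by (auto simp: nerve_def edges_def)
qed

lemma vertices_in: "\<lbrakk>\<sigma> \<in> nerve G n; g \<in> carrier G\<rbrakk> \<Longrightarrow> (\<lambda>i. g \<otimes> \<sigma> (0, i)) \<in> {..n} \<rightarrow> carrier G"
  by (auto simp: nerve_def PiE_iff)

lemma edges_vertices: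
  assumes \<sigma>: "\<sigma> \<in> nerve G n" and g: "g \<in> carrier G"
  shows "edges G n (\<lambda>i. g \<otimes> \<sigma> (0, i)) = \<sigma>"
proof (rule extensionalityI[of _ "{(i, j). i \<le> j \<and> j \<le> n}"])
  fix z assume "z \<in> {(i, j). i \<le> j \<and> j \<le> n}"
  then obtain i j where z: "z = (i, j)" "i \<le> j" "j \<le> n" by auto
  have c: "\<sigma> (0, i) \<in> carrier G" "\<sigma> (i, j) \<in> carrier G" using \<sigma> z by (auto simp: nerve_def PiE_iff)
  have "\<sigma> (0, j) = \<sigma> (0, i) \<otimes> \<sigma> (i, j)" using \<sigma> z by (simp add: nerve_def)
  then have "inv (g \<otimes> \<sigma> (0, i)) \<otimes> (g \<otimes> \<sigma> (0, j)) = inv (g \<otimes> \<sigma> (0, i)) \<otimes> ((g \<otimes> \<sigma> (0, i)) \<otimes> \<sigma> (i, j))"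
    using c g by (simp add: m_assoc)
  also have "\<dots> = \<sigma> (i, j)" using c g by (intro l_cancel_inv) auto
  finally show "edges G n (\<lambda>i. g \<otimes> \<sigma> (0, i)) z = \<sigma> z" using z by (simp add: edges_def)
qed (use \<sigma> in \<open>auto simp: edges_def nerve_def PiE_iff\<close>)

lemma nerve_act_edges:
  assumes "\<theta> \<in> {..m} \<rightarrow> {..n}" "mono_on {..m} \<theta>"
  shows "nerve_act m \<theta> (edges G n a) = edges G m (\<lambda>i. a (\<theta> i))"
proof -
  have "\<theta> i \<le> \<theta> j \<and> \<theta> j \<le> n" if "i \<le> j" "j \<le> m" for i j
    using assms that by (auto simp: mono_on_def)
  then show ?thesis unfolding nerve_act_def edges_def by (intro restrict_ext) auto
qed

lemma bg_point_glue:
  assumes "\<theta> \<in> {..m} \<rightarrow> {..n}" "mono_on {..m} \<theta>" "\<sigma> \<in> nerve G n" "t \<in> standard_simplex m"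
  shows "bg_point m (nerve_act m \<theta> \<sigma>) t = bg_point n \<sigma> (simplex_push m \<theta> t)"
proof -
  let ?R = "realization_glue (nerve G) nerve_act"
  have "?R (m, nerve_act m \<theta> \<sigma>, t) (n, \<sigma>, simplex_push m \<theta> t)"
    using assms by (rule realization_glue.intros)
  then have "equivclp ?R (m, nerve_act m \<theta> \<sigma>, t) (n, \<sigma>, simplex_push m \<theta> t)" by blast
  then show ?thesis
    unfolding bg_point_def realization_class_def
    by (intro Collect_cong) (meson equivclp_sym equivclp_trans)
qed

text \<open>
  The path in \<open>BG\<close> swept out by contracting \<open>EG\<close> to the vertex \<open>\<one>\<close>: the simplex with vertices \<open>a\<close> is a face
  of its join with \<open>\<one>\<close>, and \<open>s\<close> runs along the segment from \<open>\<one>\<close> to the point \<open>t\<close> of this face.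
\<close>

definition contraction :: "nat \<Rightarrow> (nat \<Rightarrow> 'a) \<Rightarrow> (nat \<Rightarrow> real) \<Rightarrow> real \<Rightarrow> _"
  where "contraction n a t s = bg_point (Suc n) (edges G (Suc n) (case_nat \<one> a)) (cone_point s t)"

text \<open>
  A lift of a simplex \<open>\<sigma>\<close> to \<open>EG\<close> has vertices \<open>g \<otimes> \<sigma>(0, i)\<close>, where \<open>g\<close> is its first vertex. Each lift of the
  point is recorded by its step function together with its contraction path. Treating both at once
  means that the gluing relation has to be analysed only once, in \<open>lifts_glue\<close>.
\<close>

definition lifts :: "nat \<times> (nat \<times> nat \<Rightarrow> 'a) \<times> (nat \<Rightarrow> real) \<Rightarrow> _"
  where "lifts = (\<lambda>(n, \<sigma>, t). (\<lambda>g. (step_fun (\<lambda>i. g \<otimes> \<sigma> (0, i)) t,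
     \<lambda>s\<in>{0..1}. contraction n (\<lambda>i. g \<otimes> \<sigma> (0, i)) t s)) ` carrier G)"

text \<open>
  The contraction is compatible with gluing, because \<open>\<theta>\<close> extends to the joins with the additional vertex.
\<close>

lemma contraction_push:
  assumes \<theta>: "\<theta> \<in> {..m} \<rightarrow> {..n}" "mono_on {..m} \<theta>" and a: "a \<in> {..n} \<rightarrow> carrier G"
    and t: "t \<in> standard_simplex m" and s: "s \<in> {0..1}"
  shows "contraction n a (simplex_push m \<theta> t) s = contraction m (\<lambda>i. a (\<theta> i)) t s"
proof -
  let ?c = "case_nat 0 (\<lambda>i. Suc (\<theta> i))"
  have c: "?c \<in> {..Suc m} \<rightarrow> {..Suc n}" "mono_on {..Suc m} ?c"
    using \<theta> by (auto simp: mono_on_def Pi_iff split: nat.splits)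
  have "case_nat \<one> a \<in> {..Suc n} \<rightarrow> carrier G" using a by (auto split: nat.splits)
  then have "bg_point (Suc m) (nerve_act (Suc m) ?c (edges G (Suc n) (case_nat \<one> a))) (cone_point s t) =
      bg_point (Suc n) (edges G (Suc n) (case_nat \<one> a)) (simplex_push (Suc m) ?c (cone_point s t))"
    using c cone_point_in[OF t s] by (intro bg_point_glue edges_in_nerve)
  moreover have "(\<lambda>i. case_nat \<one> a (?c i)) = case_nat \<one> (\<lambda>i. a (\<theta> i))"
    by (auto split: nat.splits)
  ultimately show ?thesis
    by (simp add: contraction_def simplex_push_cone nerve_act_edges[OF c])
qed

text \<open>
  The lift of \<open>\<sigma>\<close> with first vertex \<open>g\<close> restricts along \<open>\<theta>\<close> to the lift with first vertex \<open>g \<otimes> \<sigma>(0, \<theta> 0)\<close>, and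
  right translation by \<open>\<sigma>(0, \<theta> 0)\<close> permutes \<open>G\<close>.
\<close>

lemma lifts_glue:
  assumes "realization_glue (nerve G) nerve_act x y"
  shows "lifts x = lifts y"
  using assms
proof cases
  case (1 \<theta> m n \<sigma> t)
  let ?h = "\<sigma> (0, \<theta> 0)"
  have \<theta>: "\<theta> i \<le> n" "\<theta> 0 \<le> \<theta> i" if "i \<le> m" for i using 1 that by (auto simp: mono_on_def)
  have c: "\<sigma> (0, \<theta> i) \<in> carrier G" "\<sigma> (\<theta> 0, \<theta> i) \<in> carrier G" if "i \<le> m" for i
    using 1(5) \<theta>[OF that] by (auto simp: nerve_def PiE_iff)
  have h: "?h \<in> carrier G" using c by simp
  have v: "(g \<otimes> ?h) \<otimes> nerve_act m \<theta> \<sigma> (0, i) = g \<otimes> \<sigma> (0, \<theta> i)" if "g \<in> carrier G" "i \<le> m" for g i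
  proof -
    have "\<sigma> (0, \<theta> i) = ?h \<otimes> \<sigma> (\<theta> 0, \<theta> i)"
      using 1(5) \<theta>[OF that(2)] by (simp add: nerve_def)
    then show ?thesis using that c h by (simp add: nerve_act_def m_assoc)
  qed
  have "lifts x = (\<lambda>g. (step_fun (\<lambda>i. g \<otimes> nerve_act m \<theta> \<sigma> (0, i)) t,
      \<lambda>s\<in>{0..1}. contraction m (\<lambda>i. g \<otimes> nerve_act m \<theta> \<sigma> (0, i)) t s)) ` (\<lambda>g. g \<otimes> ?h) ` carrier G"
  proof -
    have "(\<lambda>g. g \<otimes> ?h) ` carrier G = carrier G"
    proof (intro subset_antisym subsetI)
      fix g assume "g \<in> carrier G"
      then have "g = (g \<otimes> inv ?h) \<otimes> ?h" "g \<otimes> inv ?h \<in> carrier G" using h by (simp_all add: m_assoc)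
      then show "g \<in> (\<lambda>g. g \<otimes> ?h) ` carrier G" by blast
    qed (use h in auto)
    then show ?thesis by (simp only: lifts_def 1 prod.case)
  qed
  also have "\<dots> = (\<lambda>g. (step_fun (\<lambda>i. g \<otimes> \<sigma> (0, i)) (simplex_push m \<theta> t),
      \<lambda>s\<in>{0..1}. contraction n (\<lambda>i. g \<otimes> \<sigma> (0, i)) (simplex_push m \<theta> t) s)) ` carrier G"
    unfolding image_image
  proof (rule image_cong[OF refl])
    fix g assume g: "g \<in> carrier G"
    have 1: "step_fun (\<lambda>i. (g \<otimes> ?h) \<otimes> nerve_act m \<theta> \<sigma> (0, i)) t = step_fun (\<lambda>i. g \<otimes> \<sigma> (0, i)) (simplex_push m \<theta> t)"
    proof -
      have "step_fun (\<lambda>i. (g \<otimes> ?h) \<otimes> nerve_act m \<theta> \<sigma> (0, i)) t = step_fun (\<lambda>i. g \<otimes> \<sigma> (0, \<theta> i)) t"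
        by (rule step_fun_cong[OF 1(6)]) (rule v[OF g])
      then show ?thesis by (simp only: step_fun_simplex_push[OF 1(3,4,6)])
    qed
    have "edges G (Suc m) (case_nat \<one> (\<lambda>i. (g \<otimes> ?h) \<otimes> nerve_act m \<theta> \<sigma> (0, i)))
        = edges G (Suc m) (case_nat \<one> (\<lambda>i. g \<otimes> \<sigma> (0, \<theta> i)))"
      unfolding edges_def using v[OF g] by (intro restrict_ext) (auto split: nat.splits)
    then have "contraction m (\<lambda>i. (g \<otimes> ?h) \<otimes> nerve_act m \<theta> \<sigma> (0, i)) t s
        = contraction n (\<lambda>i. g \<otimes> \<sigma> (0, i)) (simplex_push m \<theta> t) s" if "s \<in> {0..1}" for s
      using contraction_push[OF \<open>\<theta> \<in> {..m} \<rightarrow> {..n}\<close> \<open>mono_on {..m} \<theta>\<close> vertices_in[OF \<open>\<sigma> \<in> nerve G n\<close> g]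
        \<open>t \<in> standard_simplex m\<close> that] by (simp add: contraction_def)
    then show "(step_fun (\<lambda>i. (g \<otimes> ?h) \<otimes> nerve_act m \<theta> \<sigma> (0, i)) t,
      \<lambda>s\<in>{0..1}. contraction m (\<lambda>i. (g \<otimes> ?h) \<otimes> nerve_act m \<theta> \<sigma> (0, i)) t s)
      = (step_fun (\<lambda>i. g \<otimes> \<sigma> (0, i)) (simplex_push m \<theta> t),
      \<lambda>s\<in>{0..1}. contraction n (\<lambda>i. g \<otimes> \<sigma> (0, i)) (simplex_push m \<theta> t) s)"
      using 1 by (auto intro: restrict_ext)
  qed
  also have "\<dots> = lifts y" by (simp add: lifts_def 1)
  finally show ?thesis .
qed

lemma lifts_bg_point:
  assumes "bg_point n \<sigma> t = bg_point m \<tau> r"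
  shows "lifts (n, \<sigma>, t) = lifts (m, \<tau>, r)"
proof -
  have "(m, \<tau>, r) \<in> bg_point n \<sigma> t" unfolding assms by (simp add: bg_point_def realization_class_def)
  then have "equivclp (realization_glue (nerve G) nerve_act) (n, \<sigma>, t) (m, \<tau>, r)"
    by (simp add: bg_point_def realization_class_def)
  then show ?thesis
    by (induction rule: equivclp_induct) (auto dest: lifts_glue)
qed

definition lifts_of where "lifts_of b = lifts (SOME x. realization_class (nerve G) nerve_act x = b)"

lemma lifts_of_bg_point: "lifts_of (bg_point n \<sigma> t) = lifts (n, \<sigma>, t)"
proof -
  define x where "x = (SOME x. realization_class (nerve G) nerve_act x = bg_point n \<sigma> t)"
  have "realization_class (nerve G) nerve_act x = bg_point n \<sigma> t"
    unfolding x_def by (rule someI) (simp add: bg_point_def)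
  then have "bg_point (fst x) (fst (snd x)) (snd (snd x)) = bg_point n \<sigma> t" by (simp add: bg_point_def)
  from lifts_bg_point[OF this] show ?thesis by (simp add: lifts_of_def x_def)
qed

definition fiber where "fiber b = fst ` lifts_of b"
definition contract where "contract b u = (SOME k. (u, k) \<in> lifts_of b)"

lemma fiber_bg_point: "fiber (bg_point n \<sigma> t) = (\<lambda>g. step_fun (\<lambda>i. g \<otimes> \<sigma> (0, i)) t) ` carrier G"
  by (simp add: fiber_def lifts_of_bg_point lifts_def image_image)

lemma disagreement_translate:
  assumes "\<sigma> \<in> nerve G n" "t \<in> standard_simplex n" "g \<in> carrier G" "h \<in> carrier G" "g \<noteq> h"
  shows "disagreement (step_fun (\<lambda>i. g \<otimes> \<sigma> (0, i)) t) (step_fun (\<lambda>i. h \<otimes> \<sigma> (0, i)) t) = 1"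
proof (rule disagreement_eq_1[OF assms(2)])
  fix i assume "i \<le> n"
  then have "\<sigma> (0, i) \<in> carrier G" using assms(1) by (auto simp: nerve_def PiE_iff)
  then show "g \<otimes> \<sigma> (0, i) \<noteq> h \<otimes> \<sigma> (0, i)" using assms by simp
qed

lemma step_fun_translate_inj:
  assumes "\<sigma> \<in> nerve G n" "t \<in> standard_simplex n"
  shows "inj_on (\<lambda>g. step_fun (\<lambda>i. g \<otimes> \<sigma> (0, i)) t) (carrier G)"
proof (rule inj_onI, rule ccontr)
  fix g h assume "g \<in> carrier G" "h \<in> carrier G" "g \<noteq> h"
    "step_fun (\<lambda>i. g \<otimes> \<sigma> (0, i)) t = step_fun (\<lambda>i. h \<otimes> \<sigma> (0, i)) t"
  then show False using disagreement_translate[OF assms, of g h] by (simp add: disagreement_def)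
qed

text \<open>
  Since \<open>G\<close> acts freely on step functions, a step function over \<open>b\<close> determines its lift, and with it the path
  recorded in \<open>lifts_of b\<close>.
\<close>

lemma contract_bg_point:
  assumes "\<sigma> \<in> nerve G n" "t \<in> standard_simplex n" "g \<in> carrier G"
  shows "contract (bg_point n \<sigma> t) (step_fun (\<lambda>i. g \<otimes> \<sigma> (0, i)) t) =
    (\<lambda>s\<in>{0..1}. contraction n (\<lambda>i. g \<otimes> \<sigma> (0, i)) t s)"
  unfolding contract_def lifts_of_bg_point lifts_def
  using assms step_fun_translate_inj[OF assms(1,2)]
  by (intro some_equality) (auto dest: inj_onD)

lemma topspace_BG: "topspace BG = {bg_point n \<sigma> t | n \<sigma> t. \<sigma> \<in> nerve G n \<and> t \<in> standard_simplex n}"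
  unfolding classifying_space_def geometric_realization_def
  by (subst topspace_final_topology) (auto simp: bg_point_def)

lemma topspace_BG_E:
  assumes "b \<in> topspace BG"
  obtains n \<sigma> t where "b = bg_point n \<sigma> t" "\<sigma> \<in> nerve G n" "t \<in> standard_simplex n"
  using assms unfolding topspace_BG by blast

lemma continuous_map_bg_point:
  assumes \<sigma>: "\<sigma> \<in> nerve G n"
  shows "continuous_map (simplex_topology n) BG (bg_point n \<sigma>)"
proof -
  have "continuous_map (prod_topology (discrete_topology (nerve G n)) (simplex_topology n)) BG
      (\<lambda>z. realization_class (nerve G) nerve_act (n, z))"
    unfolding classifying_space_def geometric_realization_def
    by (rule continuous_map_final_topology) auto
  from continuous_map_compose[OF continuous_map_pairedI this, of "simplex_topology n" "\<lambda>t. \<sigma>" "\<lambda>t. t"] \<sigma>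
  show ?thesis by (simp add: o_def bg_point_def[abs_def])
qed

lemma openin_BG:
  assumes V: "V \<subseteq> topspace BG"
    and open_slices: "\<And>n \<sigma>. \<sigma> \<in> nerve G n \<Longrightarrow> openin (simplex_topology n) {t \<in> standard_simplex n. bg_point n \<sigma> t \<in> V}"
  shows "openin BG V"
  unfolding classifying_space_def geometric_realization_def openin_final_topology
proof (intro conjI allI)
  show "V \<subseteq> realization_class (nerve G) nerve_act ` (SIGMA n:UNIV. nerve G n \<times> standard_simplex n)"
    using V unfolding topspace_BG bg_point_def by force
  fix n
  let ?P = "prod_topology (discrete_topology (nerve G n)) (simplex_topology n)"
  have "openin ?P (\<Union>\<sigma>\<in>nerve G n. {\<sigma>} \<times> {t \<in> standard_simplex n. bg_point n \<sigma> t \<in> V})"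
    using open_slices by (intro openin_Union) (auto simp: openin_prod_Times_iff)
  moreover have "(\<Union>\<sigma>\<in>nerve G n. {\<sigma>} \<times> {t \<in> standard_simplex n. bg_point n \<sigma> t \<in> V}) =
      {z \<in> topspace ?P. realization_class (nerve G) nerve_act (n, z) \<in> V}"
    by (auto simp: bg_point_def)
  ultimately show "openin ?P {z \<in> topspace ?P. realization_class (nerve G) nerve_act (n, z) \<in> V}" by simp
qed

text \<open>
  Open subsets of simplices are locally compact, hence k-spaces, and they determine the topology of open
  subsets of \<open>BG\<close>.
\<close>

lemma k_space_BG_open:
  assumes U: "openin BG U"
  shows "k_space (subtopology BG U)"
proof (rule k_space_openI)
  fix S assume S: "openin (kification (subtopology BG U)) S"
  have UB: "U \<subseteq> topspace BG" using U openin_subset by blast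
  have SU: "S \<subseteq> U" using openin_subset[OF S] by auto
  have "openin BG S"
  proof (rule openin_BG)
    show "S \<subseteq> topspace BG" using SU UB by blast
    fix n \<sigma> assume \<sigma>: "\<sigma> \<in> nerve G n"
    let ?V = "{t \<in> standard_simplex n. bg_point n \<sigma> t \<in> U}"
    have V: "openin (simplex_topology n) ?V"
      using openin_continuous_map_preimage[OF continuous_map_bg_point[OF \<sigma>] U] by simp
    have "continuous_map (subtopology (simplex_topology n) ?V) (subtopology BG U) (bg_point n \<sigma>)"
      using continuous_map_from_subtopology[OF continuous_map_bg_point[OF \<sigma>]]
      by (auto simp: continuous_map_in_subtopology)
    then have "continuous_map (subtopology (simplex_topology n) ?V) (kification (subtopology BG U)) (bg_point n \<sigma>)"
      by (simp add: continuous_map_into_kification[OF k_space_simplex_open[OF V]])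
    from openin_continuous_map_preimage[OF this S]
    have "openin (simplex_topology n) {t \<in> topspace (subtopology (simplex_topology n) ?V). bg_point n \<sigma> t \<in> S}"
      using V openin_trans_full by blast
    moreover have "{t \<in> topspace (subtopology (simplex_topology n) ?V). bg_point n \<sigma> t \<in> S}
        = {t \<in> standard_simplex n. bg_point n \<sigma> t \<in> S}"
      using SU by auto
    ultimately show "openin (simplex_topology n) {t \<in> standard_simplex n. bg_point n \<sigma> t \<in> S}" by simp
  qed
  then show "openin (subtopology BG U) S"
    using SU by (metis inf.absorb1 openin_subtopology_Int)
qed

sublocale covering: finite_covering "step_functions (carrier G)" disagreement BG fiber "card (carrier G)"
proof -
  interpret Metric_space "step_functions (carrier G)" disagreement by (rule Metric_space_step_functions)
  show "finite_covering (step_functions (carrier G)) disagreement BG fiber (card (carrier G))"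
  proof
    fix b assume "b \<in> topspace BG"
    then obtain n \<sigma> t where b: "b = bg_point n \<sigma> t" "\<sigma> \<in> nerve G n" "t \<in> standard_simplex n" by (rule topspace_BG_E)
    show "fiber b \<subseteq> step_functions (carrier G)"
      using step_fun_in[OF vertices_in[OF b(2)] b(3)] by (auto simp: b(1) fiber_bg_point)
    show "card (fiber b) = card (carrier G)"
      unfolding b(1) fiber_bg_point by (rule card_image[OF step_fun_translate_inj[OF b(2,3)]])
    show "1 \<le> disagreement u v" if "u \<in> fiber b" "v \<in> fiber b" "u \<noteq> v" for u v
      using that disagreement_translate[OF b(2,3)] by (fastforce simp: b(1) fiber_bg_point)
  next
    show "0 < card (carrier G)" using finite_carrier by (auto simp: card_gt_0_iff)
    fix V assume V: "openin mtopology V"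
    show "openin BG {b \<in> topspace BG. fiber b \<inter> V \<noteq> {}}"
    proof (rule openin_BG)
      fix n \<sigma> assume \<sigma>: "\<sigma> \<in> nerve G n"
      have "openin (simplex_topology n) (\<Union>g\<in>carrier G. {t \<in> topspace (simplex_topology n). step_fun (\<lambda>i. g \<otimes> \<sigma> (0, i)) t \<in> V})"
        using openin_continuous_map_preimage[OF continuous_map_step_fun[OF vertices_in[OF \<sigma>]] V]
        by (intro openin_Union) auto
      moreover have "(\<Union>g\<in>carrier G. {t \<in> topspace (simplex_topology n). step_fun (\<lambda>i. g \<otimes> \<sigma> (0, i)) t \<in> V})
        = {t \<in> standard_simplex n. bg_point n \<sigma> t \<in> {b \<in> topspace BG. fiber b \<inter> V \<noteq> {}}}"
        using \<sigma> by (auto simp: fiber_bg_point topspace_BG)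
      ultimately show "openin (simplex_topology n) {t \<in> standard_simplex n. bg_point n \<sigma> t \<in> {b \<in> topspace BG. fiber b \<inter> V \<noteq> {}}}"
        by simp
    qed auto
  qed
qed

lemma continuous_map_contraction:
  assumes a: "a \<in> {..n} \<rightarrow> carrier G"
  shows "continuous_map (prod_topology (simplex_topology n) unit_interval) BG (\<lambda>(t, s). contraction n a t s)"
proof -
  have "case_nat \<one> a \<in> {..Suc n} \<rightarrow> carrier G" using a by (auto split: nat.splits)
  from continuous_map_compose[OF continuous_map_cone_point continuous_map_bg_point[OF edges_in_nerve[OF this]]]
  show ?thesis by (simp add: contraction_def o_def case_prod_unfold)
qed

text \<open>
  For openness in the total space it suffices to find an open set of \<open>BG\<close>, because close to \<open>u0\<close> there
  is only one point in each fibre. Openness in \<open>BG\<close> is checked on simplices, where the path is given by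
  an explicit continuous formula.
\<close>

lemma path_family_contract: "path_family (covering.total BG id) BG (\<lambda>(b, u). contract b u)"
proof (rule path_familyI)
  let ?E = "covering.total BG id"
  have E: "topspace ?E = {(b, u). b \<in> topspace BG \<and> u \<in> fiber b}"
    using covering.topspace_total[of BG id] by simp
  have contr: "path_family (simplex_topology n) BG (\<lambda>t. contraction n (\<lambda>i. g \<otimes> \<sigma> (0, i)) t)"
    if "\<sigma> \<in> nerve G n" "g \<in> carrier G" for n \<sigma> g
    by (rule path_family_of_homotopy[OF continuous_map_contraction[OF vertices_in[OF that]]])
  show "continuous_map unit_interval BG ((\<lambda>(b, u). contract b u) z)" if zE: "z \<in> topspace ?E" for z
  proof -
    obtain b u where z: "z = (b, u)" "b \<in> topspace BG" "u \<in> fiber b" using zE E by auto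
    obtain n \<sigma> t where b: "b = bg_point n \<sigma> t" "\<sigma> \<in> nerve G n" "t \<in> standard_simplex n"
      using z(2) by (rule topspace_BG_E)
    obtain g where g: "g \<in> carrier G" "u = step_fun (\<lambda>i. g \<otimes> \<sigma> (0, i)) t" using z(3) b by (auto simp: fiber_bg_point)
    have "continuous_map unit_interval BG (contraction n (\<lambda>i. g \<otimes> \<sigma> (0, i)) t)"
      using path_family_path[OF contr[OF b(2) g(1)]] b(3) by simp
    then show ?thesis
      by (rule continuous_map_eq) (simp add: z(1) g(2) b(1) contract_bg_point[OF b(2,3) g(1)])
  qed
  fix K :: "real set" and V assume K: "compact K" "K \<subseteq> {0..1}" and V: "openin BG V"
  show "openin ?E {z \<in> topspace ?E. (\<lambda>(b, u). contract b u) z ` K \<subseteq> V}"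
  proof (subst openin_subopen, intro ballI)
    fix z assume "z \<in> {z \<in> topspace ?E. (\<lambda>(b, u). contract b u) z ` K \<subseteq> V}"
    then obtain b0 u0 where z: "z = (b0, u0)" "b0 \<in> topspace BG" "u0 \<in> fiber b0" "contract b0 u0 ` K \<subseteq> V"
      using E by auto
    have u0: "u0 \<in> step_functions (carrier G)" using z covering.fib_in by blast
    let ?W = "covering.mball u0 (1/2)"
    define O' where "O' = {b \<in> topspace BG. \<exists>u\<in>fiber b. u \<in> ?W \<and> contract b u ` K \<subseteq> V}"
    have "openin BG O'"
    proof (rule openin_BG)
      fix n \<sigma> assume \<sigma>: "\<sigma> \<in> nerve G n"
      let ?u = "\<lambda>g. step_fun (\<lambda>i. g \<otimes> \<sigma> (0, i))"
      let ?T = "topspace (simplex_topology n)"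
      let ?S = "\<lambda>g. {t \<in> ?T. ?u g t \<in> ?W} \<inter> {t \<in> ?T. contraction n (\<lambda>i. g \<otimes> \<sigma> (0, i)) t ` K \<subseteq> V}"
      have "openin (simplex_topology n) (?S g)" if "g \<in> carrier G" for g
        using openin_continuous_map_preimage[OF continuous_map_step_fun[OF vertices_in[OF \<sigma> that]] covering.openin_mball]
          path_family_openin[OF contr[OF \<sigma> that] K V] by (rule openin_Int)
      then have "openin (simplex_topology n) (\<Union>g\<in>carrier G. ?S g)" by (intro openin_Union) auto
      moreover have "(\<Union>g\<in>carrier G. ?S g) = {t \<in> standard_simplex n. bg_point n \<sigma> t \<in> O'}"
      proof -
        have "contract (bg_point n \<sigma> t) (?u g t) ` K = contraction n (\<lambda>i. g \<otimes> \<sigma> (0, i)) t ` K"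
          if "t \<in> standard_simplex n" "g \<in> carrier G" for t g
          unfolding contract_bg_point[OF \<sigma> that] using K by (intro image_cong) auto
        moreover have "bg_point n \<sigma> t \<in> topspace BG" if "t \<in> standard_simplex n" for t
          using \<sigma> that by (auto simp: topspace_BG)
        ultimately have "bg_point n \<sigma> t \<in> O' \<longleftrightarrow>
            (\<exists>g\<in>carrier G. ?u g t \<in> ?W \<and> contraction n (\<lambda>i. g \<otimes> \<sigma> (0, i)) t ` K \<subseteq> V)"
          if "t \<in> standard_simplex n" for t
          using that unfolding O'_def mem_Collect_eq fiber_bg_point bex_simps by (simp cong: bex_cong)
        then show ?thesis by auto
      qed
      ultimately show "openin (simplex_topology n) {t \<in> standard_simplex n. bg_point n \<sigma> t \<in> O'}" by simp
    qed (auto simp: O'_def)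
    then have "openin ?E (topspace ?E \<inter> O' \<times> ?W)"
      by (rule covering.openin_total_Times[OF _ covering.openin_mball])
    moreover have "z \<in> topspace ?E \<inter> O' \<times> ?W"
      using z u0 E by (auto simp: O'_def intro!: bexI[of _ u0])
    moreover have "topspace ?E \<inter> O' \<times> ?W \<subseteq> {z \<in> topspace ?E. (\<lambda>(b, u). contract b u) z ` K \<subseteq> V}"
    proof
      fix z assume z: "z \<in> topspace ?E \<inter> O' \<times> ?W"
      then obtain b v where v: "z = (b, v)" "b \<in> O'" "v \<in> fiber b" "v \<in> ?W" using E by auto
      then obtain u where u: "b \<in> topspace BG" "u \<in> fiber b" "u \<in> ?W" "contract b u ` K \<subseteq> V" by (auto simp: O'_def)
      have "u = v" using covering.fib_unique[OF u(1,2) v(3) u0] u(3) v(4) by auto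
      then show "z \<in> {z \<in> topspace ?E. (\<lambda>(b, u). contract b u) z ` K \<subseteq> V}" using u v z by auto
    qed
    ultimately show "\<exists>T. openin ?E T \<and> z \<in> T \<and> T \<subseteq> {z \<in> topspace ?E. (\<lambda>(b, u). contract b u) z ` K \<subseteq> V}"
      by blast
  qed
qed

definition bg_base where "bg_base = bg_point 0 (edges G 0 (\<lambda>_. \<one>)) (\<lambda>i. if i = 0 then 1 else 0)"

text \<open>
  Both ends are faces of the join: the additional vertex and the simplex itself.
\<close>

lemma contract_ends:
  assumes "b \<in> topspace BG" "u \<in> fiber b"
  shows "contract b u 0 = bg_base" and "contract b u 1 = b"
proof -
  obtain n \<sigma> t where b: "b = bg_point n \<sigma> t" "\<sigma> \<in> nerve G n" "t \<in> standard_simplex n"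
    using assms(1) by (rule topspace_BG_E)
  obtain g where g: "g \<in> carrier G" "u = step_fun (\<lambda>i. g \<otimes> \<sigma> (0, i)) t"
    using assms(2) b by (auto simp: fiber_bg_point)
  let ?a = "\<lambda>i. g \<otimes> \<sigma> (0, i)"
  have edges: "edges G (Suc n) (case_nat \<one> ?a) \<in> nerve G (Suc n)"
    using vertices_in[OF b(2) g(1)] by (intro edges_in_nerve) (auto split: nat.splits)
  have c: "contract b u s = contraction n ?a t s" if "s \<in> {0..1}" for s
    using that contract_bg_point[OF b(2,3) g(1)] by (simp add: b(1) g(2))
  have "bg_point 0 (nerve_act 0 (\<lambda>i. i) (edges G (Suc n) (case_nat \<one> ?a))) (\<lambda>i. if i = 0 then 1 else 0)
      = bg_point (Suc n) (edges G (Suc n) (case_nat \<one> ?a)) (simplex_push 0 (\<lambda>i. i) (\<lambda>i. if i = 0 then 1 else 0))"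
    by (rule bg_point_glue[OF _ _ edges]) (auto simp: mono_on_def standard_simplex_def)
  moreover have "simplex_push 0 (\<lambda>i. i) (\<lambda>i. if i = 0 then 1 else 0) = cone_point 0 t"
  proof
    fix j :: nat
    have "{i. i \<le> 0 \<and> i = j} = (if j = 0 then {0} else {})" by auto
    then show "simplex_push 0 (\<lambda>i. i) (\<lambda>i. if i = 0 then 1 else 0) j = cone_point 0 t j"
      by (cases j) (auto simp: simplex_push_def cone_point_def)
  qed
  moreover have "nerve_act 0 (\<lambda>i. i) (edges G (Suc n) (case_nat \<one> ?a)) = edges G 0 (\<lambda>_. \<one>)"
    unfolding nerve_act_def edges_def by (intro restrict_ext) auto
  ultimately show "contract b u 0 = bg_base" by (simp add: c contraction_def bg_base_def)
  have "bg_point n (nerve_act n Suc (edges G (Suc n) (case_nat \<one> ?a))) t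
      = bg_point (Suc n) (edges G (Suc n) (case_nat \<one> ?a)) (simplex_push n Suc t)"
    by (rule bg_point_glue[OF _ _ edges b(3)]) (auto simp: mono_on_def)
  moreover have "simplex_push n Suc t = cone_point 1 t"
  proof
    fix j :: nat
    show "simplex_push n Suc t j = cone_point 1 t j"
    proof (cases j)
      case 0
      then show ?thesis by (simp add: simplex_push_def cone_point_def)
    next
      case (Suc k)
      have "{i. i \<le> n \<and> Suc i = Suc k} = (if k \<le> n then {k} else {})" by auto
      then show ?thesis using b(3) by (auto simp: Suc simplex_push_def cone_point_def standard_simplex_def)
    qed
  qed
  moreover have "nerve_act n Suc (edges G (Suc n) (case_nat \<one> ?a)) = \<sigma>"
    using nerve_act_edges[of Suc n "Suc n" "case_nat \<one> ?a"] edges_vertices[OF b(2) g(1)]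
    by (simp add: mono_on_def Pi_iff)
  ultimately have "contraction n ?a t 1 = b" by (simp add: contraction_def b(1))
  then show "contract b u 1 = b" by (simp add: c)
qed

end

section \<open>Comparison of the two categories\<close>

context finite_covering
begin

text \<open>
  The path from \<open>x0\<close> to \<open>x\<close> runs through the image under \<open>g\<close> of the contraction path of the point over
  \<open>f x\<close>, which ends at \<open>g (f x)\<close>, and then along the homotopy to \<open>x\<close>. To make it start at \<open>x0\<close> instead of
  \<open>g c\<close>, it is preceded by the reverse of one such path that ends at \<open>x0\<close>.
\<close>

lemma based_path_family:
  assumes f: "continuous_map X B f" and g: "continuous_map B X g"
    and gf: "homotopic_with (\<lambda>_. True) X X (g \<circ> f) id"
    and K: "path_family (total B id) B K"
    and ends: "\<And>b u. b \<in> topspace B \<Longrightarrow> u \<in> fib b \<Longrightarrow> K (b, u) 0 = c \<and> K (b, u) 1 = b"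
    and x0: "x0 \<in> topspace X"
  shows "\<exists>\<Gamma>. path_family (total X f) X \<Gamma> \<and>
    (\<forall>x\<in>topspace X. \<forall>u\<in>fib (f x). \<Gamma> (x, u) 0 = x0 \<and> \<Gamma> (x, u) 1 = x)"
proof -
  obtain k where k: "continuous_map (prod_topology unit_interval X) X k"
    and k0: "\<And>x. k (0, x) = g (f x)" and k1: "\<And>x. k (1, x) = x"
    using gf unfolding homotopic_with_def by (auto simp: o_def)
  let ?E = "total X f"
  have E: "topspace ?E = {(x, u). x \<in> topspace X \<and> u \<in> fib (f x)}" by (rule topspace_total[OF f])
  have fB: "f x \<in> topspace B" if "x \<in> topspace X" for x using f that by (auto simp: continuous_map_def)
  have "continuous_map ?E (total B id) (\<lambda>z. (f (fst z), snd z))"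
  proof (rule continuous_map_into_total)
    show "continuous_map ?E B (\<lambda>z. f (fst z))"
      using continuous_map_compose[OF continuous_map_total_fst f] by (simp add: o_def)
  qed (auto simp: continuous_map_total_snd E)
  from path_family_compose[OF path_family_reindex[OF K this] g]
  have 1: "path_family ?E X (\<lambda>z t. g (K (f (fst z), snd z) t))" .
  have 2: "path_family ?E X (\<lambda>z t. k (t, fst z))"
  proof (rule path_family_of_homotopy)
    have "continuous_map (prod_topology ?E unit_interval) (prod_topology unit_interval X) (\<lambda>w. (snd w, fst (fst w)))"
      using continuous_map_compose[OF continuous_map_fst continuous_map_total_fst]
      by (intro continuous_map_pairedI continuous_map_snd) (simp add: o_def)
    from continuous_map_compose[OF this k]
    show "continuous_map (prod_topology ?E unit_interval) X (\<lambda>(z, t). k (t, fst z))"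
      by (simp add: o_def case_prod_unfold)
  qed
  define Q where "Q z = path_concat (\<lambda>t. g (K (f (fst z), snd z) t)) (\<lambda>t. k (t, fst z))" for z
  have Q: "path_family ?E X Q"
    unfolding Q_def using ends fB by (intro path_family_concat 1 2) (auto simp: E k0)
  have Q_ends: "Q (x, u) 0 = g c" "Q (x, u) 1 = x" if "x \<in> topspace X" "u \<in> fib (f x)" for x u
    using that ends fB by (auto simp: Q_def path_concat_def k1)
  obtain u0 where u0: "u0 \<in> fib (f x0)" using fib_nonempty[OF fB[OF x0]] by blast
  have "continuous_map unit_interval X (Q (x0, u0))" using path_family_path[OF Q] x0 u0 E by auto
  from continuous_map_compose[OF continuous_map_interval_reverse this]
  have "continuous_map unit_interval X (\<lambda>t. Q (x0, u0) (1 - t))" by (simp add: o_def)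
  then have "path_family ?E X (\<lambda>z. path_concat (\<lambda>t. Q (x0, u0) (1 - t)) (Q z))"
    using Q_ends x0 u0 by (intro path_family_concat path_family_const Q) (auto simp: E)
  then show ?thesis
    using Q_ends x0 u0 by (intro exI[of _ "\<lambda>z. path_concat (\<lambda>t. Q (x0, u0) (1 - t)) (Q z)"])
      (auto simp: path_concat_def)
qed

end

theorem theorem1p3:
  fixes G :: "('g, 'b) monoid_scheme"
    and M :: "'x set" and d :: "'x \<Rightarrow> 'x \<Rightarrow> real"
  assumes "group G" and "finite (carrier G)"
    and "b0 \<in> topspace (classifying_space G)"
    and "Metric_space M d"
    and "Metric_space.mtopology M d homotopy_equivalent_space classifying_space G"
    and "x0 \<in> M"
  shows "analog_category (classifying_space G) b0 = distributional_category M d x0"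
proof -
  interpret finite_group G
    using assms(1,2) by (simp add: finite_group_def finite_group_axioms_def)
  interpret M: Metric_space M d by fact
  let ?X = "M.mtopology"
  obtain f g where f: "continuous_map ?X BG f" and g: "continuous_map BG ?X g"
    and gf: "homotopic_with (\<lambda>_. True) ?X ?X (g \<circ> f) id" and fg: "homotopic_with (\<lambda>_. True) BG BG (f \<circ> g) id"
    using assms(5) unfolding homotopy_equivalent_space_def by blast
  have ends: "(\<lambda>(b, u). contract b u) (b, u) 0 = bg_base \<and> (\<lambda>(b, u). contract b u) (b, u) 1 = b"
    if "b \<in> topspace BG" "u \<in> fiber b" for b u
    using contract_ends[OF that] by simp
  have "homotopic_with (\<lambda>_. True) BG BG (id \<circ> id) id" by simp
  from covering.based_path_family[OF continuous_map_id continuous_map_id this path_family_contract ends assms(3)]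
  obtain \<Gamma> where \<Gamma>: "path_family (covering.total BG id) BG \<Gamma>"
    and \<Gamma>_ends: "\<And>b u. b \<in> topspace BG \<Longrightarrow> u \<in> fiber b \<Longrightarrow> \<Gamma> (b, u) 0 = b0 \<and> \<Gamma> (b, u) 1 = b" by auto
  have x0: "x0 \<in> topspace ?X" using assms(6) by simp
  from covering.based_path_family[OF f g gf path_family_contract ends x0]
  obtain \<Delta> where \<Delta>: "path_family (covering.total ?X f) ?X \<Delta>"
    and \<Delta>_ends: "\<And>x u. x \<in> M \<Longrightarrow> u \<in> fiber (f x) \<Longrightarrow> \<Delta> (x, u) 0 = x0 \<and> \<Delta> (x, u) 1 = x" by auto
  have transfer: "(\<exists>T. covering.weights n BG id T) \<longleftrightarrow> (\<exists>T. covering.weights n ?X f T)" for n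
    using covering.weights_homotopy_transfer[OF f g fg, of n] covering.weights_pullback[OF _ f, of n id] by auto
  have "(\<exists>s. continuous_map BG (analog_fiber_measures n (based_path_space BG b0) BG (\<lambda>\<gamma>. \<gamma> 1)) s \<and>
        (\<forall>b\<in>topspace BG. fiber_projection (\<lambda>\<gamma>. \<gamma> 1) (s b) = b)) \<longleftrightarrow>
      (\<exists>s. continuous_map ?X (distributional_fiber_measures n (based_paths ?X x0) (path_dist d) ?X (\<lambda>\<gamma>. \<gamma> 1)) s \<and>
        (\<forall>x\<in>topspace ?X. fiber_projection (\<lambda>\<gamma>. \<gamma> 1) (s x) = x))" for n
    using covering.analog_sections_iff_weights[OF k_space_BG_open assms(3) \<Gamma> \<Gamma>_ends, of n]
      covering.distributional_sections_iff_weights[OF assms(4,6) f \<Delta> \<Delta>_ends, of n] transfer[of n]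
    by (simp only:)
  then show ?thesis
    unfolding analog_category_def distributional_category_def analog_sectional_category_def
      distributional_sectional_category_def by (simp only:)
qed

end
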